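(* Let $1< p < \infty$, $m_0 \in \mathbb{N}$, $m_1 \in \mathbb{N}_0$, $0 \le \ell < d$, and $a_0 \in \mathbb{R}$. Suppose $$\frac{d}{2p} \le m_0 < \frac dp, \qquad m_1 \le 2 m_0 -\frac dp, \qquad \text{and}\qquad a_1:= 2\Big(a_0 - \frac{d}{2p} \Big).$$ Then there exists a constant $c$ such that $$\|u\cdot v|\mathcal{K}^{m_1}_{a_1,p} (\mathbb{R}^d,\mathbb{R}^\ell_* )\|\le c \, \|u|\mathcal{K}^{m_0}_{a_0,p} (\mathbb{R}^d,\mathbb{R}^\ell_* )\| \, \|v|\mathcal{K}^{m_0}_{a_0,p} (\mathbb{R}^d,\mathbb{R}^\ell_* )\|$$ holds for all $u, v \in \mathcal{K}^{m_0}_{a_0,p} (\mathbb{R}^d,\mathbb{R}^\ell_* )$.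
   Context: $\mathbb{N}=\{1,2,\dots\}$, $\mathbb{N}_0=\mathbb{N}\cup\{0\}$. For an integer $0\le\ell<d$ put $\mathbb{R}^\ell_*=\{x\in\mathbb{R}^d: x_1=\dots=x_{d-\ell}=0\}$ (so $\mathbb{R}^0_*=\{0\}$) and $\rho(x)=\min\big(1,(\sum_{i=1}^{d-\ell}|x_i|^2)^{1/2}\big)$. For $m\in\mathbb{N}_0$, $a\in\mathbb{R}$, $1\le p<\infty$, the Kondratiev space $\mathcal{K}^m_{a,p}(\mathbb{R}^d,\mathbb{R}^\ell_* )$ consists of all measurable functions $u$ on $\mathbb{R}^d\setminus\mathbb{R}^\ell_*$ having weak derivatives $\partial^\alpha u$, $|\alpha|\le m$, in $\mathbb{R}^d\setminus\mathbb{R}^\ell_*$ with $\|u|\mathcal{K}^m_{a,p}(\mathbb{R}^d,\mathbb{R}^\ell_* )\|=\big(\sum_{|\alpha|\le m}\int_{\mathbb{R}^d\setminus\mathbb{R}^\ell_*}|\rho(x)^{|\alpha|-a}\partial^\alpha u(x)|^p\,dx\big)^{1/p}<\infty$. *)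

theory Defs
  imports "HOL-Analysis.Analysis"
begin

section \<open>Test functions and weak derivatives\<close>

definition partial_deriv :: "'n::finite \<Rightarrow> (real^'n \<Rightarrow> real) \<Rightarrow> real^'n \<Rightarrow> real" where
  "partial_deriv i f x = deriv (\<lambda>t. f (x + t *\<^sub>R axis i 1)) 0"

text \<open>Differentiability of every iterated partial derivative, taken in any order, is the same
  as existence and continuity of the partial derivatives of all orders.\<close>

definition smooth_fun :: "(real^'n::finite \<Rightarrow> real) \<Rightarrow> bool" where
  "smooth_fun f \<longleftrightarrow> (\<forall>is. foldr partial_deriv is f differentiable_on UNIV)"

definition test_functions :: "(real^'n::finite) set \<Rightarrow> (real^'n \<Rightarrow> real) set" where
  "test_functions \<Omega> = {\<phi>. smooth_fun \<phi> \<and>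
     compact (closure {x. \<phi> x \<noteq> 0}) \<and> closure {x. \<phi> x \<noteq> 0} \<subseteq> \<Omega>}"

text \<open>The linear order on the index type only serves to number the coordinates from first to
  last.  A multi-index is a function \<open>\<alpha>\<close> from indices to naturals.\<close>

definition coords :: "'n::{finite,linorder} list" where
  "coords = sorted_list_of_set UNIV"

definition mi_order :: "('n::finite \<Rightarrow> nat) \<Rightarrow> nat" where
  "mi_order \<alpha> = (\<Sum>i\<in>UNIV. \<alpha> i)"

definition multi_deriv ::
    "('n \<Rightarrow> nat) \<Rightarrow> (real^'n::{finite,linorder} \<Rightarrow> real) \<Rightarrow> real^'n::{finite,linorder} \<Rightarrow> real" where
  "multi_deriv \<alpha> f = foldr (\<lambda>i. partial_deriv i ^^ \<alpha> i) coords f"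

definition locally_integrable_on ::
    "(real^'n::finite \<Rightarrow> 'a::{banach,second_countable_topology}) \<Rightarrow> (real^'n) set \<Rightarrow> bool" where
  "locally_integrable_on u \<Omega> \<longleftrightarrow> (\<forall>K. compact K \<and> K \<subseteq> \<Omega> \<longrightarrow> set_integrable lebesgue K u)"

text \<open>Real-valued test functions suffice also for complex-valued \<open>u\<close>, by linearity.\<close>

definition has_weak_deriv :: "(real^'n::{finite,linorder} \<Rightarrow> 'a::{banach,second_countable_topology}) \<Rightarrow>
    ('n \<Rightarrow> nat) \<Rightarrow> (real^'n::{finite,linorder} \<Rightarrow> 'a) \<Rightarrow> (real^'n::{finite,linorder}) set \<Rightarrow> bool" where
  "has_weak_deriv u \<alpha> w \<Omega> \<longleftrightarrow>
     locally_integrable_on u \<Omega> \<and> locally_integrable_on w \<Omega> \<and>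
     (\<forall>\<phi>\<in>test_functions \<Omega>.
        (LINT x:\<Omega>|lebesgue. multi_deriv \<alpha> \<phi> x *\<^sub>R u x) =
        (- 1) ^ mi_order \<alpha> *\<^sub>R (LINT x:\<Omega>|lebesgue. \<phi> x *\<^sub>R w x))"

text \<open>Weak derivatives are unique only up to null sets, so this picks a representative.  It is
  meaningful only if a weak derivative exists.\<close>

definition weak_deriv :: "(real^'n::{finite,linorder}) set \<Rightarrow> ('n \<Rightarrow> nat) \<Rightarrow>
    (real^'n::{finite,linorder} \<Rightarrow> 'a::{banach,second_countable_topology}) \<Rightarrow> real^'n::{finite,linorder} \<Rightarrow> 'a" where
  "weak_deriv \<Omega> \<alpha> u = (SOME w. has_weak_deriv u \<alpha> w \<Omega>)"


section \<open>Kondratiev spaces\<close>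

text \<open>With \<open>d = CARD('n)\<close>, the coordinates \<open>x\<^sub>1, \<dots>, x\<^sub>d\<^sub>-\<^sub>\<ell>\<close>, which vanish on the singular set.\<close>

definition normal_coords :: "nat \<Rightarrow> 'n::{finite,linorder} set" where
  "normal_coords l = set (take (CARD('n) - l) coords)"

definition singular_set :: "nat \<Rightarrow> (real^'n::{finite,linorder}) set" where
  "singular_set l = {x. \<forall>i\<in>normal_coords l. x $ i = 0}"

definition rho :: "nat \<Rightarrow> real^'n::{finite,linorder} \<Rightarrow> real" where
  "rho l x = min 1 (sqrt (\<Sum>i\<in>normal_coords l. \<bar>x $ i\<bar>\<^sup>2))"

definition kondratiev_integrand :: "real \<Rightarrow> real \<Rightarrow> nat \<Rightarrow> ('n \<Rightarrow> nat) \<Rightarrow>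
    (real^'n::{finite,linorder} \<Rightarrow> 'a::{banach,second_countable_topology}) \<Rightarrow> real^'n::{finite,linorder} \<Rightarrow> real" where
  "kondratiev_integrand a p l \<alpha> u x =
     (rho l x powr (real (mi_order \<alpha>) - a) * norm (weak_deriv (- singular_set l) \<alpha> u x)) powr p"

text \<open>Elements are functions rather than classes modulo null sets; their values on the singular
  set are irrelevant.\<close>

definition kondratiev_space :: "nat \<Rightarrow> real \<Rightarrow> real \<Rightarrow> nat \<Rightarrow>
    (real^'n::{finite,linorder} \<Rightarrow> 'a::{banach,second_countable_topology}) set" where
  "kondratiev_space m a p l = {u.
     u \<in> borel_measurable (lebesgue_on (- singular_set l)) \<and>
     (\<forall>\<alpha>. mi_order \<alpha> \<le> m \<longrightarrow>
        (\<exists>w. has_weak_deriv u \<alpha> w (- singular_set l)) \<and>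
        set_integrable lebesgue (- singular_set l) (kondratiev_integrand a p l \<alpha> u))}"

definition kondratiev_norm :: "nat \<Rightarrow> real \<Rightarrow> real \<Rightarrow> nat \<Rightarrow>
    (real^'n::{finite,linorder} \<Rightarrow> 'a::{banach,second_countable_topology}) \<Rightarrow> real" where
  "kondratiev_norm m a p l u =
     (\<Sum>\<alpha> | mi_order \<alpha> \<le> m.
        LINT x:- singular_set l|lebesgue. kondratiev_integrand a p l \<alpha> u x) powr (1 / p)"

text \<open>The sum in the norm ranges over a finite set, as it should.\<close>

lemma finite_mi_order_le: "finite {\<alpha> :: 'n::finite \<Rightarrow> nat. mi_order \<alpha> \<le> m}"
proof (rule finite_subset)
  have "\<alpha> i \<le> mi_order \<alpha>" for \<alpha> :: "'n \<Rightarrow> nat" and i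
    unfolding mi_order_def by (rule member_le_sum) auto
  then show "{\<alpha> :: 'n \<Rightarrow> nat. mi_order \<alpha> \<le> m} \<subseteq> (UNIV :: 'n set) \<rightarrow>\<^sub>E {..m}"
    by (auto intro: order_trans)
  show "finite ((UNIV :: 'n set) \<rightarrow>\<^sub>E {..m})"
    by (intro finite_PiE) auto
qed

lemma card_normal_coords:
  assumes "l < CARD('n)"
  shows "card (normal_coords l :: 'n::{finite,linorder} set) = CARD('n) - l"
  unfolding normal_coords_def coords_def
  by (subst distinct_card) (auto simp: distinct_take)

end

theory Submission
  imports Defs
begin

text \<open>
  With respect to the measure \<open>rho powr (- d) dx\<close> the norm of \<open>u\<close> is the \<open>p\<close>-norm of the functions
  \<open>rho powr (\<bar>\<beta>\<bar> - a + d / p) * D\<^sup>\<beta> u\<close>, in which \<open>p\<close> enters the weight only through a fixed shift.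
  The Gagliardo-Nirenberg-Sobolev inequality for \<open>rho powr s * f\<close> bounds \<open>rho powr s * f\<close> in the
  Sobolev exponent by the \<open>p\<close>-norms of \<open>rho powr (s - 1) * f\<close> and of \<open>rho powr s\<close> times the gradient,
  because the gradient of the distance is bounded; near the singular set the first of these norms
  also pays for the cutoff functions, so no boundary term arises.  Iterating, a derivative of order
  \<open>b\<close> gains integrability up to \<open>1 / q = 1 / p - (m0 - b) / d\<close> in the same weighted scale.  Since
  \<open>m1 \<le> 2 * m0 - d / p\<close>, the gains available for \<open>D\<^sup>\<beta> u\<close> and \<open>D\<^sup>\<gamma> v\<close> with \<open>\<bar>\<beta>\<bar> + \<bar>\<gamma>\<bar> \<le> m1\<close> suffice for
  Young's inequality, which puts the product into the \<open>p\<close>-norm with weight shift \<open>a1\<close>.  Everything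
  is transferred from smooth functions by convolution: along a suitable sequence of mollifiers
  finitely many integrable functions are approximated almost everywhere under an integrable bound,
  and Jensen's inequality turns this into bounds for their powers.
\<close>

text \<open>The value of \<open>a1\<close> is forced by homogeneity. The scale-invariant weights of
  the two factors add up to (|\<beta>| - a0 + d/p) + (|\<gamma>| - a0 + d/p); one of the shifts d/p
  belongs to the product, which leaves |\<beta>| + |\<gamma>| - a1. Three obstacles shape the proof.
  The functions are only locally integrable off the singular set, so they can be mollified only on a
  compact part of its complement; hence the weight is cut off first, with bounds independent of the
  cutoff, and Fatou's lemma removes the cutoff. Next, the measure \<open>rho powr (- d) dx\<close>
  is infinite, so surplus integrability cannot simply be discarded: an exponent larger than the
  conjugate one is brought down by interpolating with \<open>p\<close>. Finally, the product must be
  shown to have weak derivatives at all; the exponents behind the estimate also make every product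
  in the Leibniz rule locally integrable. The strict bound m0 < d/p keeps all Sobolev exponents
  finite and yields m1 < m0, so each factor of a Leibniz term has a derivative to spare.\<close>

section \<open>Hoelder's inequality with equal exponents on the extended nonnegative reals\<close>

definition epow :: "real \<Rightarrow> ennreal \<Rightarrow> ennreal" where
  "epow a x = (if x = \<infinity> then \<infinity> else ennreal (enn2real x powr a))"

lemma epow_ennreal: "0 \<le> r \<Longrightarrow> epow a (ennreal r) = ennreal (r powr a)"
  by (simp add: epow_def)

lemma epow_0 [simp]: "epow a 0 = 0"
  by (simp add: epow_def)

lemma epow_top [simp]: "epow a top = top"
  by (simp add: epow_def)

lemma epow_eq_0_iff: "epow a x = 0 \<longleftrightarrow> x = 0"
  by (cases x) (auto simp: epow_def)

lemma epow_measurable [measurable]: "epow a \<in> borel_measurable borel"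
  unfolding epow_def by measurable

lemma epow_mono:
  assumes "0 \<le> a" "x \<le> y" shows "epow a x \<le> epow a y"
  using assms by (cases x; cases y) (auto simp: epow_ennreal top_unique intro!: ennreal_leI powr_mono2)

text \<open>The arithmetic-geometric mean inequality for the normalised values
  \<open>h i / c i\<close>. The free scaling \<open>c\<close> is later set to the integrals of the
  \<open>h i\<close>, which turns the pointwise bound into Hoelder's inequality.\<close>

lemma prod_epow_le_sum:
  fixes c :: "'a \<Rightarrow> real"
  assumes S: "finite S" "S \<noteq> {}" and c: "\<And>i. i \<in> S \<Longrightarrow> 0 < c i"
  shows "(\<Prod>i\<in>S. epow (1 / card S) (h i)) \<le>
    (\<Prod>i\<in>S. ennreal (c i powr (1 / card S))) * (\<Sum>i\<in>S. ennreal (1 / (card S * c i)) * h i)"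
proof -
  have k: "0 < card S" using S by (simp add: card_gt_0_iff)
  show ?thesis
  proof (cases "\<exists>i\<in>S. h i = \<infinity>")
    case True
    then obtain j where j: "j \<in> S" "h j = top" by auto
    \<comment> \<open>Every coefficient is positive, so one infinite value makes the right-hand side
      infinite.\<close>
    have "ennreal (1 / (card S * c j)) * h j = top"
      using c[OF j(1)] k j by (simp add: ennreal_mult_top)
    then have "(\<Sum>i\<in>S. ennreal (1 / (card S * c i)) * h i) = top"
      using j S by (auto simp: sum.remove)
    moreover have "(\<Prod>i\<in>S. ennreal (c i powr (1 / card S))) \<noteq> 0"
      using c S by (auto simp: less_imp_neq[symmetric])
    ultimately show ?thesis by (simp add: ennreal_mult_eq_top_iff top_unique)
  next
    case False
    define r where "r i = enn2real (h i)" for i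
    have r: "h i = ennreal (r i)" if "i \<in> S" for i
      using False that by (auto simp: r_def less_top)
    have r0: "0 \<le> r i" for i by (simp add: r_def)
    let ?k = "1 / real (card S)"
    have "(\<Prod>i\<in>S. r i powr ?k) = (\<Prod>i\<in>S. c i powr ?k * (r i / c i) powr ?k)"
      using c r0 by (intro prod.cong) (simp_all add: powr_divide less_imp_le less_imp_neq[symmetric])
    also have "\<dots> = (\<Prod>i\<in>S. c i powr ?k) * (\<Prod>i\<in>S. r i / c i) powr ?k"
      using c r0 by (simp add: prod.distrib prod_powr_distrib less_imp_le)
    also have "\<dots> \<le> (\<Prod>i\<in>S. c i powr ?k) * (\<Sum>i\<in>S. (r i / c i) / card S)"
      using c r0 S by (intro mult_left_mono arith_geom_mean prod_nonneg) (simp_all add: less_imp_le)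
    also have "(\<Sum>i\<in>S. (r i / c i) / card S) = (\<Sum>i\<in>S. 1 / (card S * c i) * r i)"
      by (intro sum.cong) (auto simp: field_simps)
    finally have le: "(\<Prod>i\<in>S. r i powr ?k) \<le> (\<Prod>i\<in>S. c i powr ?k) * (\<Sum>i\<in>S. 1 / (card S * c i) * r i)" .
    have "(\<Prod>i\<in>S. epow ?k (h i)) = ennreal (\<Prod>i\<in>S. r i powr ?k)"
      using r r0 by (simp add: epow_ennreal prod_ennreal)
    also have "\<dots> \<le> ennreal ((\<Prod>i\<in>S. c i powr ?k) * (\<Sum>i\<in>S. 1 / (card S * c i) * r i))"
      by (rule ennreal_leI[OF le])
    also have "\<dots> = (\<Prod>i\<in>S. ennreal (c i powr ?k)) * (\<Sum>i\<in>S. ennreal (1 / (card S * c i)) * h i)"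
    proof -
      have "(\<Sum>i\<in>S. ennreal (1 / (card S * c i)) * h i) = (\<Sum>i\<in>S. ennreal (1 / (card S * c i) * r i))"
        using c r0 r by (intro sum.cong refl) (simp add: less_imp_le flip: ennreal_mult)
      also have "\<dots> = ennreal (\<Sum>i\<in>S. 1 / (card S * c i) * r i)"
        using c r0 by (intro sum_ennreal) (simp add: less_imp_le)
      finally show ?thesis
        using c r0 by (subst ennreal_mult) (auto simp: prod_ennreal less_imp_le intro!: sum_nonneg prod_nonneg)
    qed
    finally show ?thesis .
  qed
qed

text \<open>Normalising each \<open>h i\<close> by its integral makes the sum in
  \<open>prod_epow_le_sum\<close> integrate to 1. Integrals equal to 0 or infinity cannot be used
  for normalising and are taken out first.\<close>

lemma nn_integral_prod_epow_le:
  assumes S: "finite S" "S \<noteq> {}" and h [measurable]: "\<And>i. i \<in> S \<Longrightarrow> h i \<in> borel_measurable M"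
  shows "(\<integral>\<^sup>+x. (\<Prod>i\<in>S. epow (1 / card S) (h i x)) \<partial>M) \<le> (\<Prod>i\<in>S. epow (1 / card S) (\<integral>\<^sup>+x. h i x \<partial>M))"
proof -
  let ?k = "1 / real (card S)"
  have k: "0 < card S" using S by (simp add: card_gt_0_iff)
  \<comment> \<open>The zero case comes first: 0 times infinity is 0 in \<open>ennreal\<close>, so
    an infinite integral makes the right-hand side infinite only when no other factor
    vanishes.\<close>
  consider (zero) j where "j \<in> S" "(\<integral>\<^sup>+x. h j x \<partial>M) = 0"
    | (top) j where "j \<in> S" "(\<integral>\<^sup>+x. h j x \<partial>M) = top" "\<And>i. i \<in> S \<Longrightarrow> (\<integral>\<^sup>+x. h i x \<partial>M) \<noteq> 0"
    | (fin) "\<And>i. i \<in> S \<Longrightarrow> (\<integral>\<^sup>+x. h i x \<partial>M) \<noteq> 0 \<and> (\<integral>\<^sup>+x. h i x \<partial>M) \<noteq> top"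
    by metis
  then show ?thesis
  proof cases
    case zero
    then have "AE x in M. h j x = 0" by (subst (asm) nn_integral_0_iff_AE) auto
    then have "AE x in M. (\<Prod>i\<in>S. epow ?k (h i x)) = 0"
      by eventually_elim (use zero S in \<open>auto simp: epow_eq_0_iff\<close>)
    then have "(\<integral>\<^sup>+x. (\<Prod>i\<in>S. epow ?k (h i x)) \<partial>M) = (\<integral>\<^sup>+x. 0 \<partial>M)" by (rule nn_integral_cong_AE)
    then show ?thesis by simp
  next
    case top
    have "(\<Prod>i\<in>S. epow ?k (\<integral>\<^sup>+x. h i x \<partial>M)) = epow ?k (\<integral>\<^sup>+x. h j x \<partial>M) * (\<Prod>i\<in>S-{j}. epow ?k (\<integral>\<^sup>+x. h i x \<partial>M))"
      using S top(1) by (simp add: prod.remove)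
    also have "\<dots> = top"
      using top S by (simp add: ennreal_top_mult epow_eq_0_iff)
    finally show ?thesis by simp
  next
    case fin
    define c where "c i = enn2real (\<integral>\<^sup>+x. h i x \<partial>M)" for i
    have ci: "(\<integral>\<^sup>+x. h i x \<partial>M) = ennreal (c i)" "0 < c i" if "i \<in> S" for i
      using fin[OF that] by (auto simp: c_def less_top enn2real_positive_iff zero_less_iff_neq_zero)
    have "(\<integral>\<^sup>+x. (\<Prod>i\<in>S. epow ?k (h i x)) \<partial>M) \<le>
       (\<integral>\<^sup>+x. (\<Prod>i\<in>S. ennreal (c i powr ?k)) * (\<Sum>i\<in>S. ennreal (1 / (card S * c i)) * h i x) \<partial>M)"
      using ci(2) S by (intro nn_integral_mono prod_epow_le_sum) auto
    also have "\<dots> = (\<Prod>i\<in>S. ennreal (c i powr ?k)) * (\<Sum>i\<in>S. ennreal (1 / (card S * c i)) * (\<integral>\<^sup>+x. h i x \<partial>M))"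
      by (subst nn_integral_cmult, measurable, subst nn_integral_sum, measurable, simp add: nn_integral_cmult)
    also have "(\<Sum>i\<in>S. ennreal (1 / (card S * c i)) * (\<integral>\<^sup>+x. h i x \<partial>M)) = (\<Sum>i\<in>S. ennreal (1 / card S))"
      using ci k by (intro sum.cong refl) (simp add: ennreal_mult[symmetric] less_imp_le less_imp_neq[symmetric])
    also have "\<dots> = 1"
      using k by (simp add: ennreal_of_nat_eq_real_of_nat ennreal_mult[symmetric] flip: ennreal_1)
    also have "(\<Prod>i\<in>S. ennreal (c i powr ?k)) = (\<Prod>i\<in>S. epow ?k (\<integral>\<^sup>+x. h i x \<partial>M))"
      using ci by (intro prod.cong refl) (simp add: epow_ennreal less_imp_le)
    finally show ?thesis by simp
  qed
qed

subsection \<open>The Gagliardo inequality\<close>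

interpretation coord: product_sigma_finite "\<lambda>_. lborel :: real measure"
  by standard

abbreviation coord_measure :: "'n set \<Rightarrow> ('n \<Rightarrow> real) measure" where
  "coord_measure J \<equiv> Pi\<^sub>M J (\<lambda>_. lborel)"

definition merge_coords :: "'n set \<Rightarrow> ('n \<Rightarrow> real) \<Rightarrow> ('n \<Rightarrow> real) \<Rightarrow> 'n \<Rightarrow> real" where
  "merge_coords J x y = (\<lambda>i. if i \<in> J then y i else x i)"

text \<open>The result stays a function of all coordinates, constant in those of \<open>J\<close>,
  so that one type serves every stage of the induction over \<open>J\<close>.\<close>

definition partial_int :: "'n set \<Rightarrow> (('n \<Rightarrow> real) \<Rightarrow> ennreal) \<Rightarrow> ('n \<Rightarrow> real) \<Rightarrow> ennreal" where
  "partial_int J g x = (\<integral>\<^sup>+y. g (merge_coords J x y) \<partial>coord_measure J)"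

lemma merge_coords_measurable:
  "(\<lambda>(x, y). merge_coords J x y) \<in> coord_measure UNIV \<Otimes>\<^sub>M coord_measure J \<rightarrow>\<^sub>M coord_measure UNIV"
proof (rule measurable_PiM_single')
  fix i :: 'a
  show "(\<lambda>\<omega>. (case \<omega> of (x, y) \<Rightarrow> merge_coords J x y) i) \<in> coord_measure UNIV \<Otimes>\<^sub>M coord_measure J \<rightarrow>\<^sub>M lborel"
    unfolding merge_coords_def case_prod_beta by (cases "i \<in> J") simp_all
qed (simp add: merge_coords_def)

lemma merge_coords_measurable' [measurable]:
  assumes "f \<in> M \<rightarrow>\<^sub>M coord_measure UNIV" "g \<in> M \<rightarrow>\<^sub>M coord_measure J"
  shows "(\<lambda>z. merge_coords J (f z) (g z)) \<in> M \<rightarrow>\<^sub>M coord_measure UNIV"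
  using measurable_compose[OF measurable_Pair[OF assms] merge_coords_measurable] by simp

lemma partial_int_measurable [measurable]:
  assumes "finite J" and [measurable]: "g \<in> borel_measurable (coord_measure UNIV)"
  shows "partial_int J g \<in> borel_measurable (coord_measure UNIV)"
proof -
  interpret S: sigma_finite_measure "coord_measure J"
    by (rule coord.sigma_finite[OF assms(1)])
  show ?thesis unfolding partial_int_def by measurable
qed

lemma fun_upd_coord_measurable [measurable]:
  "(\<lambda>t. x(j := t)) \<in> lborel \<rightarrow>\<^sub>M coord_measure UNIV"
  by (rule measurable_PiM_single') auto

lemma partial_int_empty: "partial_int {} g x = g x"
  by (simp add: partial_int_def merge_coords_def PiM_empty)

lemma partial_int_insert:
  assumes "finite J" "j \<notin> J" and [measurable]: "g \<in> borel_measurable (coord_measure UNIV)"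
  shows "partial_int (insert j J) g x = (\<integral>\<^sup>+t. partial_int J g (x(j := t)) \<partial>lborel)"
proof -
  have c: "(\<lambda>z. x) \<in> coord_measure (insert j J) \<rightarrow>\<^sub>M coord_measure UNIV"
    by (auto simp: space_PiM)
  have [measurable]: "(\<lambda>y. g (merge_coords (insert j J) x y)) \<in> borel_measurable (coord_measure (insert j J))"
    using c by measurable
  have "merge_coords (insert j J) x (y(j := t)) = merge_coords J (x(j := t)) y" for y t
    using assms(2) by (auto simp: merge_coords_def)
  then show ?thesis
    unfolding partial_int_def by (subst coord.product_nn_integral_insert_rev[OF assms(1,2)]) auto
qed

lemma partial_int_upd:
  assumes "j \<in> J" shows "partial_int J g (x(j := t)) = partial_int J g x"
proof -
  have "merge_coords J (x(j := t)) y = merge_coords J x y" for y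
    using assms by (auto simp: merge_coords_def)
  then show ?thesis by (simp add: partial_int_def)
qed

text \<open>Coordinates are integrated one at a time. When \<open>j\<close> is added, the factor
  with index \<open>j\<close> has already been integrated in that direction and is constant; the
  other CARD - 1 factors are exactly as many as Hoelder's inequality with exponent 1 / (CARD - 1)
  can take.\<close>

lemma partial_int_prod_le:
  fixes g :: "'n::finite \<Rightarrow> ('n \<Rightarrow> real) \<Rightarrow> ennreal"
  assumes n: "2 \<le> CARD('n)" and [measurable]: "\<And>i. g i \<in> borel_measurable (coord_measure UNIV)"
  shows "partial_int J (\<lambda>x. \<Prod>i\<in>UNIV. epow (1 / (CARD('n) - 1)) (partial_int {i} (g i) x)) x
    \<le> (\<Prod>i\<in>UNIV. epow (1 / (CARD('n) - 1)) (partial_int (insert i J) (g i) x))"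
    (is "partial_int J ?\<Phi> x \<le> _")
proof -
  have "finite J" by simp
  then show ?thesis
  proof (induction J arbitrary: x rule: finite_induct)
    case empty
    then show ?case by (simp add: partial_int_empty)
  next
    case (insert j J)
    let ?E = "epow (1 / (CARD('n) - 1))" and ?S = "UNIV - {j} :: 'n set"
    have cS: "card ?S = CARD('n) - 1" by simp
    have "?S \<noteq> {}"
      using n cS by (metis card.empty diff_is_0_eq not_less_eq_eq numeral_2_eq_2 One_nat_def)
    have "partial_int (insert j J) ?\<Phi> x = (\<integral>\<^sup>+t. partial_int J ?\<Phi> (x(j := t)) \<partial>lborel)"
      using insert by (intro partial_int_insert) auto
    also have "\<dots> \<le> (\<integral>\<^sup>+t. (\<Prod>i\<in>UNIV. ?E (partial_int (insert i J) (g i) (x(j := t)))) \<partial>lborel)"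
      by (intro nn_integral_mono insert.IH)
    also have "\<dots> = (\<integral>\<^sup>+t. ?E (partial_int (insert j J) (g j) x) *
         (\<Prod>i\<in>?S. ?E (partial_int (insert i J) (g i) (x(j := t)))) \<partial>lborel)"
      by (subst prod.remove[of UNIV j]) (auto simp: partial_int_upd)
    also have "\<dots> = ?E (partial_int (insert j J) (g j) x) *
         (\<integral>\<^sup>+t. (\<Prod>i\<in>?S. ?E (partial_int (insert i J) (g i) (x(j := t)))) \<partial>lborel)"
      by (intro nn_integral_cmult) measurable
    also have "\<dots> \<le> ?E (partial_int (insert j J) (g j) x) *
         (\<Prod>i\<in>?S. ?E (\<integral>\<^sup>+t. partial_int (insert i J) (g i) (x(j := t)) \<partial>lborel))"
      using nn_integral_prod_epow_le[of ?S "\<lambda>i t. partial_int (insert i J) (g i) (x(j := t))" lborel] \<open>?S \<noteq> {}\<close>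
      unfolding cS by (intro mult_left_mono) auto
    also have "(\<Prod>i\<in>?S. ?E (\<integral>\<^sup>+t. partial_int (insert i J) (g i) (x(j := t)) \<partial>lborel)) =
        (\<Prod>i\<in>?S. ?E (partial_int (insert i (insert j J)) (g i) x))"
      using insert by (intro prod.cong refl arg_cong[of _ _ ?E])
        (subst insert_commute, subst partial_int_insert, auto)
    also have "?E (partial_int (insert j J) (g j) x) * \<dots> = (\<Prod>i\<in>UNIV. ?E (partial_int (insert i (insert j J)) (g i) x))"
      by (subst prod.remove[of UNIV j]) auto
    finally show ?case .
  qed
qed

text \<open>Both measures agree on boxes, which characterises \<open>lborel\<close>. The product
  form gives access to Fubini's theorem over any set of coordinates.\<close>

lemma lborel_eq_distr_vec_lambda:
  "(lborel :: (real^'n::finite) measure) = distr (coord_measure UNIV) borel vec_lambda"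
proof (rule lborel_eqI)
  have m [measurable]: "vec_lambda \<in> coord_measure UNIV \<rightarrow>\<^sub>M (borel :: (real^'n) measure)"
    by (subst borel_measurable_euclidean_space) (auto simp: Basis_vec_def inner_axis)
  fix l u :: "real^'n"
  assume le: "\<And>b. b \<in> Basis \<Longrightarrow> l \<bullet> b \<le> u \<bullet> b"
  have le': "l $ i \<le> u $ i" for i
    using le[of "axis i 1"] by (simp add: inner_axis axis_in_Basis_iff)
  have "vec_lambda -` box l u \<inter> space (coord_measure UNIV) = Pi\<^sub>E UNIV (\<lambda>i. {l $ i<..<u $ i})"
    by (auto simp: space_PiM mem_box_cart PiE_def Pi_def)
  then have "emeasure (distr (coord_measure UNIV) borel vec_lambda) (box l u)
      = emeasure (coord_measure UNIV) (Pi\<^sub>E UNIV (\<lambda>i. {l $ i<..<u $ i}))"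
    by (simp add: emeasure_distr)
  also have "\<dots> = (\<Prod>i\<in>UNIV. emeasure lborel {l $ i<..<u $ i})"
    by (rule coord.emeasure_PiM) auto
  also have "\<dots> = (\<Prod>i\<in>UNIV. ennreal (u $ i - l $ i))"
    using le' by simp
  also have "\<dots> = ennreal (\<Prod>i\<in>UNIV. u $ i - l $ i)"
    using le' by (intro prod_ennreal) simp
  also have "(\<Prod>i\<in>UNIV. u $ i - l $ i) = (\<Prod>b\<in>Basis. (u - l) \<bullet> b)"
  proof -
    have B: "(Basis :: (real^'n) set) = (\<lambda>i. axis i 1) ` UNIV"
      by (auto simp: Basis_vec_def)
    have "inj (\<lambda>i::'n. axis i (1::real))"
      by (auto simp: inj_on_def axis_eq_axis)
    then show ?thesis
      unfolding B by (subst prod.reindex) (auto simp: inner_axis)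
  qed
  finally show "emeasure (distr (coord_measure UNIV) borel vec_lambda) (box l u) = (\<Prod>b\<in>Basis. (u - l) \<bullet> b)" .
qed simp

lemma vec_lambda_measurable [measurable]: "vec_lambda \<in> coord_measure UNIV \<rightarrow>\<^sub>M (borel :: (real^'n::finite) measure)"
  by (subst borel_measurable_euclidean_space) (auto simp: Basis_vec_def inner_axis)

lemma nn_integral_vec_lambda:
  fixes f :: "real^'n::finite \<Rightarrow> ennreal"
  assumes [measurable]: "f \<in> borel_measurable borel"
  shows "(\<integral>\<^sup>+x. f x \<partial>lborel) = (\<integral>\<^sup>+x. f (vec_lambda x) \<partial>coord_measure UNIV)"
  by (subst lborel_eq_distr_vec_lambda, subst nn_integral_distr) auto

definition upd_coord :: "real^'n::finite \<Rightarrow> 'n \<Rightarrow> real \<Rightarrow> real^'n" where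
  "upd_coord x i t = (\<chi> k. if k = i then t else x $ k)"

lemma upd_coord_eq: "upd_coord x i t = x + (t - x $ i) *\<^sub>R axis i 1"
  by (auto simp: upd_coord_def vec_eq_iff axis_def)

text \<open>The case \<open>J = UNIV\<close> of \<open>partial_int_prod_le\<close>, where every
  factor on the right has become a full integral; this is the Loomis-Whitney inequality in
  Gagliardo's form.\<close>

lemma gagliardo_inequality:
  fixes g :: "'n::finite \<Rightarrow> real^'n \<Rightarrow> ennreal"
  assumes n: "2 \<le> CARD('n)" and [measurable]: "\<And>i. g i \<in> borel_measurable borel"
  shows "(\<integral>\<^sup>+x. (\<Prod>i\<in>UNIV. epow (1 / (CARD('n) - 1)) (\<integral>\<^sup>+t. g i (upd_coord x i t) \<partial>lborel)) \<partial>lborel)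
    \<le> (\<Prod>i\<in>UNIV. epow (1 / (CARD('n) - 1)) (\<integral>\<^sup>+x. g i x \<partial>lborel))"
proof -
  define h where "h i x = g i (vec_lambda x)" for i x
  have [measurable]: "h i \<in> borel_measurable (coord_measure UNIV)" for i
    unfolding h_def by measurable
  let ?\<Phi> = "\<lambda>x. \<Prod>i\<in>UNIV. epow (1 / (CARD('n) - 1)) (partial_int {i} (h i) x)"
  have U: "partial_int UNIV f x = (\<integral>\<^sup>+y. f y \<partial>coord_measure UNIV)" for f and x :: "'n \<Rightarrow> real"
    by (simp add: partial_int_def merge_coords_def)
  have line: "(\<integral>\<^sup>+t. g i (upd_coord (vec_lambda x) i t) \<partial>lborel) = partial_int {i} (h i) x" for i x
  proof -
    have "vec_lambda (x(i := t)) = upd_coord (vec_lambda x) i t" for t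
      by (auto simp: upd_coord_def vec_eq_iff)
    then show ?thesis
      by (subst partial_int_insert) (auto simp: partial_int_empty h_def)
  qed
  have [measurable]: "(\<lambda>x::real^'n. x $ i) \<in> borel_measurable borel" for i
    by (intro borel_measurable_continuous_onI continuous_intros)
  have [measurable]: "(\<lambda>p. upd_coord (fst p) i (snd p)) \<in> borel_measurable (borel \<Otimes>\<^sub>M lborel)" for i :: 'n
    unfolding upd_coord_eq by measurable
  have "(\<integral>\<^sup>+x. (\<Prod>i\<in>UNIV. epow (1 / (CARD('n) - 1)) (\<integral>\<^sup>+t. g i (upd_coord x i t) \<partial>lborel)) \<partial>lborel)
     = (\<integral>\<^sup>+x. ?\<Phi> x \<partial>coord_measure UNIV)"
    by (subst nn_integral_vec_lambda) (simp_all add: line)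
  also have "\<dots> \<le> (\<Prod>i\<in>UNIV. epow (1 / (CARD('n) - 1)) (\<integral>\<^sup>+y. h i y \<partial>coord_measure UNIV))"
    using partial_int_prod_le[OF n, of h UNIV] by (simp add: U insert_absorb)
  also have "\<dots> = (\<Prod>i\<in>UNIV. epow (1 / (CARD('n) - 1)) (\<integral>\<^sup>+x. g i x \<partial>lborel))"
    by (subst nn_integral_vec_lambda) (simp_all add: h_def[abs_def])
  finally show ?thesis .
qed

subsection \<open>The Gagliardo-Nirenberg-Sobolev inequality\<close>

text \<open>Continuous differentiability with the partial derivatives as an explicit parameter:
  values may be vectors, and the derivative of a convolution can be named as another
  convolution.\<close>

definition has_partials ::
    "(real^'n::finite \<Rightarrow> 'a::real_normed_vector) \<Rightarrow> ('n \<Rightarrow> real^'n \<Rightarrow> 'a) \<Rightarrow> bool" where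
  "has_partials F F' \<longleftrightarrow> continuous_on UNIV F \<and> (\<forall>i. continuous_on UNIV (F' i)) \<and>
     (\<forall>i x. ((\<lambda>t. F (x + t *\<^sub>R axis i 1)) has_vector_derivative F' i x) (at 0))"

lemma has_partials_line:
  assumes "has_partials F F'"
  shows "((\<lambda>s. F (x + s *\<^sub>R axis i 1)) has_vector_derivative F' i (x + t *\<^sub>R axis i 1)) (at t)"
proof -
  let ?G = "\<lambda>s. F ((x + t *\<^sub>R axis i 1) + s *\<^sub>R axis i 1)"
  have "(?G has_vector_derivative F' i (x + t *\<^sub>R axis i 1)) (at (t - t))"
    using assms by (simp add: has_partials_def)
  moreover have "((\<lambda>s. s - t) has_vector_derivative 1) (at t)"
    by (auto intro!: derivative_eq_intros simp: has_vector_derivative_def)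
  ultimately have "(?G \<circ> (\<lambda>s. s - t) has_vector_derivative (1 *\<^sub>R F' i (x + t *\<^sub>R axis i 1))) (at t)"
    by (rule vector_diff_chain_at[rotated])
  then show ?thesis by (simp add: o_def algebra_simps)
qed

lemma has_partials_upd_coord:
  assumes "has_partials F F'"
  shows "((\<lambda>s. F (upd_coord x i s)) has_vector_derivative F' i (upd_coord x i t)) (at t)"
proof -
  let ?y = "x - (x $ i) *\<^sub>R axis i 1"
  have "upd_coord x i s = ?y + s *\<^sub>R axis i 1" for s
    by (simp add: upd_coord_eq algebra_simps)
  then show ?thesis using has_partials_line[OF assms, of ?y i t] by simp
qed

text \<open>For g > 1 the difference quotient at 0 is at most |h|^(g-1) and tends to 0. Besides
  |y|^g this also covers the cutoff functions, which are squares of positive parts.\<close>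

lemma max_powr_has_derivative:
  fixes y g :: real
  assumes "1 < g"
  shows "((\<lambda>y. max y 0 powr g) has_real_derivative g * max y 0 powr (g - 1)) (at y)"
proof -
  consider "y > 0" | "y < 0" | "y = 0" by linarith
  then show ?thesis
  proof cases
    case 1
    have "((\<lambda>y. y powr g) has_real_derivative g * y powr (g - 1)) (at y)"
      using 1 by (rule has_real_derivative_powr)
    moreover have "\<forall>\<^sub>F z in nhds y. z powr g = max z 0 powr g"
      using 1 eventually_nhds_in_open[of "{0<..}" y] by (auto elim!: eventually_mono)
    ultimately have "((\<lambda>y. max y 0 powr g) has_real_derivative g * y powr (g - 1)) (at y)"
      by (rule DERIV_cong_ev[OF refl _ refl, THEN iffD1, rotated])
    then show ?thesis using 1 by simp
  next
    case 2
    have "((\<lambda>y. 0) has_real_derivative 0) (at y)" by simp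
    moreover have "\<forall>\<^sub>F z in nhds y. 0 = max z 0 powr g"
      using 2 eventually_nhds_in_open[of "{..<0}" y] by (auto elim!: eventually_mono)
    ultimately have "((\<lambda>y. max y 0 powr g) has_real_derivative 0) (at y)"
      by (rule DERIV_cong_ev[OF refl _ refl, THEN iffD1, rotated])
    then show ?thesis using 2 by simp
  next
    case 3
    have "((\<lambda>h. \<bar>h\<bar> powr (g - 1)) \<longlongrightarrow> \<bar>0\<bar> powr (g - 1)) (at (0::real))"
      using assms by (intro tendsto_powr' tendsto_intros) auto
    then have lim: "((\<lambda>h. \<bar>h\<bar> powr (g - 1)) \<longlongrightarrow> 0) (at (0::real))" by simp
    have "((\<lambda>h. (max h 0 powr g) / h) \<longlongrightarrow> 0) (at (0::real))"
    proof (rule Lim_null_comparison[OF _ lim])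
      have "norm (max h 0 powr g / h) \<le> \<bar>h\<bar> powr (g - 1)" if "h \<noteq> 0" for h :: real
      proof (cases "h > 0")
        case True
        then show ?thesis by (simp add: powr_diff)
      next
        case False
        then have "max h 0 = 0" by simp
        then show ?thesis by simp
      qed
      then show "\<forall>\<^sub>F h in at 0. norm (max h 0 powr g / h) \<le> \<bar>h\<bar> powr (g - 1)"
        by (auto simp: eventually_at_filter)
    qed
    then show ?thesis using 3 assms by (simp add: DERIV_def)
  qed
qed

lemma abs_powr_eq_max: "\<bar>y::real\<bar> powr g = max y 0 powr g + max (- y) 0 powr g"
  by (auto simp: abs_if max_def)

lemma abs_powr_has_derivative:
  fixes y g :: real
  assumes "1 < g"
  shows "((\<lambda>y. \<bar>y\<bar> powr g) has_real_derivative g * (max y 0 powr (g - 1) - max (- y) 0 powr (g - 1))) (at y)"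
  unfolding abs_powr_eq_max
  by (rule derivative_eq_intros max_powr_has_derivative[OF assms] DERIV_chain2[OF max_powr_has_derivative[OF assms]] refl
      | simp add: algebra_simps)+

lemma norm_le_nn_integral_deriv:
  fixes h :: "real \<Rightarrow> 'a::euclidean_space"
  assumes d: "\<And>t. (h has_vector_derivative h' t) (at t)" and c: "continuous_on UNIV h'"
    and "h a = 0" "a \<le> b"
  shows "ennreal (norm (h b)) \<le> (\<integral>\<^sup>+t. ennreal (norm (h' t)) \<partial>lborel)"
proof -
  have "integral\<^sup>L lborel (\<lambda>x. indicator {a..b} x *\<^sub>R h' x) = h b - h a"
    using assms by (intro integral_FTC_atLeastAtMost)
      (auto intro: has_vector_derivative_at_within continuous_on_subset)
  then have "ennreal (norm (h b)) = ennreal (norm (integral\<^sup>L lborel (\<lambda>x. indicator {a..b} x *\<^sub>R h' x)))"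
    using \<open>h a = 0\<close> by simp
  also have "\<dots> \<le> (\<integral>\<^sup>+x. ennreal (norm (indicator {a..b} x *\<^sub>R h' x)) \<partial>lborel)"
  proof (rule integral_norm_bound_ennreal)
    show "integrable lborel (\<lambda>x. indicator {a..b} x *\<^sub>R h' x)"
      by (rule borel_integrable_compact) (auto intro: continuous_on_subset[OF c])
  qed
  also have "\<dots> \<le> (\<integral>\<^sup>+x. ennreal (norm (h' x)) \<partial>lborel)"
    by (intro nn_integral_mono) (auto simp: indicator_def)
  finally show ?thesis .
qed

text \<open>Upper bounds \<open>A\<close> and \<open>B\<close> replace the integrals because only a
  bound for the derivative is available where this is applied. Young's inequality acts on the
  functions divided by A^(1/p) and B^(1/q); if a bound is 0, the product vanishes almost
  everywhere.\<close>

lemma nn_integral_Holder: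
  fixes f g :: "'a \<Rightarrow> real"
  assumes pq: "1 < p" "1 < q" "1 / p + 1 / q = 1"
    and [measurable]: "f \<in> borel_measurable M" "g \<in> borel_measurable M"
    and nn: "\<And>x. 0 \<le> f x" "\<And>x. 0 \<le> g x"
    and A: "(\<integral>\<^sup>+x. ennreal (f x powr p) \<partial>M) \<le> ennreal A" "0 \<le> A"
    and B: "(\<integral>\<^sup>+x. ennreal (g x powr q) \<partial>M) \<le> ennreal B" "0 \<le> B"
  shows "(\<integral>\<^sup>+x. ennreal (f x * g x) \<partial>M) \<le> ennreal (A powr (1 / p) * B powr (1 / q))"
proof -
  have z: "(\<integral>\<^sup>+x. ennreal (f x * g x) \<partial>M) = 0"
    if [measurable]: "h \<in> borel_measurable M" and "(\<integral>\<^sup>+x. ennreal (h x powr r) \<partial>M) = 0"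
      "\<And>x. h x = 0 \<Longrightarrow> f x * g x = 0" "0 < r" "\<And>x. 0 \<le> h x" for h r
  proof -
    have "AE x in M. ennreal (h x powr r) = 0"
      using that(2) by (subst (asm) nn_integral_0_iff_AE) auto
    moreover have "ennreal (f x * g x) = 0" if "ennreal (h x powr r) = 0" for x
    proof -
      have "h x = 0" using that by (auto simp: ennreal_eq_0_iff)
      then show ?thesis by (simp only: \<open>\<And>x. h x = 0 \<Longrightarrow> f x * g x = 0\<close>) simp
    qed
    ultimately have "AE x in M. ennreal (f x * g x) = 0" by (auto elim: eventually_mono)
    then show ?thesis by (subst nn_integral_0_iff_AE) auto
  qed
  show ?thesis
  proof (cases "A = 0 \<or> B = 0")
    case True
    then have "(\<integral>\<^sup>+x. ennreal (f x * g x) \<partial>M) = 0"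
      using z[of f p] z[of g q] A B pq nn by auto
    then show ?thesis by simp
  next
    case False
    then have AB: "0 < A" "0 < B" using A B by auto
    define c where "c = A powr (1 / p) * B powr (1 / q)"
    have c: "0 < c" using AB by (simp add: c_def)
    have pt: "f x * g x \<le> c * (f x powr p / (p * A) + g x powr q / (q * B))" for x
    proof -
      have "(f x / A powr (1/p)) * (g x / B powr (1/q)) \<le>
        (f x / A powr (1/p)) powr p / p + (g x / B powr (1/q)) powr q / q"
        using pq nn AB by (intro Youngs_inequality) auto
      also have "\<dots> = f x powr p / (p * A) + g x powr q / (q * B)"
        using pq nn AB by (simp add: powr_divide powr_powr field_simps)
      finally have "(f x * g x) / c \<le> f x powr p / (p * A) + g x powr q / (q * B)"
        by (simp add: c_def)
      then show ?thesis using c by (simp add: field_simps)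
    qed
    have "(\<integral>\<^sup>+x. ennreal (f x * g x) \<partial>M) \<le>
      (\<integral>\<^sup>+x. ennreal (c / (p * A)) * ennreal (f x powr p) + ennreal (c / (q * B)) * ennreal (g x powr q) \<partial>M)"
      using c AB pq pt by (intro nn_integral_mono) (simp add: distrib_left flip: ennreal_mult ennreal_plus)
    also have "\<dots> = ennreal (c / (p * A)) * (\<integral>\<^sup>+x. ennreal (f x powr p) \<partial>M)
        + ennreal (c / (q * B)) * (\<integral>\<^sup>+x. ennreal (g x powr q) \<partial>M)"
      by (simp add: nn_integral_add nn_integral_cmult)
    also have "\<dots> \<le> ennreal (c / (p * A)) * ennreal A + ennreal (c / (q * B)) * ennreal B"
      by (intro add_mono mult_left_mono A B) auto
    also have "\<dots> = ennreal (c * (1 / p + 1 / q))"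
      using c AB pq(1,2) by (simp add: distrib_left flip: ennreal_mult ennreal_plus)
    finally show ?thesis using pq by (simp add: c_def)
  qed
qed

text \<open>Dividing by the power of \<open>x\<close> on the right leaves \<open>x powr b\<close> on
  the left. As \<open>x\<close> is a real number, finiteness must be known beforehand.\<close>

lemma absorb_powr:
  fixes x K D :: real
  assumes "0 \<le> x" "0 \<le> K" "0 < b" "x \<le> K * x powr (1 - b)"
  shows "x \<le> K powr (1 / b)"
proof (cases "x = 0")
  case False
  then have x: "0 < x" using assms by simp
  have "x powr b = x / x powr (1 - b)"
    using x by (simp add: powr_diff)
  also have "\<dots> \<le> K" using assms(4) x by (simp add: divide_le_eq)
  finally have "(x powr b) powr (1 / b) \<le> K powr (1 / b)"
    using assms by (intro powr_mono2) auto
  then show ?thesis using x assms by (simp add: powr_powr)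
qed simp

text \<open>On each coordinate line |F|^g is bounded by the integral of g |F|^(g-1) |F'|.
  Gagliardo's inequality combines the directions, Hoelder's inequality separates F' from the power
  of F, and that power is absorbed into the left-hand side.\<close>

lemma gagliardo_nirenberg_sobolev:
  fixes F :: "real^'n::finite \<Rightarrow> real" and p D :: real
  defines "n \<equiv> real CARD('n)"
  assumes p: "1 < p" "p < n"
    and F: "has_partials F F'" and R: "\<And>x. R < norm x \<Longrightarrow> F x = 0"
    and D: "\<And>i. (\<integral>\<^sup>+x. ennreal (\<bar>F' i x\<bar> powr p) \<partial>lborel) \<le> ennreal D" "0 \<le> D"
  shows "(\<integral>\<^sup>+x. ennreal (\<bar>F x\<bar> powr (n * p / (n - p))) \<partial>lborel)
    \<le> ennreal (((p * (n - 1) / (n - p)) * D powr (1 / p)) powr (n * p / (n - p)))"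
proof -
  define s where "s = n * p / (n - p)"
  \<comment> \<open>Determined by g n/(n-1) = (g-1) p/(p-1): the power of F that Gagliardo's
    inequality produces and the one that Hoelder's inequality leaves over then both equal
    \<open>s\<close>.\<close>
  define g where "g = p * (n - 1) / (n - p)"
  have n1: "1 < n" and np: "0 < n - p" using p by auto
  then have n2: "2 \<le> CARD('n)" by (simp add: n_def)
  have nz: "p \<noteq> 0" "n \<noteq> 0" "n - 1 \<noteq> 0" "n - p \<noteq> 0" "p - 1 \<noteq> 0" using p by auto
  have g_eq: "g - 1 = n * (p - 1) / (n - p)"
    unfolding g_def using nz by (simp add: divide_simps) (simp add: algebra_simps)
  have "0 < n * (p - 1) / (n - p)" using p n1 np by simp
  then have g1: "1 < g" using g_eq by linarith
  have s0: "0 < s" using p np n1 by (simp add: s_def)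
  have cF: "continuous_on UNIV F" and cF': "\<And>i. continuous_on UNIV (F' i)"
    using F by (auto simp: has_partials_def)
  have [measurable]: "F \<in> borel_measurable borel" "F' i \<in> borel_measurable borel" for i
    using cF cF' by (auto intro: borel_measurable_continuous_onI)
  define G where "G i x = g * \<bar>F x\<bar> powr (g - 1) * \<bar>F' i x\<bar>" for i x
  have G0: "0 \<le> G i x" for i x using g1 by (simp add: G_def)
  have [measurable]: "G i \<in> borel_measurable borel" for i unfolding G_def by measurable
  have line: "ennreal (\<bar>F x\<bar> powr g) \<le> (\<integral>\<^sup>+t. ennreal (G i (upd_coord x i t)) \<partial>lborel)" for x i
  proof -
    let ?u = "upd_coord x i"
    define k where "k y = g * (max y 0 powr (g - 1) - max (- y) 0 powr (g - 1))" for y :: real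
    define h where "h t = \<bar>F (?u t)\<bar> powr g" for t
    define h' where "h' t = k (F (?u t)) * F' i (?u t)" for t
    have cu: "continuous_on UNIV ?u"
      unfolding upd_coord_eq by (intro continuous_intros)
    have der: "(h has_vector_derivative h' t) (at t)" for t
    proof -
      have "((\<lambda>s. F (?u s)) has_real_derivative F' i (?u t)) (at t)"
        using has_partials_upd_coord[OF F] by (simp add: has_real_derivative_iff_has_vector_derivative)
      from DERIV_chain2[OF abs_powr_has_derivative[OF g1] this]
      show ?thesis
        unfolding h_def h'_def k_def by (simp add: has_real_derivative_iff_has_vector_derivative)
    qed
    have ck: "continuous_on UNIV k"
      unfolding k_def using g1
      by (intro continuous_on_mult continuous_on_diff continuous_on_const continuous_on_powr'
          continuous_on_max continuous_on_minus continuous_on_id) auto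
    have cFu: "continuous_on UNIV (\<lambda>t. F (?u t))" and cFu': "continuous_on UNIV (\<lambda>t. F' i (?u t))"
      using continuous_on_compose2[OF cF cu] continuous_on_compose2[OF cF' cu] by auto
    have "continuous_on UNIV (\<lambda>t. k (F (?u t)))"
      by (rule continuous_on_compose2[OF ck cFu]) simp
    then have ch': "continuous_on UNIV h'"
      unfolding h'_def by (rule continuous_on_mult[OF _ cFu'])
    \<comment> \<open>A starting point on the line, not beyond \<open>x\<close>, at which
      \<open>F\<close> already vanishes.\<close>
    define a where "a = min (x $ i) (- \<bar>R\<bar> - 1)"
    have "R < norm (?u a)"
    proof -
      have "\<bar>?u a $ i\<bar> \<le> norm (?u a)" by (rule component_le_norm_cart)
      moreover have "?u a $ i = a" by (simp add: upd_coord_def)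
      moreover have "a \<le> - \<bar>R\<bar> - 1" by (simp add: a_def)
      ultimately show ?thesis by linarith
    qed
    then have "h a = 0" using R by (simp add: h_def)
    then have "ennreal (norm (h (x $ i))) \<le> (\<integral>\<^sup>+t. ennreal (norm (h' t)) \<partial>lborel)"
      by (intro norm_le_nn_integral_deriv[OF der ch']) (auto simp: a_def)
    moreover have "?u (x $ i) = x" by (simp add: upd_coord_eq)
    moreover have "\<bar>k y\<bar> = g * \<bar>y\<bar> powr (g - 1)" for y
    proof (cases "0 \<le> y")
      case True
      then show ?thesis using g1 by (simp add: k_def abs_mult)
    next
      case False
      then have "max y 0 = 0" "max (- y) 0 = - y" by auto
      then show ?thesis using g1 False by (simp add: k_def abs_mult)
    qed
    ultimately show ?thesis by (simp add: h_def h'_def G_def abs_mult)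
  qed
  \<comment> \<open>Compact support makes the left-hand side finite in advance; the absorption below
    depends on it.\<close>
  have fin: "(\<integral>\<^sup>+x. ennreal (\<bar>F x\<bar> powr s) \<partial>lborel) < \<infinity>"
  proof -
    have "integrable lborel (\<lambda>x. indicator (cball 0 R) x *\<^sub>R \<bar>F x\<bar> powr s)"
      using s0 by (intro borel_integrable_compact continuous_on_powr' continuous_intros continuous_on_subset[OF cF]) auto
    then have "(\<integral>\<^sup>+x. ennreal (norm (indicator (cball 0 R) x *\<^sub>R \<bar>F x\<bar> powr s)) \<partial>lborel) < \<infinity>"
      by (simp add: integrable_iff_bounded)
    also have "(\<lambda>x. norm (indicator (cball 0 R) x *\<^sub>R \<bar>F x\<bar> powr s)) = (\<lambda>x. \<bar>F x\<bar> powr s)"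
      using R by (auto simp: indicator_def fun_eq_iff not_le)
    finally show ?thesis .
  qed
  define x where "x = enn2real (\<integral>\<^sup>+x. ennreal (\<bar>F x\<bar> powr s) \<partial>lborel)"
  have x: "(\<integral>\<^sup>+x. ennreal (\<bar>F x\<bar> powr s) \<partial>lborel) = ennreal x" "0 \<le> x"
    using fin by (auto simp: x_def)
  define q where "q = p / (p - 1)"
  have q: "1 < q" "1 / q + 1 / p = 1" using p by (simp_all add: q_def add_divide_distrib[symmetric])
  have gq: "(g - 1) * q = s"
    unfolding q_def s_def g_eq using nz by simp
  have HG: "(\<integral>\<^sup>+x. ennreal (G i x) \<partial>lborel) \<le> ennreal (g * (x powr (1 / q) * D powr (1 / p)))" for i
  proof -
    have "(\<integral>\<^sup>+x. ennreal (G i x) \<partial>lborel) = ennreal g * (\<integral>\<^sup>+x. ennreal (\<bar>F x\<bar> powr (g - 1) * \<bar>F' i x\<bar>) \<partial>lborel)"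
      unfolding G_def using g1 by (subst nn_integral_cmult[symmetric]) (auto simp: mult.assoc simp flip: ennreal_mult)
    also have "\<dots> \<le> ennreal g * ennreal (x powr (1 / q) * D powr (1 / p))"
      using x D p q by (intro mult_left_mono nn_integral_Holder) (auto simp: powr_powr gq)
    finally show ?thesis using g1 by (simp add: ennreal_mult)
  qed
  let ?k = "1 / real (CARD('n) - 1)"
  have k: "?k = 1 / (n - 1)" using n2 by (simp add: n_def of_nat_diff)
  have powk: "(y powr ?k) ^ CARD('n) = y powr (n / (n - 1))" if "0 \<le> y" for y
  proof (cases "y = 0")
    case False
    then have "(y powr ?k) ^ CARD('n) = (y powr ?k) powr n"
      using that by (simp add: n_def powr_realpow)
    then show ?thesis by (simp only: powr_powr k times_divide_eq_left mult_1_left)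
  qed simp
  have "ennreal x = (\<integral>\<^sup>+x. (\<Prod>i\<in>(UNIV::'n set). epow ?k (ennreal (\<bar>F x\<bar> powr g))) \<partial>lborel)"
  proof -
    have e: "g * n / (n - 1) = s" unfolding g_def s_def using nz by simp
    have "(\<Prod>i\<in>(UNIV::'n set). epow ?k (ennreal (\<bar>F x\<bar> powr g))) = ennreal (\<bar>F x\<bar> powr s)" for x
    proof -
      have "(\<Prod>i\<in>(UNIV::'n set). epow ?k (ennreal (\<bar>F x\<bar> powr g))) = ennreal ((\<bar>F x\<bar> powr (g * ?k)) ^ CARD('n))"
        by (simp add: epow_ennreal powr_powr ennreal_power)
      also have "(\<bar>F x\<bar> powr (g * ?k)) ^ CARD('n) = \<bar>F x\<bar> powr s"
        using powk[of "\<bar>F x\<bar> powr g"] by (simp add: powr_powr e)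
      finally show ?thesis .
    qed
    then show ?thesis using x by simp
  qed
  also have "\<dots> \<le> (\<integral>\<^sup>+x. (\<Prod>i\<in>UNIV. epow ?k (\<integral>\<^sup>+t. ennreal (G i (upd_coord x i t)) \<partial>lborel)) \<partial>lborel)"
    by (intro nn_integral_mono prod_mono_ennreal epow_mono line) auto
  also have "\<dots> \<le> (\<Prod>i\<in>UNIV. epow ?k (\<integral>\<^sup>+x. ennreal (G i x) \<partial>lborel))"
    using n2 by (intro gagliardo_inequality) auto
  also have "\<dots> \<le> (\<Prod>i\<in>(UNIV::'n set). epow ?k (ennreal (g * (x powr (1 / q) * D powr (1 / p)))))"
    by (intro prod_mono_ennreal epow_mono HG) auto
  also have "\<dots> = ennreal ((g * (x powr (1 / q) * D powr (1 / p))) powr (n / (n - 1)))"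
  proof -
    let ?y = "g * (x powr (1 / q) * D powr (1 / p))"
    have y: "0 \<le> ?y" using g1 by simp
    have "(\<Prod>i\<in>(UNIV::'n set). epow ?k (ennreal ?y)) = ennreal ((?y powr ?k) ^ CARD('n))"
      using y by (simp add: epow_ennreal ennreal_power)
    also have "(?y powr ?k) ^ CARD('n) = ?y powr (n / (n - 1))"
      by (rule powk[OF y])
    finally show ?thesis .
  qed
  finally have "x \<le> (g * (x powr (1 / q) * D powr (1 / p))) powr (n / (n - 1))"
    by simp
  \<comment> \<open>The exponent of \<open>x\<close> is written as 1 minus a positive number, the
    form that \<open>absorb_powr\<close> expects.\<close>
  also have "\<dots> = (g * D powr (1 / p)) powr (n / (n - 1)) * x powr (1 - n / (n - 1) * (1 / s))"
  proof -
    have "1 / q * (n / (n - 1)) = 1 - n / (n - 1) * (1 / s)"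
      unfolding q_def s_def using nz by (simp add: divide_simps) (simp add: algebra_simps)
    then show ?thesis using g1 x(2) D(2)
      by (simp add: powr_mult powr_powr mult_ac)
  qed
  finally have "x \<le> ((g * D powr (1 / p)) powr (n / (n - 1))) powr (1 / (n / (n - 1) * (1 / s)))"
    using x n1 s0 by (intro absorb_powr) auto
  also have "\<dots> = (g * D powr (1 / p)) powr s"
    using n1 s0 by (simp add: powr_powr)
  finally show ?thesis
    using x by (auto simp: s_def[symmetric] g_def[symmetric] intro!: ennreal_leI)
qed

subsection \<open>Smooth functions\<close>

lemma partial_deriv_eqI:
  assumes "((\<lambda>t. f (x + t *\<^sub>R axis i 1)) has_real_derivative D) (at 0)"
  shows "partial_deriv i f x = D"
  unfolding partial_deriv_def using assms by (rule DERIV_imp_deriv)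

lemma differentiable_partial_deriv:
  assumes "f differentiable at x"
  shows "((\<lambda>t. f (x + t *\<^sub>R axis i 1)) has_real_derivative partial_deriv i f x) (at 0)"
proof -
  obtain D where D: "(f has_derivative D) (at x)"
    using assms by (auto simp: differentiable_def)
  let ?g = "\<lambda>t::real. x + t *\<^sub>R axis i (1::real)"
  have "(?g has_derivative (\<lambda>t. t *\<^sub>R axis i 1)) (at 0)"
    by (auto intro!: derivative_eq_intros)
  moreover have "(f has_derivative D) (at (?g 0))" using D by simp
  ultimately have "((\<lambda>t. f (?g t)) has_derivative (\<lambda>t. D (t *\<^sub>R axis i 1))) (at 0)"
    by (rule has_derivative_compose)
  moreover have "D (t *\<^sub>R axis i 1) = D (axis i 1) * t" for t
    using has_derivative_bounded_linear[OF D] by (simp add: linear_cmul[OF bounded_linear.linear])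
  ultimately have "((\<lambda>t. f (?g t)) has_real_derivative D (axis i 1)) (at 0)"
    by (simp add: has_field_derivative_def)
  then show ?thesis using partial_deriv_eqI by metis
qed

section \<open>Bump functions\<close>

text \<open>The index \<open>k\<close> is carried along because differentiation of exp(-1/t) only
  produces further powers of 1/t: the family is closed under differentiation up to linear
  combinations.\<close>

definition flat_exp :: "nat \<Rightarrow> real \<Rightarrow> real" where
  "flat_exp k t = (if 0 < t then (1 / t) ^ k * exp (- (1 / t)) else 0)"

lemma flat_exp_tendsto_0: "(flat_exp k \<longlongrightarrow> 0) (at 0)"
proof -
  have "((\<lambda>t. (1 / t) ^ k / exp (1 / t)) \<longlongrightarrow> 0) (at_right (0::real))"
    using filterlim_compose[OF tendsto_power_div_exp_0 filterlim_inverse_at_top_right, of k]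
    by (simp add: inverse_eq_divide)
  then have r: "(flat_exp k \<longlongrightarrow> 0) (at_right 0)"
    by (rule Lim_transform_eventually)
      (auto simp: eventually_at_filter flat_exp_def exp_minus field_simps)
  have l: "(flat_exp k \<longlongrightarrow> 0) (at_left 0)"
    by (rule tendsto_eventually) (auto simp: eventually_at_filter flat_exp_def)
  show ?thesis using l r by (simp add: filterlim_at_split)
qed

lemma flat_exp_has_derivative:
  "(flat_exp k has_real_derivative flat_exp (k + 2) t - real k * flat_exp (k + 1) t) (at t)"
proof -
  consider "t > 0" | "t < 0" | "t = 0" by linarith
  then show ?thesis
  proof cases
    case 1
    have i: "((\<lambda>t. 1 / t) has_real_derivative - ((1 / t) ^ 2)) (at t)"
      using 1 by (auto intro!: derivative_eq_intros simp: power2_eq_square)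
    have e: "((\<lambda>t. exp (- (1 / t))) has_real_derivative exp (- (1 / t)) * (- (- ((1 / t) ^ 2)))) (at t)"
      by (intro DERIV_chain2[OF DERIV_exp] DERIV_minus i)
    have "real k * (1 / t) ^ (k - 1) * (1 / t) ^ 2 = real k * (1 / t) ^ (k + 1)"
      by (cases k) (simp_all add: power2_eq_square)
    then have "((\<lambda>t. (1 / t) ^ k * exp (- (1 / t))) has_real_derivative flat_exp (k + 2) t - real k * flat_exp (k + 1) t) (at t)"
      using DERIV_mult[OF DERIV_power[OF i, of k] e] 1
      by (simp add: flat_exp_def algebra_simps power_add power2_eq_square)
    moreover have "\<forall>\<^sub>F z in nhds t. (1 / z) ^ k * exp (- (1 / z)) = flat_exp k z"
      using 1 eventually_nhds_in_open[of "{0<..}" t] by (auto elim!: eventually_mono simp: flat_exp_def)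
    ultimately show ?thesis
      by (rule DERIV_cong_ev[OF refl _ refl, THEN iffD1, rotated])
  next
    case 2
    have "((\<lambda>t. 0) has_real_derivative 0) (at t)" by simp
    moreover have "\<forall>\<^sub>F z in nhds t. 0 = flat_exp k z"
      using 2 eventually_nhds_in_open[of "{..<0}" t] by (auto elim!: eventually_mono simp: flat_exp_def)
    ultimately have "(flat_exp k has_real_derivative 0) (at t)"
      by (rule DERIV_cong_ev[OF refl _ refl, THEN iffD1, rotated])
    then show ?thesis using 2 by (simp add: flat_exp_def)
  next
    case 3
    \<comment> \<open>At 0 the difference quotient is again a member of the family, and all members
      tend to 0 there.\<close>
    have "(\<lambda>h. flat_exp k h / h) = flat_exp (k + 1)"
      by (auto simp: flat_exp_def fun_eq_iff)
    then show ?thesis using 3 flat_exp_tendsto_0[of "k + 1"]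
      by (simp add: DERIV_def flat_exp_def)
  qed
qed

lemma flat_exp_nonneg: "0 \<le> flat_exp k t"
  by (simp add: flat_exp_def)

lemma flat_exp_pos_iff: "0 < flat_exp k t \<longleftrightarrow> 0 < t"
  by (simp add: flat_exp_def)

text \<open>An algebra of smooth functions that is visibly closed under differentiation and
  contains the usual bump functions.\<close>

inductive smooth_elem :: "(real^'n::finite \<Rightarrow> real) \<Rightarrow> bool" where
  base: "smooth_elem (\<lambda>x. flat_exp k (a * x $ i + c))"
| const: "smooth_elem (\<lambda>x. c)"
| add: "smooth_elem f \<Longrightarrow> smooth_elem g \<Longrightarrow> smooth_elem (\<lambda>x. f x + g x)"
| mult: "smooth_elem f \<Longrightarrow> smooth_elem g \<Longrightarrow> smooth_elem (\<lambda>x. f x * g x)"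

lemma smooth_elem_differentiable: "smooth_elem f \<Longrightarrow> f differentiable (at x)"
proof (induction rule: smooth_elem.induct)
  case (base k a i c)
  have "(\<lambda>x::real^'a. a * x $ i + c) differentiable (at x)"
    by (intro differentiable_add differentiable_mult differentiable_const
        bounded_linear_imp_differentiable[OF bounded_linear_vec_nth])
  moreover have "flat_exp k differentiable (at (a * x $ i + c))"
    using flat_exp_has_derivative by (auto simp: differentiable_def has_field_derivative_def)
  ultimately show ?case
    using differentiable_chain_at[of "\<lambda>x::real^'a. a * x $ i + c" x "flat_exp k"] by (simp add: o_def)
qed auto

lemma smooth_elem_partial_deriv: "smooth_elem f \<Longrightarrow> smooth_elem (partial_deriv j f)"
proof (induction rule: smooth_elem.induct)
  case (base k a i c)
  define b where "b = (if i = j then a else 0)"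
  have e: "a * (x + t *\<^sub>R axis j 1) $ i + c = b * t + (a * x $ i + c)" for x t
    by (auto simp: axis_def b_def algebra_simps)
  have "partial_deriv j (\<lambda>x. flat_exp k (a * x $ i + c)) x =
      (flat_exp (k + 2) (a * x $ i + c) + (- real k) * flat_exp (k + 1) (a * x $ i + c)) * b" for x :: "real^'a"
  proof (rule partial_deriv_eqI, unfold e)
    have "((\<lambda>t. b * t + (a * x $ i + c)) has_real_derivative b) (at 0)"
      by (auto intro!: derivative_eq_intros)
    from DERIV_chain2[OF flat_exp_has_derivative this]
    show "((\<lambda>t. flat_exp k (b * t + (a * x $ i + c))) has_real_derivative
        (flat_exp (k + 2) (a * x $ i + c) + (- real k) * flat_exp (k + 1) (a * x $ i + c)) * b) (at 0)"
      by simp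
  qed
  then have *: "partial_deriv j (\<lambda>x. flat_exp k (a * x $ i + c)) =
      (\<lambda>x. (flat_exp (k + 2) (a * x $ i + c) + (- real k) * flat_exp (k + 1) (a * x $ i + c)) * b)" by (rule ext)
  show ?case unfolding * by (intro smooth_elem.intros)
next
  case (const c)
  have "partial_deriv j (\<lambda>x. c) x = 0" for x :: "real^'a"
    by (rule partial_deriv_eqI) simp
  then have "partial_deriv j (\<lambda>x::real^'a. c) = (\<lambda>x. 0)" by auto
  then show ?case by (auto intro: smooth_elem.intros)
next
  case (add f g)
  have "partial_deriv j (\<lambda>x. f x + g x) = (\<lambda>x. partial_deriv j f x + partial_deriv j g x)"
    by (intro ext partial_deriv_eqI DERIV_add differentiable_partial_deriv smooth_elem_differentiable add)
  then show ?case by (auto intro: smooth_elem.intros add)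
next
  case (mult f g)
  have "partial_deriv j (\<lambda>x. f x * g x) x = partial_deriv j f x * g x + partial_deriv j g x * f x" for x
    using DERIV_mult[OF differentiable_partial_deriv[OF smooth_elem_differentiable[OF mult(1)]]
       differentiable_partial_deriv[OF smooth_elem_differentiable[OF mult(2)]]]
    by (intro partial_deriv_eqI) simp
  then have *: "partial_deriv j (\<lambda>x. f x * g x) = (\<lambda>x. partial_deriv j f x * g x + partial_deriv j g x * f x)"
    by auto
  show ?case unfolding * by (intro smooth_elem.add smooth_elem.mult mult)
qed

lemma smooth_elem_smooth: assumes "smooth_elem f" shows "smooth_fun f"
proof -
  have "smooth_elem (foldr partial_deriv is f)" for "is"
    using assms by (induction "is") (auto intro: smooth_elem_partial_deriv)
  then show ?thesis
    by (auto simp: smooth_fun_def differentiable_on_def intro: differentiable_at_withinI smooth_elem_differentiable)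
qed

text \<open>Convolution tests a weak derivative against \<open>k (x - y)\<close> as a function of
  \<open>y\<close>, so reflected kernels must be smooth too.\<close>

lemma smooth_elem_reflect: "smooth_elem f \<Longrightarrow> smooth_elem (\<lambda>y. f (x - y))"
proof (induction rule: smooth_elem.induct)
  case (base k a i c)
  have *: "(\<lambda>y. flat_exp k (a * (x - y) $ i + c)) = (\<lambda>y. flat_exp k ((- a) * y $ i + (a * x $ i + c)))"
    by (auto simp: algebra_simps)
  show ?case unfolding * by (rule smooth_elem.base)
qed (auto intro: smooth_elem.intros)

lemma smooth_elem_prod:
  "finite S \<Longrightarrow> (\<And>i. i \<in> S \<Longrightarrow> smooth_elem (f i)) \<Longrightarrow> smooth_elem (\<lambda>x. \<Prod>i\<in>S. f i x)"
  by (induction S rule: finite_induct) (auto intro: smooth_elem.intros)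

lemma smooth_fun_partial_deriv: "smooth_fun f \<Longrightarrow> smooth_fun (partial_deriv i f)"
  unfolding smooth_fun_def
proof
  fix "is" assume "\<forall>is. foldr partial_deriv is f differentiable_on UNIV"
  then have "foldr partial_deriv (is @ [i]) f differentiable_on UNIV" by blast
  then show "foldr partial_deriv is (partial_deriv i f) differentiable_on UNIV" by simp
qed

lemma smooth_fun_differentiable: assumes "smooth_fun f" shows "f differentiable (at x)"
proof -
  have "foldr partial_deriv [] f differentiable_on UNIV"
    using assms unfolding smooth_fun_def by blast
  then show ?thesis by (simp add: differentiable_on_def)
qed

lemma smooth_fun_has_partials: assumes "smooth_fun f" shows "has_partials f (\<lambda>i. partial_deriv i f)"
proof -
  have c: "continuous_on UNIV g" if "smooth_fun g" for g :: "real^'n \<Rightarrow> real"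
    using smooth_fun_differentiable[OF that]
    by (simp add: continuous_at_imp_continuous_on differentiable_imp_continuous_within)
  show ?thesis
    using c[OF assms] c[OF smooth_fun_partial_deriv[OF assms]]
      differentiable_partial_deriv[OF smooth_fun_differentiable[OF assms]]
    by (simp add: has_partials_def has_real_derivative_iff_has_vector_derivative)
qed

section \<open>Symmetry of second partial derivatives\<close>

text \<open>The mean value theorem twice: along \<open>i\<close> for the increment in direction
  \<open>j\<close>, then along \<open>j\<close>. The second difference is symmetric in
  \<open>i\<close> and \<open>j\<close>, so it represents both mixed derivatives at nearby
  points.\<close>

lemma second_difference_mvt:
  assumes f: "has_partials f f'" and fi: "has_partials (f' i) f''" and h: "0 < (h::real)"
  shows "\<exists>y. norm (y - x) \<le> 2 * h \<and>
    f (x + h *\<^sub>R axis i 1 + h *\<^sub>R axis j 1) - f (x + h *\<^sub>R axis i 1) - f (x + h *\<^sub>R axis j 1) + f x = h * h * f'' j y"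
proof -
  let ?i = "axis i (1::real)" and ?j = "axis j (1::real)"
  have "((\<lambda>s. f ((x + h *\<^sub>R ?j) + s *\<^sub>R ?i) - f (x + s *\<^sub>R ?i)) has_real_derivative
      f' i ((x + h *\<^sub>R ?j) + s *\<^sub>R ?i) - f' i (x + s *\<^sub>R ?i)) (at s)" for s
    using has_partials_line[OF f] by (intro DERIV_diff) (simp_all add: has_real_derivative_iff_has_vector_derivative)
  from MVT2[OF h this] obtain s where s: "0 < s" "s < h"
    "f (x + h *\<^sub>R ?j + h *\<^sub>R ?i) - f (x + h *\<^sub>R ?i) - (f (x + h *\<^sub>R ?j + 0 *\<^sub>R ?i) - f (x + 0 *\<^sub>R ?i)) =
      (h - 0) * (f' i (x + h *\<^sub>R ?j + s *\<^sub>R ?i) - f' i (x + s *\<^sub>R ?i))" by blast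
  have "((\<lambda>t. f' i ((x + s *\<^sub>R ?i) + t *\<^sub>R ?j)) has_real_derivative f'' j ((x + s *\<^sub>R ?i) + t *\<^sub>R ?j)) (at t)" for t
    using has_partials_line[OF fi] by (simp add: has_real_derivative_iff_has_vector_derivative)
  from MVT2[OF h this] obtain t where t: "0 < t" "t < h"
    "f' i ((x + s *\<^sub>R ?i) + h *\<^sub>R ?j) - f' i ((x + s *\<^sub>R ?i) + 0 *\<^sub>R ?j) = (h - 0) * f'' j ((x + s *\<^sub>R ?i) + t *\<^sub>R ?j)"
    by blast
  have "norm ((x + s *\<^sub>R ?i + t *\<^sub>R ?j) - x) \<le> norm (s *\<^sub>R ?i) + norm (t *\<^sub>R ?j)"
    by (metis add.assoc add_diff_cancel_left' norm_triangle_ineq)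
  also have "\<dots> \<le> 2 * h" using s t by simp
  finally show ?thesis
    using s(3) t(3) by (intro exI[of _ "x + s *\<^sub>R ?i + t *\<^sub>R ?j"]) (simp add: algebra_simps)
qed

text \<open>Needed because \<open>multi_deriv\<close> differentiates in a fixed order of
  coordinates, whereas weak derivatives are built up one arbitrary direction at a time.\<close>

lemma smooth_fun_partial_deriv_commute:
  assumes "smooth_fun f"
  shows "partial_deriv i (partial_deriv j f) = partial_deriv j (partial_deriv i f)"
proof
  fix x
  let ?a = "partial_deriv i (partial_deriv j f)" and ?b = "partial_deriv j (partial_deriv i f)"
  note hp = smooth_fun_has_partials[OF assms] smooth_fun_has_partials[OF smooth_fun_partial_deriv[OF assms]]
  have ca: "isCont ?a x" and cb: "isCont ?b x"
    using hp(2) by (auto simp: has_partials_def continuous_on_eq_continuous_at)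
  have "dist (?a x) (?b x) \<le> e" if e: "0 < e" for e
  proof -
    obtain d1 where d1: "0 < d1" "\<And>y. dist y x < d1 \<Longrightarrow> dist (?a y) (?a x) < e / 2"
      using ca half_gt_zero[OF e] unfolding continuous_at_eps_delta by blast
    obtain d2 where d2: "0 < d2" "\<And>y. dist y x < d2 \<Longrightarrow> dist (?b y) (?b x) < e / 2"
      using cb half_gt_zero[OF e] unfolding continuous_at_eps_delta by blast
    define h where "h = min d1 d2 / 4"
    have h: "0 < h" "2 * h < d1" "2 * h < d2" using d1 d2 by (auto simp: h_def)
    let ?D = "f (x + h *\<^sub>R axis i 1 + h *\<^sub>R axis j 1) - f (x + h *\<^sub>R axis i 1) - f (x + h *\<^sub>R axis j 1) + f x"
    obtain y where y: "norm (y - x) \<le> 2 * h" "?D = h * h * ?b y"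
      using second_difference_mvt[OF hp(1) hp(2), of h x i j] h by auto
    obtain z where z: "norm (z - x) \<le> 2 * h" "?D = h * h * ?a z"
      using second_difference_mvt[OF hp(1) hp(2), of h x j i] h by (auto simp: algebra_simps)
    have "?a z = ?b y" using y z h by simp
    moreover have "dist (?a z) (?a x) < e / 2" "dist (?b y) (?b x) < e / 2"
      using d1(2)[of z] d2(2)[of y] y z h by (auto simp: dist_norm)
    ultimately show ?thesis
      by (smt (verit) dist_commute dist_triangle field_sum_of_halves)
  qed
  then have "dist (?a x) (?b x) \<le> 0" by (rule field_le_epsilon) simp
  then show "?a x = ?b x" by simp
qed

subsection \<open>Test functions\<close>

lemma test_functionD:
  assumes "\<phi> \<in> test_functions \<Omega>"
  shows "smooth_fun \<phi>" "has_partials \<phi> (\<lambda>i. partial_deriv i \<phi>)"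
    "compact (closure {x. \<phi> x \<noteq> 0})" "closure {x. \<phi> x \<noteq> 0} \<subseteq> \<Omega>"
    "\<And>x. x \<notin> closure {x. \<phi> x \<noteq> 0} \<Longrightarrow> \<phi> x = 0"
  using assms smooth_fun_has_partials subsetD[OF closure_subset, of _ "{x. \<phi> x \<noteq> 0}"]
  by (auto simp: test_functions_def)

lemma partial_deriv_eq_0:
  assumes "open U" "x \<in> U" "\<And>y. y \<in> U \<Longrightarrow> f y = 0"
  shows "partial_deriv i f x = 0"
proof (rule partial_deriv_eqI)
  have "open ((\<lambda>t. x + t *\<^sub>R axis i 1) -` U)"
    by (intro open_vimage assms continuous_intros)
  then have "\<forall>\<^sub>F t in nhds 0. 0 = f (x + t *\<^sub>R axis i 1)"
    by (rule eventually_mono[OF eventually_nhds_in_open]) (use assms in auto)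
  then show "((\<lambda>t. f (x + t *\<^sub>R axis i 1)) has_real_derivative 0) (at 0)"
    by (rule DERIV_cong_ev[OF refl _ refl, THEN iffD1]) simp
qed

lemma test_function_partial_deriv:
  assumes "\<phi> \<in> test_functions \<Omega>" shows "partial_deriv i \<phi> \<in> test_functions \<Omega>"
    and "\<And>x. x \<notin> closure {x. \<phi> x \<noteq> 0} \<Longrightarrow> partial_deriv i \<phi> x = 0"
proof -
  let ?K = "closure {x. \<phi> x \<noteq> 0}"
  note t = test_functionD[OF assms]
  show z: "partial_deriv i \<phi> x = 0" if "x \<notin> ?K" for x
    by (rule partial_deriv_eq_0[of "- ?K"], rule open_Compl, rule closed_closure,
        rule ComplI, erule notE[OF that], rule t(5), erule ComplD)
  then have sub: "closure {x. partial_deriv i \<phi> x \<noteq> 0} \<subseteq> ?K"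
    by (intro closure_minimal) auto
  moreover have "compact (closure {x. partial_deriv i \<phi> x \<noteq> 0})"
    unfolding compact_eq_bounded_closed
    using bounded_subset[OF compact_imp_bounded[OF t(3)] sub] by blast
  ultimately show "partial_deriv i \<phi> \<in> test_functions \<Omega>"
    using smooth_fun_partial_deriv[OF t(1)] t(4) unfolding test_functions_def by blast
qed

lemma smooth_fun_funpow_partial_deriv: "smooth_fun f \<Longrightarrow> smooth_fun ((partial_deriv i ^^ k) f)"
  by (induction k) (auto intro: smooth_fun_partial_deriv)

lemma smooth_fun_foldr_partial_deriv:
  "smooth_fun f \<Longrightarrow> smooth_fun (foldr (\<lambda>j. partial_deriv j ^^ \<alpha> j) js f)"
  by (induction js) (auto intro: smooth_fun_funpow_partial_deriv)

lemma funpow_partial_deriv_commute: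
  "smooth_fun f \<Longrightarrow> (partial_deriv j ^^ k) (partial_deriv i f) = partial_deriv i ((partial_deriv j ^^ k) f)"
  by (induction k) (auto simp: smooth_fun_partial_deriv_commute smooth_fun_funpow_partial_deriv)

text \<open>The extra innermost derivative is commuted outwards until it meets the derivatives in
  its own direction; distinctness ensures that exactly one entry is raised.\<close>

lemma foldr_partial_deriv_Suc:
  assumes "smooth_fun f" "distinct js"
  shows "foldr (\<lambda>j. partial_deriv j ^^ \<alpha> j) js (partial_deriv i f) =
    (if i \<in> set js then foldr (\<lambda>j. partial_deriv j ^^ (\<alpha>(i := Suc (\<alpha> i))) j) js f
     else partial_deriv i (foldr (\<lambda>j. partial_deriv j ^^ \<alpha> j) js f))"
  using assms(2)
proof (induction js)
  case (Cons j js)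
  have s: "smooth_fun (foldr (\<lambda>j. partial_deriv j ^^ \<alpha> j) js f)"
    using assms(1) by (rule smooth_fun_foldr_partial_deriv)
  show ?case
  proof (cases "i = j")
    case True
    then have "i \<notin> set js" using Cons by auto
    then have "foldr (\<lambda>j. partial_deriv j ^^ (\<alpha>(i := Suc (\<alpha> i))) j) js f = foldr (\<lambda>j. partial_deriv j ^^ \<alpha> j) js f"
      by (intro foldr_cong) auto
    then show ?thesis using True \<open>i \<notin> set js\<close> Cons
      by (simp add: funpow_swap1)
  next
    case False
    then show ?thesis using Cons s by (auto simp: funpow_partial_deriv_commute)
  qed
qed simp

lemma multi_deriv_partial_deriv:
  assumes "smooth_fun f"
  shows "multi_deriv \<alpha> (partial_deriv i f) = multi_deriv (\<alpha>(i := Suc (\<alpha> i))) f"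
  using foldr_partial_deriv_Suc[OF assms, of coords \<alpha> i] by (simp add: multi_deriv_def coords_def)

lemma multi_deriv_0: "multi_deriv (\<lambda>_. 0) f = f"
proof -
  have "foldr (\<lambda>i. partial_deriv i ^^ 0) js f = f" for js by (induction js) auto
  then show ?thesis by (simp add: multi_deriv_def)
qed

subsection \<open>Mollifiers\<close>

text \<open>\<open>smooth_elem\<close> is asked for rather than smoothness because closure under
  reflection comes with it. \<open>r\<close> bounds the support only from above, so a mollifier also
  counts as one for any larger radius.\<close>

definition mollifier :: "real \<Rightarrow> (real^'n::finite \<Rightarrow> real) \<Rightarrow> bool" where
  "mollifier r k \<longleftrightarrow> smooth_elem k \<and> (\<forall>x. 0 \<le> k x) \<and> (\<forall>x. r \<le> norm x \<longrightarrow> k x = 0) \<and>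
     integrable lborel k \<and> (\<integral>x. k x \<partial>lborel) = 1"

lemma mollifier_exists:
  assumes "0 < r" shows "\<exists>k. mollifier r (k :: real^'n::finite \<Rightarrow> real)"
proof -
  \<comment> \<open>\<open>k\<close> will be positive exactly on the open cube of half-width
    \<open>s\<close>; there the l1-norm, and with it the Euclidean norm, is below
    \<open>r\<close>.\<close>
  define s where "s = r / CARD('n)"
  have s: "0 < s" using assms by (simp add: s_def)
  define k where "k x = (\<Prod>i\<in>UNIV. flat_exp 0 ((-1) * x $ i + s) * flat_exp 0 (1 * x $ i + s))" for x :: "real^'n"
  have sm: "smooth_elem k"
    unfolding k_def by (intro smooth_elem_prod smooth_elem.intros) auto
  have k0: "0 \<le> k x" for x
    by (auto simp: k_def intro!: prod_nonneg mult_nonneg_nonneg flat_exp_nonneg)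
  have supp: "k x = 0" if "r \<le> norm x" for x
  proof (rule ccontr)
    assume "k x \<noteq> 0"
    then have "flat_exp 0 ((-1) * x $ i + s) \<noteq> 0" "flat_exp 0 (1 * x $ i + s) \<noteq> 0" for i
      by (auto simp: k_def)
    then have "0 < (-1) * x $ i + s" "0 < 1 * x $ i + s" for i
      using flat_exp_nonneg by (metis flat_exp_pos_iff less_eq_real_def)+
    then have "\<bar>x $ i\<bar> < s" for i by (smt (verit) mult_minus1 mult_1)
    then have "(\<Sum>i\<in>UNIV. \<bar>x $ i\<bar>) < (\<Sum>i\<in>(UNIV::'n set). s)" by (intro sum_strict_mono) auto
    also have "\<dots> = r" by (simp add: s_def)
    finally show False using norm_le_l1_cart[of x] that by linarith
  qed
  have ck: "continuous_on UNIV k"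
    using smooth_fun_has_partials[OF smooth_elem_smooth[OF sm]] by (simp add: has_partials_def)
  have int: "integrable lborel k"
  proof -
    have "integrable lborel (\<lambda>x. indicator (cball 0 r) x *\<^sub>R k x)"
      by (intro borel_integrable_compact continuous_on_subset[OF ck]) auto
    also have "(\<lambda>x. indicator (cball 0 r) x *\<^sub>R k x) = k"
      using supp by (auto simp: fun_eq_iff indicator_def)
    finally show ?thesis .
  qed
  have pos: "0 < (\<integral>x. k x \<partial>lborel)"
  proof -
    have "(\<integral>x. k x \<partial>lborel) \<noteq> 0"
    proof
      assume "(\<integral>x. k x \<partial>lborel) = 0"
      then have "AE x in lborel. k x = 0"
        using k0 integral_nonneg_eq_0_iff_AE[OF int] by auto
      moreover have o: "open {x. k x \<noteq> 0}"
        using ck by (intro open_Collect_neq) auto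
      ultimately have "{x. k x \<noteq> 0} \<in> null_sets lborel"
        by (subst AE_iff_null_sets) auto
      then have "negligible {x. k x \<noteq> 0}"
        unfolding negligible_iff_null_sets by (rule null_sets_completionI)
      moreover have "k 0 \<noteq> 0"
        using s flat_exp_pos_iff[of 0 s] by (auto simp: k_def)
      ultimately show False using open_not_negligible[OF o] by blast
    qed
    then show ?thesis using k0 by (simp add: order_less_le)
  qed
  have "mollifier r (\<lambda>x. inverse (\<integral>x. k x \<partial>lborel) * k x)"
    unfolding mollifier_def using sm k0 supp int pos by (auto intro: smooth_elem.intros)
  then show ?thesis by blast
qed

lemma mollifierD:
  assumes "mollifier r k"
  shows "smooth_elem k" "0 \<le> k x" "r \<le> norm x \<Longrightarrow> k x = 0" "integrable lborel k" "(\<integral>x. k x \<partial>lborel) = 1"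
    "has_partials k (\<lambda>i. partial_deriv i k)" "k \<in> borel_measurable borel" "partial_deriv i k \<in> borel_measurable borel"
proof -
  show h: "has_partials k (\<lambda>i. partial_deriv i k)"
    using assms smooth_fun_has_partials smooth_elem_smooth by (auto simp: mollifier_def)
  then show "k \<in> borel_measurable borel" "partial_deriv i k \<in> borel_measurable borel"
    by (auto simp: has_partials_def intro: borel_measurable_continuous_onI)
qed (use assms in \<open>auto simp: mollifier_def\<close>)

lemma mollifier_test_function:
  assumes "mollifier r k" "cball x r \<subseteq> \<Omega>"
  shows "(\<lambda>y. k (x - y)) \<in> test_functions \<Omega>"
proof -
  have "closure {y. k (x - y) \<noteq> 0} \<subseteq> cball x r"
    using mollifierD(3)[OF assms(1)] by (intro closure_minimal) (auto simp: dist_norm, meson linear)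
  moreover from this have "compact (closure {y. k (x - y) \<noteq> 0})"
    by (meson bounded_cball bounded_subset closed_closure compact_eq_bounded_closed)
  moreover have "smooth_fun (\<lambda>y. k (x - y))"
    using mollifierD(1)[OF assms(1)] by (intro smooth_elem_smooth smooth_elem_reflect)
  ultimately show ?thesis using assms(2) by (auto simp: test_functions_def)
qed

lemma partial_deriv_reflect:
  assumes "has_partials k k'" shows "partial_deriv i (\<lambda>y. k (x - y)) y = - (k' i (x - y))"
proof (rule partial_deriv_eqI)
  have "((\<lambda>s. k ((x - y) + s *\<^sub>R axis i 1)) has_real_derivative k' i (x - y)) (at (- 0))"
    using assms by (simp add: has_partials_def has_real_derivative_iff_has_vector_derivative)
  then have "((\<lambda>s. k ((x - y) + (- s) *\<^sub>R axis i 1)) has_real_derivative k' i (x - y) * (- 1)) (at 0)"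
    by (rule DERIV_chain2) (auto intro!: derivative_eq_intros)
  then show "((\<lambda>t. k (x - (y + t *\<^sub>R axis i 1))) has_real_derivative - k' i (x - y)) (at 0)"
    by (simp add: algebra_simps)
qed

subsection \<open>Approximation by convolutions\<close>

lemma lborel_distr_reflect: "distr lborel borel (\<lambda>y. x - y) = (lborel :: 'a::euclidean_space measure)"
  using lborel_affine[of "-1" x] by (simp add: density_1)

lemma lborel_distr_shift: "distr lborel borel (\<lambda>y. y - x) = (lborel :: 'a::euclidean_space measure)"
proof -
  have "(+) (- x) = (\<lambda>y. y - x)" by auto
  then show ?thesis using lborel_distr_plus[of "- x"] by simp
qed

lemma nn_integral_shift:
  fixes f :: "'a::euclidean_space \<Rightarrow> ennreal"
  assumes [measurable]: "f \<in> borel_measurable borel"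
  shows "(\<integral>\<^sup>+y. f (y - x) \<partial>lborel) = (\<integral>\<^sup>+y. f y \<partial>lborel)"
  by (subst (2) lborel_distr_shift[of x, symmetric]) (simp add: nn_integral_distr)

lemma integral_reflect:
  fixes f :: "'a::euclidean_space \<Rightarrow> 'b::{banach, second_countable_topology}"
  assumes [measurable]: "f \<in> borel_measurable borel"
  shows "(\<integral>y. f (x - y) \<partial>lborel) = (\<integral>y. f y \<partial>lborel)"
  by (subst (2) lborel_distr_reflect[of x, symmetric]) (simp add: integral_distr)

lemma integrable_reflect:
  fixes f :: "'a::euclidean_space \<Rightarrow> 'b::{banach, second_countable_topology}"
  assumes "integrable lborel f"
  shows "integrable lborel (\<lambda>y. f (x - y))"
proof -
  have [measurable]: "f \<in> borel_measurable borel" using assms by auto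
  have "integrable (distr lborel borel (\<lambda>y. x - y)) f"
    using assms by (simp add: lborel_distr_reflect)
  then show ?thesis by (subst (asm) integrable_distr_eq) auto
qed

section \<open>Continuity of translation in the mean\<close>

definition L1_modulus :: "('a::euclidean_space \<Rightarrow> 'b::{banach, second_countable_topology}) \<Rightarrow> 'a \<Rightarrow> ennreal" where
  "L1_modulus F z = (\<integral>\<^sup>+x. ennreal (norm (F (x - z) - F x)) \<partial>lborel)"

lemma L1_modulus_approx:
  assumes [measurable]: "F \<in> borel_measurable borel" "G \<in> borel_measurable borel"
  shows "L1_modulus F z \<le> L1_modulus G z + 2 * (\<integral>\<^sup>+x. ennreal (norm (F x - G x)) \<partial>lborel)"
proof -
  have "L1_modulus F z \<le> (\<integral>\<^sup>+x. ennreal (norm (G (x - z) - G x)) +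
      (ennreal (norm (F (x - z) - G (x - z))) + ennreal (norm (F x - G x))) \<partial>lborel)"
    unfolding L1_modulus_def
  proof (intro nn_integral_mono)
    fix x
    let ?a = "G (x - z) - G x" and ?b = "F (x - z) - G (x - z)" and ?c = "F x - G x"
    have "norm (F (x - z) - F x) = norm (?a + (?b + - ?c))" by simp
    also have "\<dots> \<le> norm ?a + (norm ?b + norm ?c)"
      using norm_triangle_ineq[of ?a "?b + - ?c"] norm_triangle_ineq[of ?b "- ?c"]
      by (simp only: norm_minus_cancel)
    finally have "norm (F (x - z) - F x) \<le> norm ?a + (norm ?b + norm ?c)" .
    then show "ennreal (norm (F (x - z) - F x)) \<le> ennreal (norm (G (x - z) - G x)) +
      (ennreal (norm (F (x - z) - G (x - z))) + ennreal (norm (F x - G x)))"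
      by (simp flip: ennreal_plus)
  qed
  also have "\<dots> = L1_modulus G z + ((\<integral>\<^sup>+x. ennreal (norm (F (x - z) - G (x - z))) \<partial>lborel) +
      (\<integral>\<^sup>+x. ennreal (norm (F x - G x)) \<partial>lborel))"
    by (simp add: nn_integral_add L1_modulus_def)
  also have "(\<integral>\<^sup>+x. ennreal (norm (F (x - z) - G (x - z))) \<partial>lborel) = (\<integral>\<^sup>+x. ennreal (norm (F x - G x)) \<partial>lborel)"
    by (rule nn_integral_shift) simp
  finally show ?thesis by (simp add: mult_2)
qed

text \<open>The approximation error enters twice, once translated and once not, and the modulus of
  \<open>G\<close> is the third part; hence e/3.\<close>

lemma L1_modulus_small_approx:
  assumes [measurable]: "F \<in> borel_measurable borel"
    and G: "\<And>e. 0 < e \<Longrightarrow> \<exists>G\<in>borel_measurable borel. (\<integral>\<^sup>+x. ennreal (norm (F x - G x)) \<partial>lborel) \<le> ennreal e \<and>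
       (\<forall>e>0. eventually (\<lambda>z. L1_modulus G z \<le> ennreal e) (nhds 0))"
    and "0 < e"
  shows "eventually (\<lambda>z. L1_modulus F z \<le> ennreal e) (nhds 0)"
proof -
  have e: "0 < e / 3" using \<open>0 < e\<close> by simp
  then obtain G where G [measurable]: "G \<in> borel_measurable borel"
    and FG: "(\<integral>\<^sup>+x. ennreal (norm (F x - G x)) \<partial>lborel) \<le> ennreal (e / 3)"
    and ev: "eventually (\<lambda>z. L1_modulus G z \<le> ennreal (e / 3)) (nhds 0)"
    using G[of "e / 3"] by blast
  show ?thesis using ev
  proof eventually_elim
    case (elim z)
    have "L1_modulus F z \<le> L1_modulus G z + 2 * (\<integral>\<^sup>+x. ennreal (norm (F x - G x)) \<partial>lborel)"
      by (rule L1_modulus_approx) auto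
    also have "\<dots> \<le> ennreal (e / 3) + 2 * ennreal (e / 3)"
      by (intro add_mono elim mult_left_mono FG) auto
    also have "\<dots> = ennreal (e / 3 + 2 * (e / 3))"
    proof -
      have "2 * ennreal (e / 3) = ennreal (2 * (e / 3))"
        using e by (subst ennreal_mult) auto
      then show ?thesis using e by (simp only: ennreal_plus[symmetric] less_imp_le mult_nonneg_nonneg zero_le_numeral)
    qed
    finally show ?case by simp
  qed
qed

lemma norm_ratio_le_1: "norm c / (norm c + 1) \<le> 1"
  using norm_ge_zero[of c] by (subst divide_le_eq_1_pos) (auto simp: add_nonneg_pos)

text \<open>If \<open>x\<close> lies in \<open>U\<close>, so do all nearby points, and dominated
  convergence makes the part of \<open>U\<close> outside its translate small. The opposite
  difference is the same quantity for the shift \<open>- z\<close>, by translation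
  invariance.\<close>

lemma L1_modulus_open:
  fixes U :: "'a::euclidean_space set" and c :: "'b::{banach, second_countable_topology}"
  assumes U: "open U" and fin: "emeasure lborel U < \<infinity>" and "0 < (e::real)"
  shows "eventually (\<lambda>z. L1_modulus (\<lambda>x. indicator U x *\<^sub>R c) z \<le> ennreal e) (nhds 0)"
proof -
  have [measurable]: "U \<in> sets borel" using U by auto
  define g where "g z = (\<integral>\<^sup>+x. indicator U x * indicator (- U) (x - z) \<partial>lborel)" for z :: 'a
  have g_lim: "(\<lambda>n. g (z n)) \<longlonglongrightarrow> 0" if z: "z \<longlonglongrightarrow> 0" for z
  proof -
    have "(\<lambda>n. \<integral>\<^sup>+x. indicator U x * indicator (- U) (x - z n) \<partial>lborel) \<longlonglongrightarrow> (\<integral>\<^sup>+x. 0 \<partial>(lborel :: 'a measure))"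
    proof (rule nn_integral_dominated_convergence[where w = "indicator U"])
      show "(\<integral>\<^sup>+x. indicator U x \<partial>lborel) < \<infinity>" using fin by simp
      show "AE x in lborel. (\<lambda>n. indicator U x * indicator (- U) (x - z n) :: ennreal) \<longlonglongrightarrow> 0"
      proof (rule AE_I2)
        fix x :: 'a
        have "(\<lambda>n. x - z n) \<longlonglongrightarrow> x - 0" by (intro tendsto_intros z)
        then have "eventually (\<lambda>n. x - z n \<in> U) sequentially" if "x \<in> U"
          using U that by (auto intro: topological_tendstoD)
        then show "(\<lambda>n. indicator U x * indicator (- U) (x - z n) :: ennreal) \<longlonglongrightarrow> 0"
          by (cases "x \<in> U") (auto intro!: tendsto_eventually elim: eventually_mono)
      qed
    qed (auto simp: indicator_def)
    then show ?thesis by (simp add: g_def)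
  qed
  have g_ev: "eventually (\<lambda>z. g z < ennreal d) (nhds 0)" if "0 < d" for d
  proof (rule sequentially_imp_eventually_nhds_within[where s = UNIV, simplified], intro allI impI)
    fix z :: "nat \<Rightarrow> 'a" assume "z \<longlonglongrightarrow> 0"
    then show "eventually (\<lambda>n. g (z n) < ennreal d) sequentially"
      using order_tendstoD(2)[OF g_lim] that by simp
  qed
  have bound: "L1_modulus (\<lambda>x. indicator U x *\<^sub>R c) z \<le> ennreal (norm c) * (g z + g (- z))" for z
  proof -
    have "L1_modulus (\<lambda>x. indicator U x *\<^sub>R c) z =
      (\<integral>\<^sup>+x. ennreal (norm c) * (indicator U x * indicator (- U) (x - z) + indicator U (x - z) * indicator (- U) x) \<partial>lborel)"
      unfolding L1_modulus_def by (intro nn_integral_cong) (auto simp: indicator_def)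
    also have "\<dots> = ennreal (norm c) * (g z + (\<integral>\<^sup>+x. indicator U (x - z) * indicator (- U) x \<partial>lborel))"
      by (simp add: nn_integral_cmult nn_integral_add g_def)
    also have "(\<integral>\<^sup>+x. indicator U (x - z) * indicator (- U) x \<partial>lborel) =
        (\<integral>\<^sup>+x. (\<lambda>x. indicator U x * indicator (- U) (x - (- z))) (x - z) \<partial>lborel)"
      by simp
    also have "\<dots> = g (- z)"
      unfolding g_def by (rule nn_integral_shift) measurable
    finally show ?thesis by simp
  qed
  \<comment> \<open>Two such terms, multiplied by \<open>norm c\<close>, stay below
    \<open>e\<close>; adding 1 avoids division by 0.\<close>
  define d where "d = e / (2 * (norm c + 1))"
  have d: "0 < d" using \<open>0 < e\<close> by (auto simp: d_def intro!: divide_pos_pos add_nonneg_pos mult_pos_pos)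
  have d_le: "norm c * (d + d) \<le> e"
  proof -
    have "0 < norm c + 1" by (simp add: add_nonneg_pos)
    then have "d + d = e / (norm c + 1)"
      unfolding d_def by (simp add: divide_simps)
    then have "norm c * (d + d) = e * (norm c / (norm c + 1))" by simp
    also have "\<dots> \<le> e * 1"
      using \<open>0 < e\<close> by (intro mult_left_mono norm_ratio_le_1) auto
    finally show ?thesis by simp
  qed
  have "((\<lambda>z::'a. - z) \<longlongrightarrow> - 0) (nhds 0)"
    by (intro tendsto_minus filterlim_ident)
  then have "((\<lambda>z::'a. - z) \<longlongrightarrow> 0) (nhds 0)" by simp
  then have "eventually (\<lambda>z. g (- z) < ennreal d) (nhds 0)"
    by (rule eventually_compose_filterlim[OF g_ev[OF d]])
  with g_ev[OF d] show ?thesis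
  proof eventually_elim
    case (elim z)
    have "L1_modulus (\<lambda>x. indicator U x *\<^sub>R c) z \<le> ennreal (norm c) * (ennreal d + ennreal d)"
      using elim by (intro order_trans[OF bound] mult_left_mono add_mono) auto
    also have "\<dots> = ennreal (norm c * (d + d))"
    proof -
      have "ennreal (d + d) = ennreal d + ennreal d" using d by (intro ennreal_plus) auto
      then show ?thesis using d by (subst ennreal_mult) auto
    qed
    also have "\<dots> \<le> ennreal e" using d_le by (rule ennreal_leI)
    finally show ?case .
  qed
qed

text \<open>Indicators of open sets are the case with a pointwise argument; outer regularity reaches
  measurable sets of finite measure, and induction over integrable functions the rest.\<close>

lemma L1_modulus_tendsto:
  fixes F :: "'a::euclidean_space \<Rightarrow> 'b::{banach, second_countable_topology}"
  assumes "integrable lborel F" "0 < e"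
  shows "eventually (\<lambda>z. L1_modulus F z \<le> ennreal e) (nhds 0)"
  using assms
proof (induction arbitrary: e rule: integrable_induct)
  case (base A c)
  show ?case
  proof (rule L1_modulus_small_approx[OF _ _ base(3)])
    show "(\<lambda>x. indicator A x *\<^sub>R c) \<in> borel_measurable borel" using base by auto
    fix e :: real assume e: "0 < e"
    define d where "d = e / (norm c + 1)"
    have d: "0 < d" using e by (auto simp: d_def intro!: divide_pos_pos add_nonneg_pos)
    obtain U where U: "open U" "A \<subseteq> U" "emeasure lborel (U - A) < ennreal d"
      using outer_regular_lborel[of A d] base d by auto
    have "emeasure lborel U = emeasure lborel A + emeasure lborel (U - A)"
      using U base by (subst plus_emeasure) (auto simp: Un_absorb1)
    then have fin: "emeasure lborel U < \<infinity>"
      using U base by (auto simp: less_top[symmetric]) 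
    have "(\<integral>\<^sup>+x. ennreal (norm (indicator A x *\<^sub>R c - indicator U x *\<^sub>R c)) \<partial>lborel) =
        (\<integral>\<^sup>+x. ennreal (norm c) * indicator (U - A) x \<partial>lborel)"
      using U by (intro nn_integral_cong) (auto simp: indicator_def)
    also have "\<dots> = ennreal (norm c) * emeasure lborel (U - A)"
      using U base by (subst nn_integral_cmult_indicator) auto
    also have "\<dots> \<le> ennreal (norm c) * ennreal d"
      using U by (intro mult_left_mono) auto
    also have "\<dots> = ennreal (e * (norm c / (norm c + 1)))"
      using d by (simp add: d_def mult.commute flip: ennreal_mult)
    also have "\<dots> \<le> ennreal (e * 1)"
      using e by (intro ennreal_leI mult_left_mono norm_ratio_le_1) auto
    finally show "\<exists>G\<in>borel_measurable borel. (\<integral>\<^sup>+x. ennreal (norm (indicator A x *\<^sub>R c - G x)) \<partial>lborel) \<le> ennreal e \<and>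
       (\<forall>e>0. eventually (\<lambda>z. L1_modulus G z \<le> ennreal e) (nhds 0))"
      using U L1_modulus_open[OF U(1) fin]
      by (intro bexI[of _ "\<lambda>x. indicator U x *\<^sub>R c"]) auto
  qed
next
  case (add f g)
  have [measurable]: "f \<in> borel_measurable borel" "g \<in> borel_measurable borel" using add by auto
  have "0 < e / 2" using add by simp
  from add.IH(1)[OF this] add.IH(2)[OF this] show ?case
  proof eventually_elim
    case (elim z)
    have "L1_modulus (\<lambda>x. f x + g x) z \<le> L1_modulus f z + L1_modulus g z"
      unfolding L1_modulus_def
      by (subst nn_integral_add[symmetric])
        (auto intro!: nn_integral_mono ennreal_leI norm_diff_triangle_ineq simp flip: ennreal_plus)
    also have "\<dots> \<le> ennreal (e / 2) + ennreal (e / 2)" by (intro add_mono elim)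
    also have "\<dots> = ennreal e" using add by (subst ennreal_plus[symmetric]) auto
    finally show ?case .
  qed
next
  case (lim f s)
  show ?case
  proof (rule L1_modulus_small_approx[OF _ _ lim.prems])
    have [measurable]: "f \<in> borel_measurable borel" "\<And>i. s i \<in> borel_measurable borel"
      using lim by auto
    then show "f \<in> borel_measurable borel" by simp
    fix e :: real assume e: "0 < e"
    have "(\<lambda>i. \<integral>\<^sup>+x. ennreal (norm (f x - s i x)) \<partial>lborel) \<longlonglongrightarrow> 0"
      using lim by (intro nn_integral_dominated_convergence_norm[where w = "\<lambda>x. 2 * norm (f x)"])
        (auto simp: integrable_iff_bounded nn_integral_cmult ennreal_mult ennreal_mult_less_top)
    then have "eventually (\<lambda>i. (\<integral>\<^sup>+x. ennreal (norm (f x - s i x)) \<partial>lborel) < ennreal e) sequentially"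
      using e by (intro order_tendstoD(2)) auto
    then obtain i where "(\<integral>\<^sup>+x. ennreal (norm (f x - s i x)) \<partial>lborel) < ennreal e"
      by (auto simp: eventually_sequentially)
    then show "\<exists>G\<in>borel_measurable borel. (\<integral>\<^sup>+x. ennreal (norm (f x - G x)) \<partial>lborel) \<le> ennreal e \<and>
       (\<forall>e>0. eventually (\<lambda>z. L1_modulus G z \<le> ennreal e) (nhds 0))"
      using lim.IH by (intro bexI[of _ "s i"]) auto
  qed
qed

section \<open>Convolution with a mollifier\<close>

definition convol ::
    "(real^'n::finite \<Rightarrow> real) \<Rightarrow> (real^'n \<Rightarrow> 'a::{banach, second_countable_topology}) \<Rightarrow> real^'n \<Rightarrow> 'a" where
  "convol k F x = (\<integral>y. k (x - y) *\<^sub>R F y \<partial>lborel)"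

lemma compact_support_bounded:
  fixes k :: "real^'n::finite \<Rightarrow> real"
  assumes "continuous_on UNIV k" "\<And>x. r < norm x \<Longrightarrow> k x = 0"
  shows "\<exists>B\<ge>0. \<forall>x. \<bar>k x\<bar> \<le> B"
proof -
  have "compact (k ` cball 0 r)"
    using assms by (intro compact_continuous_image continuous_on_subset[OF assms(1)]) auto
  then have "bounded (k ` cball 0 r)" by (rule compact_imp_bounded)
  then obtain B where B: "\<forall>y\<in>k ` cball 0 r. norm y \<le> B"
    unfolding bounded_iff by blast
  have "\<bar>k x\<bar> \<le> max 0 B" for x
    using B assms(2)[of x] by (cases "norm x \<le> r") (auto simp: le_max_iff_disj)
  then show ?thesis by (intro exI[of _ "max 0 B"]) auto
qed

lemma mollifier_bounded:
  fixes k :: "real^'n::finite \<Rightarrow> real"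
  assumes "mollifier r k"
  shows "\<exists>B\<ge>0. (\<forall>x. \<bar>k x\<bar> \<le> B) \<and> (\<forall>i x. \<bar>partial_deriv i k x\<bar> \<le> B)"
proof -
  note k = mollifierD[OF assms]
  have d0: "partial_deriv i k x = 0" if "r < norm x" for i x
    by (rule partial_deriv_eq_0[of "- cball 0 r"]) (use that k(3) in auto)
  have c: "continuous_on UNIV k" "\<And>i. continuous_on UNIV (partial_deriv i k)"
    using k(6) by (auto simp: has_partials_def)
  obtain A where A: "0 \<le> A" "\<And>x. \<bar>k x\<bar> \<le> A"
    using compact_support_bounded[OF c(1), of r] k(3) by (metis less_imp_le)
  have "\<forall>i. \<exists>B\<ge>0. \<forall>x. \<bar>partial_deriv i k x\<bar> \<le> B"
    using compact_support_bounded[OF c(2) d0] by blast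
  then obtain B where B: "\<And>i. 0 \<le> B i" "\<And>i x. \<bar>partial_deriv i k x\<bar> \<le> B i" by metis
  have "\<bar>k x\<bar> \<le> A + sum B UNIV" for x
    using A(2)[of x] B(1) by (simp add: sum_nonneg add_increasing2)
  moreover have "\<bar>partial_deriv i k x\<bar> \<le> A + sum B UNIV" for i x
    using B(2)[of i x] member_le_sum[of i UNIV B] A(1) B(1) by simp
  moreover have "0 \<le> A + sum B UNIV" using A B by (simp add: sum_nonneg)
  ultimately show ?thesis by blast
qed

lemma integrable_bounded_scaleR:
  fixes F :: "'b \<Rightarrow> 'a::{banach, second_countable_topology}" and g :: "'b \<Rightarrow> real"
  assumes "integrable M F" "g \<in> borel_measurable M" "\<And>x. \<bar>g x\<bar> \<le> B"
  shows "integrable M (\<lambda>y. g y *\<^sub>R F y)"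
proof (rule Bochner_Integration.integrable_bound)
  show "integrable M (\<lambda>y. B * norm (F y))" using assms by simp
  show "(\<lambda>y. g y *\<^sub>R F y) \<in> borel_measurable M" using assms by auto
  show "AE y in M. norm (g y *\<^sub>R F y) \<le> norm (B * norm (F y))"
  proof (rule AE_I2)
    fix y
    have "\<bar>g y\<bar> * norm (F y) \<le> B * norm (F y)" by (intro mult_right_mono assms) auto
    then show "norm (g y *\<^sub>R F y) \<le> norm (B * norm (F y))" by simp
  qed
qed

lemma convol_continuous:
  assumes k: "continuous_on UNIV k" "\<And>x. \<bar>k x\<bar> \<le> B" and F: "integrable lborel F"
  shows "continuous_on UNIV (convol k F)"
proof -
  have [measurable]: "k \<in> borel_measurable borel" using k by (intro borel_measurable_continuous_onI)
  have [measurable]: "F \<in> borel_measurable borel" using F by auto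
  have "(\<lambda>n. convol k F (X n)) \<longlonglongrightarrow> convol k F x" if X: "X \<longlonglongrightarrow> x" for X x
    unfolding convol_def
  proof (rule integral_dominated_convergence[where w = "\<lambda>y. B * norm (F y)"])
    show "AE y in lborel. (\<lambda>n. k (X n - y) *\<^sub>R F y) \<longlonglongrightarrow> k (x - y) *\<^sub>R F y"
    proof (intro AE_I2 tendsto_intros)
      fix y
      have "isCont k (x - y)" using k(1) by (simp add: continuous_on_eq_continuous_at)
      then show "(\<lambda>n. k (X n - y)) \<longlonglongrightarrow> k (x - y)"
        by (rule isCont_tendsto_compose) (intro tendsto_intros X)
    qed
    show "AE y in lborel. norm (k (X n - y) *\<^sub>R F y) \<le> B * norm (F y)" for n
      using k(2) by (auto intro!: mult_right_mono)
  qed (use F in auto)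
  then show ?thesis
    by (auto simp: continuous_on_eq_continuous_at continuous_at_sequentially o_def)
qed

lemma has_partials_lipschitz:
  fixes k :: "real^'n::finite \<Rightarrow> 'a::real_normed_vector"
  assumes k: "has_partials k k'" "\<And>x. norm (k' i x) \<le> B"
  shows "norm (k (x + h *\<^sub>R axis i 1) - k x) \<le> B * \<bar>h\<bar>"
proof -
  have d: "((\<lambda>s. k (x + s *\<^sub>R axis i 1)) has_derivative (\<lambda>t. t *\<^sub>R k' i (x + s *\<^sub>R axis i 1))) (at s within UNIV)" for s
    using has_partials_line[OF k(1)] by (simp add: has_vector_derivative_def)
  have o: "onorm (\<lambda>t. t *\<^sub>R k' i (x + s *\<^sub>R axis i 1)) \<le> B" for s
  proof (rule onorm_le)
    show "norm (t *\<^sub>R k' i (x + s *\<^sub>R axis i 1)) \<le> B * norm t" for t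
      using mult_left_mono[OF k(2), of "\<bar>t\<bar>"] by (simp add: mult.commute)
  qed
  from differentiable_bound[OF convex_UNIV d o, of h 0] show ?thesis by simp
qed

text \<open>The kernel is Lipschitz along each axis, so its difference quotients are bounded, and
  dominated convergence moves the derivative under the integral.\<close>

lemma convol_has_partials:
  assumes k: "mollifier r k" and F: "integrable lborel F"
  shows "has_partials (convol k F) (\<lambda>i. convol (partial_deriv i k) F)"
proof -
  note m = mollifierD[OF k]
  obtain B where B: "0 \<le> B" "\<And>x. \<bar>k x\<bar> \<le> B" "\<And>i x. \<bar>partial_deriv i k x\<bar> \<le> B"
    using mollifier_bounded[OF k] by blast
  have c: "continuous_on UNIV k" "\<And>i. continuous_on UNIV (partial_deriv i k)"
    using m(6) by (auto simp: has_partials_def)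
  have [measurable]: "F \<in> borel_measurable borel" using F by auto
  note [measurable] = m(7,8)
  have int: "integrable lborel (\<lambda>y. g (x - y) *\<^sub>R F y)" if "g \<in> borel_measurable borel" "\<And>x. \<bar>g x\<bar> \<le> B" for g x
    using that by (intro integrable_bounded_scaleR[OF F]) auto
  have "((\<lambda>t. convol k F (x + t *\<^sub>R axis i 1)) has_vector_derivative convol (partial_deriv i k) F x) (at 0)" for i x
  proof -
    let ?e = "axis i (1::real)"
    let ?q = "\<lambda>h y. (k (x + h *\<^sub>R ?e - y) - k (x - y)) / h - partial_deriv i k (x - y)"
    have eq: "norm (convol k F (x + h *\<^sub>R ?e) - convol k F x - h *\<^sub>R convol (partial_deriv i k) F x) / norm h
        = norm (\<integral>y. ?q h y *\<^sub>R F y \<partial>lborel)" if "h \<noteq> 0" for h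
    proof -
      have "(\<integral>y. ?q h y *\<^sub>R F y \<partial>lborel) = (\<integral>y. (1 / h) *\<^sub>R (k (x + h *\<^sub>R ?e - y) *\<^sub>R F y - k (x - y) *\<^sub>R F y)
          - partial_deriv i k (x - y) *\<^sub>R F y \<partial>lborel)"
        by (intro Bochner_Integration.integral_cong refl) (simp add: algebra_simps diff_divide_distrib)
      also have "\<dots> = (1 / h) *\<^sub>R (convol k F (x + h *\<^sub>R ?e) - convol k F x) - convol (partial_deriv i k) F x"
        unfolding convol_def using int[of k] int[of "partial_deriv i k"] B
        by (subst Bochner_Integration.integral_diff) (auto simp: Bochner_Integration.integral_diff)
      also have "\<dots> = (1 / h) *\<^sub>R (convol k F (x + h *\<^sub>R ?e) - convol k F x - h *\<^sub>R convol (partial_deriv i k) F x)"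
        using that by (simp add: scaleR_diff_right)
      finally show ?thesis using that by (simp add: divide_inverse mult.commute)
    qed
    have lim: "(\<lambda>n. norm (\<integral>y. ?q (X n) y *\<^sub>R F y \<partial>lborel)) \<longlonglongrightarrow> 0"
      if X: "\<And>n. X n \<noteq> 0" "X \<longlonglongrightarrow> 0" for X
    proof -
      have "(\<lambda>n. \<integral>y. ?q (X n) y *\<^sub>R F y \<partial>lborel) \<longlonglongrightarrow> (\<integral>y. 0 \<partial>(lborel :: (real^'a) measure))"
      proof (rule integral_dominated_convergence[where w = "\<lambda>y. (2 * B) * norm (F y)"])
        show "AE y in lborel. (\<lambda>n. ?q (X n) y *\<^sub>R F y) \<longlonglongrightarrow> 0"
        proof (rule AE_I2)
          fix y
          have "((\<lambda>t. k ((x - y) + t *\<^sub>R ?e)) has_real_derivative partial_deriv i k (x - y)) (at 0)"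
            using m(6) by (simp add: has_partials_def has_real_derivative_iff_has_vector_derivative)
          then have "((\<lambda>h. (k (x + h *\<^sub>R ?e - y) - k (x - y)) / h) \<longlongrightarrow> partial_deriv i k (x - y)) (at 0)"
            by (simp add: DERIV_def algebra_simps)
          then have "(\<lambda>n. (k (x + X n *\<^sub>R ?e - y) - k (x - y)) / X n) \<longlonglongrightarrow> partial_deriv i k (x - y)"
            using X by (auto simp: tendsto_at_iff_sequentially o_def)
          then have "(\<lambda>n. ?q (X n) y *\<^sub>R F y) \<longlonglongrightarrow> (partial_deriv i k (x - y) - partial_deriv i k (x - y)) *\<^sub>R F y"
            by (intro tendsto_intros)
          then show "(\<lambda>n. ?q (X n) y *\<^sub>R F y) \<longlonglongrightarrow> 0" by simp
        qed
        show "AE y in lborel. norm (?q (X n) y *\<^sub>R F y) \<le> 2 * B * norm (F y)" for n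
        proof (rule AE_I2)
          fix y
          have "\<bar>k (x - y + X n *\<^sub>R ?e) - k (x - y)\<bar> \<le> B * \<bar>X n\<bar>"
            using has_partials_lipschitz[OF m(6), of i B "x - y" "X n"] B(3) by simp
          then have "\<bar>(k (x + X n *\<^sub>R ?e - y) - k (x - y)) / X n\<bar> \<le> B"
            using X(1)[of n] by (simp add: abs_divide divide_le_eq algebra_simps)
          then have "\<bar>?q (X n) y\<bar> \<le> 2 * B" using B(3)[of i "x - y"] by linarith
          then show "norm (?q (X n) y *\<^sub>R F y) \<le> 2 * B * norm (F y)"
            by (simp add: mult_right_mono)
        qed
      qed (use F in auto)
      then show ?thesis by (simp add: tendsto_norm_zero)
    qed
    have "((\<lambda>h. norm (convol k F (x + h *\<^sub>R ?e) - convol k F x - h *\<^sub>R convol (partial_deriv i k) F x) / norm h) \<longlongrightarrow> 0) (at 0)"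
      unfolding tendsto_at_iff_sequentially using lim eq by (auto simp: o_def)
    then show ?thesis
      by (simp add: has_vector_derivative_def has_derivative_at bounded_linear_scaleR_left)
  qed
  then show ?thesis
    unfolding has_partials_def using convol_continuous[OF c(1) B(2) F] convol_continuous[OF c(2) B(3) F] by blast
qed

lemma convol_measurable [measurable]:
  assumes [measurable]: "k \<in> borel_measurable borel" "F \<in> borel_measurable borel"
  shows "convol k F \<in> borel_measurable borel"
proof -
  have "(\<lambda>x. \<integral>y. k (x - y) *\<^sub>R F y \<partial>lborel) \<in> borel_measurable lborel"
    by (intro lborel.borel_measurable_lebesgue_integral) measurable
  then show ?thesis by (simp add: convol_def[abs_def])
qed

lemma convol_eq:
  assumes [measurable]: "k \<in> borel_measurable borel" "F \<in> borel_measurable borel"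
  shows "convol k F x = (\<integral>y. k y *\<^sub>R F (x - y) \<partial>lborel)"
  using integral_reflect[of "\<lambda>y. k y *\<^sub>R F (x - y)" x] by (simp add: convol_def)

text \<open>Since \<open>k\<close> has mass 1, the error is the \<open>k\<close>-average of the
  differences \<open>F (x - z) - F x\<close>. Integrating over \<open>x\<close> first leaves an
  average of \<open>L1_modulus F z\<close> over norm z < r.\<close>

lemma convol_L1_dist:
  assumes k: "mollifier r k" and F: "integrable lborel F"
    and e: "\<And>z. norm z < r \<Longrightarrow> L1_modulus F z \<le> ennreal e"
  shows "(\<integral>\<^sup>+x. ennreal (norm (convol k F x - F x)) \<partial>lborel) \<le> ennreal e"
proof -
  note m = mollifierD[OF k]
  note [measurable] = m(7)
  have [measurable]: "F \<in> borel_measurable borel" using F by auto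
  obtain B where B: "0 \<le> B" "\<And>x. \<bar>k x\<bar> \<le> B" "\<And>i x. \<bar>partial_deriv i k x\<bar> \<le> B"
    using mollifier_bounded[OF k] by blast
  have pt: "ennreal (norm (convol k F x - F x)) \<le> (\<integral>\<^sup>+z. ennreal (k z) * ennreal (norm (F (x - z) - F x)) \<partial>lborel)" for x
  proof -
    have i1: "integrable lborel (\<lambda>z. k z *\<^sub>R F (x - z))"
      using B by (intro integrable_bounded_scaleR integrable_reflect F) auto
    have i2: "integrable lborel (\<lambda>z. k z *\<^sub>R F x)" using m(4) by simp
    have "convol k F x - F x = (\<integral>z. k z *\<^sub>R F (x - z) \<partial>lborel) - (\<integral>z. k z *\<^sub>R F x \<partial>lborel)"
      using m(4,5) by (simp add: convol_eq)
    also have "\<dots> = (\<integral>z. k z *\<^sub>R (F (x - z) - F x) \<partial>lborel)"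
      by (subst Bochner_Integration.integral_diff[OF i1 i2, symmetric]) (simp add: scaleR_diff_right)
    finally have "ennreal (norm (convol k F x - F x)) = ennreal (norm (\<integral>z. k z *\<^sub>R (F (x - z) - F x) \<partial>lborel))" by simp
    also have "\<dots> \<le> (\<integral>\<^sup>+z. ennreal (norm (k z *\<^sub>R (F (x - z) - F x))) \<partial>lborel)"
      using Bochner_Integration.integrable_diff[OF i1 i2]
      by (intro integral_norm_bound_ennreal) (simp add: scaleR_diff_right)
    finally show ?thesis using m(2) by (simp add: ennreal_mult)
  qed
  have "(\<integral>\<^sup>+x. ennreal (norm (convol k F x - F x)) \<partial>lborel) \<le>
     (\<integral>\<^sup>+x. (\<integral>\<^sup>+z. ennreal (k z) * ennreal (norm (F (x - z) - F x)) \<partial>lborel) \<partial>lborel)"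
    by (intro nn_integral_mono pt)
  also have "\<dots> = (\<integral>\<^sup>+z. (\<integral>\<^sup>+x. ennreal (k z) * ennreal (norm (F (x - z) - F x)) \<partial>lborel) \<partial>lborel)"
    by (rule lborel_pair.Fubini') measurable
  also have "\<dots> = (\<integral>\<^sup>+z. ennreal (k z) * L1_modulus F z \<partial>lborel)"
    by (simp add: nn_integral_cmult L1_modulus_def)
  also have "\<dots> \<le> (\<integral>\<^sup>+z. ennreal (k z) * ennreal e \<partial>lborel)"
  proof (intro nn_integral_mono)
    show "ennreal (k z) * L1_modulus F z \<le> ennreal (k z) * ennreal e" for z
      using e[of z] m(3)[of z] by (cases "norm z < r") (auto intro: mult_left_mono)
  qed
  also have "\<dots> = ennreal e"
    using m by (simp add: nn_integral_multc nn_integral_eq_integral)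
  finally show ?thesis .
qed

text \<open>Jensen's inequality for the probability density \<open>k (x - y)\<close>:
  \<open>t powr q\<close> lies above its tangent at the mean \<open>c\<close> of
  \<open>norm F\<close>, and this affine function averages to \<open>c powr q\<close>.\<close>

lemma convol_Jensen:
  fixes F :: "real^'n::finite \<Rightarrow> 'a::{banach, second_countable_topology}"
  assumes k: "mollifier r k" and F: "integrable lborel F"
    and Fq: "integrable lborel (\<lambda>x. norm (F x) powr q)" and q: "1 \<le> q"
  shows "norm (convol k F x) powr q \<le> convol k (\<lambda>x. norm (F x) powr q) x"
proof -
  note m = mollifierD[OF k]
  note [measurable] = m(7)
  obtain B where B: "0 \<le> B" "\<And>x. \<bar>k x\<bar> \<le> B" "\<And>i x. \<bar>partial_deriv i k x\<bar> \<le> B"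
    using mollifier_bounded[OF k] by blast
  have i: "integrable lborel (\<lambda>y. k (x - y) *\<^sub>R G y)" if "integrable lborel G" for G :: "real^'n \<Rightarrow> 'b::{banach, second_countable_topology}"
    using B that by (intro integrable_bounded_scaleR) auto
  have ik: "integrable lborel (\<lambda>y. k (x - y))" "(\<integral>y. k (x - y) \<partial>lborel) = 1"
    using m integrable_reflect[of k x] integral_reflect[of k x] by auto
  define c where "c = (\<integral>y. k (x - y) * norm (F y) \<partial>lborel)"
  have c0: "0 \<le> c" unfolding c_def using m(2) by (intro Bochner_Integration.integral_nonneg) auto
  have "norm (convol k F x) \<le> c"
    unfolding convol_def c_def using m(2) integral_norm_bound[of lborel "\<lambda>y. k (x - y) *\<^sub>R F y"] by simp
  then have "norm (convol k F x) powr q \<le> c powr q" using q by (intro powr_mono2) auto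
  also have "c powr q \<le> convol k (\<lambda>x. norm (F x) powr q) x"
  proof (cases "q = 1")
    case True
    then show ?thesis using c0 by (simp add: c_def convol_def)
  next
    case False
    then have q1: "1 < q" using q by simp
    \<comment> \<open>Young's inequality with second factor \<open>c powr (q - 1)\<close> is
      precisely this tangent inequality.\<close>
    have tangent: "q * c powr (q - 1) * t - (q - 1) * c powr q \<le> t powr q" if "0 \<le> t" for t
    proof -
      have "1 / q + 1 / (q / (q - 1)) = 1" using q1 by (simp add: add_divide_distrib[symmetric])
      then have "t * c powr (q - 1) \<le> t powr q / q + (c powr (q - 1)) powr (q / (q - 1)) / (q / (q - 1))"
        using q1 that by (intro Youngs_inequality) auto
      also have "(c powr (q - 1)) powr (q / (q - 1)) = c powr q"
        using q1 by (simp add: powr_powr)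
      finally have "q * (t * c powr (q - 1)) \<le> q * (t powr q / q + c powr q / (q / (q - 1)))"
        using q1 by (intro mult_left_mono) auto
      also have "\<dots> = t powr q + (q - 1) * c powr q"
        using q1 by (simp add: distrib_left)
      finally show ?thesis by (simp add: mult_ac)
    qed
    have "c powr q = q * c powr (q - 1) * c - (q - 1) * c powr q * 1"
    proof -
      have "c powr (q - 1) * c = c powr q" using c0 by (cases "c = 0") (simp_all add: powr_diff)
      then show ?thesis by (simp add: algebra_simps)
    qed
    also have "\<dots> = (\<integral>y. q * c powr (q - 1) * (k (x - y) * norm (F y)) - (q - 1) * c powr q * k (x - y) \<partial>lborel)"
      using i[of "\<lambda>y. norm (F y)"] ik F by (subst Bochner_Integration.integral_diff) (auto simp: c_def)
    also have "\<dots> \<le> (\<integral>y. k (x - y) * norm (F y) powr q \<partial>lborel)"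
    proof (rule integral_mono)
      show "integrable lborel (\<lambda>y. q * c powr (q - 1) * (k (x - y) * norm (F y)) - (q - 1) * c powr q * k (x - y))"
        using i[of "\<lambda>y. norm (F y)"] ik F by auto
      show "integrable lborel (\<lambda>y. k (x - y) * norm (F y) powr q)"
        using i[OF Fq] by simp
      show "q * c powr (q - 1) * (k (x - y) * norm (F y)) - (q - 1) * c powr q * k (x - y) \<le> k (x - y) * norm (F y) powr q" for y
        using mult_left_mono[OF tangent[of "norm (F y)"] m(2)[of "x - y"]] by (simp add: algebra_simps)
    qed
    finally show ?thesis by (simp add: convol_def)
  qed
  finally show ?thesis .
qed

section \<open>Simultaneous almost everywhere approximation\<close>

text \<open>One integrable majorant for the whole sequence is demanded besides convergence; this is
  the form in which dominated convergence consumes the approximation.\<close>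

definition approximated_by ::
    "(real^'n::finite \<Rightarrow> 'a::{banach, second_countable_topology}) \<Rightarrow> (nat \<Rightarrow> real^'n \<Rightarrow> real) \<Rightarrow> bool" where
  "approximated_by F K \<longleftrightarrow> (AE x in lborel. (\<lambda>n. convol (K n) F x) \<longlonglongrightarrow> F x) \<and>
     (\<exists>H. integrable lborel H \<and> (AE x in lborel. \<forall>n. norm (convol (K n) F x) \<le> H x))"

text \<open>The L1 errors are summable, so their pointwise sum is integrable and finite almost
  everywhere. That forces pointwise convergence, and \<open>norm F\<close> plus this sum is the
  majorant.\<close>

lemma approximated_byI:
  assumes k: "\<And>n. mollifier (r n) (K n)" and F: "integrable lborel F"
    and e: "\<And>n. (\<integral>\<^sup>+x. ennreal (norm (convol (K n) F x - F x)) \<partial>lborel) \<le> ennreal ((1/2)^n)"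
  shows "approximated_by F K"
proof -
  have [measurable]: "F \<in> borel_measurable borel" "\<And>n. K n \<in> borel_measurable borel"
    using F mollifierD(7)[OF k] by auto
  define S where "S x = (\<Sum>n. ennreal (norm (convol (K n) F x - F x)))" for x
  have [measurable]: "S \<in> borel_measurable borel" unfolding S_def by measurable
  have "(\<integral>\<^sup>+x. S x \<partial>lborel) = (\<Sum>n. \<integral>\<^sup>+x. ennreal (norm (convol (K n) F x - F x)) \<partial>lborel)"
    unfolding S_def by (intro nn_integral_suminf) measurable
  also have "\<dots> \<le> (\<Sum>n. ennreal ((1/2)^n))" by (rule suminf_le[OF e summableI summableI])
  also have "\<dots> = ennreal 2"
  proof (rule suminf_ennreal_eq)
    show "(\<lambda>n. (1 / 2 :: real) ^ n) sums 2" using geometric_sums[of "1/2::real"] by simp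
  qed simp
  finally have S_fin: "(\<integral>\<^sup>+x. S x \<partial>lborel) < \<infinity>" by (simp add: le_less_trans)
  then have fin: "AE x in lborel. S x < \<infinity>"
    using nn_integral_PInf_AE[of S lborel] by (auto simp: less_top)
  define H where "H x = norm (F x) + enn2real (S x)" for x
  have "integrable lborel (\<lambda>x. enn2real (S x))"
  proof (rule integrableI_bounded)
    have "(\<integral>\<^sup>+x. ennreal (norm (enn2real (S x))) \<partial>lborel) \<le> (\<integral>\<^sup>+x. S x \<partial>lborel)"
      by (intro nn_integral_mono) (auto simp: enn2real_nonneg ennreal_enn2real_if)
    then show "(\<integral>\<^sup>+x. ennreal (norm (enn2real (S x))) \<partial>lborel) < \<infinity>" using S_fin by (rule le_less_trans)
  qed measurable
  then have H: "integrable lborel H" unfolding H_def using F by auto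
  have pt: "(\<lambda>n. convol (K n) F x) \<longlonglongrightarrow> F x \<and> (\<forall>n. norm (convol (K n) F x) \<le> H x)" if x: "S x < \<infinity>" for x
  proof
    have s: "summable (\<lambda>n. norm (convol (K n) F x - F x))"
      using x unfolding S_def by (intro summable_suminf_not_top) auto
    then have "(\<lambda>n. norm (convol (K n) F x - F x)) \<longlonglongrightarrow> 0" by (rule summable_LIMSEQ_zero)
    then show "(\<lambda>n. convol (K n) F x) \<longlonglongrightarrow> F x"
      by (rule LIM_zero_cancel[OF tendsto_norm_zero_cancel])
    have "S x = ennreal (\<Sum>n. norm (convol (K n) F x - F x))"
      unfolding S_def using s by (intro suminf_ennreal2) auto
    then have e: "enn2real (S x) = (\<Sum>n. norm (convol (K n) F x - F x))"
      using s by (simp add: suminf_nonneg)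
    show "\<forall>n. norm (convol (K n) F x) \<le> H x"
    proof
      fix n
      have "(\<Sum>i\<in>{n}. norm (convol (K i) F x - F x)) \<le> (\<Sum>n. norm (convol (K n) F x - F x))"
        by (rule sum_le_suminf[OF s]) auto
      then show "norm (convol (K n) F x) \<le> H x"
        unfolding H_def e using norm_triangle_sub[of "convol (K n) F x" "F x"] by simp
    qed
  qed
  show ?thesis
    unfolding approximated_by_def
  proof (intro conjI exI[of _ H])
    show "AE x in lborel. (\<lambda>n. convol (K n) F x) \<longlonglongrightarrow> F x"
      using fin by eventually_elim (use pt in blast)
    show "AE x in lborel. \<forall>n. norm (convol (K n) F x) \<le> H x"
      using fin by eventually_elim (use pt in blast)
  qed (rule H)
qed

lemma mollifier_mono: "mollifier r k \<Longrightarrow> r \<le> r' \<Longrightarrow> mollifier r' k"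
  by (auto simp: mollifier_def)

text \<open>A single sequence must serve all functions, because products and powers pass to the
  limit together; finiteness permits a common radius at which every modulus is at most (1/2)^n.
  There are two families because the functions have values in \<open>'a\<close> while the powers of
  their norms are real.\<close>

lemma approximation_exists:
  fixes \<F> :: "(real^'n::finite \<Rightarrow> 'a::{banach, second_countable_topology}) set" and \<G> :: "(real^'n \<Rightarrow> real) set"
  assumes "finite \<F>" "finite \<G>" "\<And>F. F \<in> \<F> \<Longrightarrow> integrable lborel F" "\<And>G. G \<in> \<G> \<Longrightarrow> integrable lborel G" and "0 < r"
  shows "\<exists>K. (\<forall>n. mollifier r (K n)) \<and> (\<forall>F\<in>\<F>. approximated_by F K) \<and> (\<forall>G\<in>\<G>. approximated_by G K)"
proof -
  have "\<exists>d k. 0 < d \<and> d \<le> r \<and> mollifier d (k :: real^'n \<Rightarrow> real) \<and> (\<forall>F\<in>\<F>. \<forall>z. norm z < d \<longrightarrow> L1_modulus F z \<le> ennreal ((1/2)^n)) \<and>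
    (\<forall>G\<in>\<G>. \<forall>z. norm z < d \<longrightarrow> L1_modulus G z \<le> ennreal ((1/2)^n))" for n :: nat
  proof -
    have "eventually (\<lambda>z. (\<forall>F\<in>\<F>. L1_modulus F z \<le> ennreal ((1/2)^n)) \<and> (\<forall>G\<in>\<G>. L1_modulus G z \<le> ennreal ((1/2)^n))) (nhds 0)"
      using assms by (intro eventually_conj eventually_ball_finite ballI L1_modulus_tendsto) auto
    then obtain d where d: "0 < d" "\<And>z. norm z < d \<Longrightarrow> (\<forall>F\<in>\<F>. L1_modulus F z \<le> ennreal ((1/2)^n)) \<and> (\<forall>G\<in>\<G>. L1_modulus G z \<le> ennreal ((1/2)^n))"
      unfolding eventually_nhds_metric by (auto simp: dist_norm)
    have "0 < min d r" using d assms by simp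
    then obtain k :: "real^'n \<Rightarrow> real" where "mollifier (min d r) k" using mollifier_exists by blast
    then show ?thesis using d \<open>0 < min d r\<close> by (intro exI[of _ "min d r"] exI[of _ k]) auto
  qed
  then obtain d K where dK: "\<And>n. 0 < d n" "\<And>n. d n \<le> r" "\<And>n. mollifier (d n) (K n :: real^'n \<Rightarrow> real)"
    "\<And>n F z. F \<in> \<F> \<Longrightarrow> norm z < d n \<Longrightarrow> L1_modulus F z \<le> ennreal ((1/2)^n)"
    "\<And>n G z. G \<in> \<G> \<Longrightarrow> norm z < d n \<Longrightarrow> L1_modulus G z \<le> ennreal ((1/2)^n)"
    by metis
  show ?thesis
    using mollifier_mono[OF dK(3) dK(2)] assms(3,4)
    by (intro exI[of _ K] conjI allI ballI approximated_byI[OF dK(3)] convol_L1_dist[OF dK(3)] dK(4,5)) auto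
qed

subsection \<open>Weak partial derivatives\<close>

lemma compact_exhaustion:
  fixes \<Omega> :: "'a::euclidean_space set"
  assumes "open \<Omega>"
  shows "\<exists>C::nat \<Rightarrow> 'a set. (\<forall>n. compact (C n)) \<and> (\<forall>n. C n \<subseteq> \<Omega>) \<and> (\<Union>n. C n) = \<Omega>"
  using open_Union_compact_subsets[OF assms] by metis

lemma compact_enlarge:
  fixes \<Omega> :: "'a::euclidean_space set"
  assumes "compact K" "open \<Omega>" "K \<subseteq> \<Omega>"
  shows "\<exists>d>0. \<exists>K'. compact K' \<and> K' \<subseteq> \<Omega> \<and> (\<forall>x\<in>K. cball x d \<subseteq> K')"
proof -
  obtain d where d: "d > 0" "(\<Union>x\<in>K. cball x d) \<subseteq> \<Omega>"
    using compact_subset_open_imp_cball_epsilon_subset[OF assms] by blast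
  then show ?thesis
    using compact_minkowski_sum_cball[OF assms(1), of d] by blast
qed

text \<open>Local integrability for Borel functions with respect to \<open>lborel\<close>, where
  Fubini's theorem is at hand. \<open>borel_representative\<close> makes the passage from the
  Lebesgue-measurable notion \<open>locally_integrable_on\<close>.\<close>

definition loc_int :: "(real^'n::finite) set \<Rightarrow> (real^'n \<Rightarrow> 'a::{banach, second_countable_topology}) \<Rightarrow> bool" where
  "loc_int \<Omega> f \<longleftrightarrow> f \<in> borel_measurable borel \<and>
     (\<forall>K. compact K \<and> K \<subseteq> \<Omega> \<longrightarrow> integrable lborel (\<lambda>x. indicator K x *\<^sub>R f x))"

definition weak_partial ::
    "(real^'n::finite) set \<Rightarrow> 'n \<Rightarrow> (real^'n \<Rightarrow> 'a::{banach, second_countable_topology}) \<Rightarrow> (real^'n \<Rightarrow> 'a) \<Rightarrow> bool" where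
  "weak_partial \<Omega> i f g \<longleftrightarrow> loc_int \<Omega> f \<and> loc_int \<Omega> g \<and>
     (\<forall>\<phi>\<in>test_functions \<Omega>. (\<integral>x. partial_deriv i \<phi> x *\<^sub>R f x \<partial>lborel) = - (\<integral>x. \<phi> x *\<^sub>R g x \<partial>lborel))"

lemma loc_intD:
  assumes "loc_int \<Omega> f" shows "f \<in> borel_measurable borel"
    "compact K \<Longrightarrow> K \<subseteq> \<Omega> \<Longrightarrow> integrable lborel (\<lambda>x. indicator K x *\<^sub>R f x)"
  using assms by (auto simp: loc_int_def)

lemma weak_partialD:
  assumes "weak_partial \<Omega> i f g"
  shows "loc_int \<Omega> f" "loc_int \<Omega> g"
    "\<phi> \<in> test_functions \<Omega> \<Longrightarrow> (\<integral>x. partial_deriv i \<phi> x *\<^sub>R f x \<partial>lborel) = - (\<integral>x. \<phi> x *\<^sub>R g x \<partial>lborel)"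
  using assms by (auto simp: weak_partial_def)

lemma convol_restrict:
  assumes "\<And>y. y \<notin> K \<Longrightarrow> k (x - y) = 0"
  shows "convol k (\<lambda>y. indicator K y *\<^sub>R f y) x = (\<integral>y. k (x - y) *\<^sub>R f y \<partial>lborel)"
  unfolding convol_def using assms
  by (intro Bochner_Integration.integral_cong refl) (auto simp: indicator_def)

text \<open>Testing with \<open>k (x - y)\<close> moves the derivative from the kernel to the
  function; this needs the ball around \<open>x\<close> to lie in \<Omega>. Restriction to
  \<open>K\<close> makes the functions globally integrable and is invisible to the kernel at such
  \<open>x\<close>.\<close>

lemma convol_weak_partial:
  assumes w: "weak_partial \<Omega> i f g" and k: "mollifier r k" and K: "cball x r \<subseteq> K" "K \<subseteq> \<Omega>"
  shows "convol (partial_deriv i k) (\<lambda>y. indicator K y *\<^sub>R f y) x = convol k (\<lambda>y. indicator K y *\<^sub>R g y) x"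
proof -
  have out: "r < norm (x - y)" if "y \<notin> K" for y
    using that K(1) by (metis dist_norm mem_cball not_le subsetD)
  have k0: "k (x - y) = 0" if "y \<notin> K" for y
    using mollifierD(3)[OF k] out[OF that] by simp
  have dk0: "partial_deriv i k (x - y) = 0" if "y \<notin> K" for y
    by (rule partial_deriv_eq_0[of "- cball 0 r"]) (use out[OF that] mollifierD(3)[OF k] in auto)
  have t: "(\<lambda>y. k (x - y)) \<in> test_functions \<Omega>"
    using K by (intro mollifier_test_function[OF k]) auto
  have "convol (partial_deriv i k) (\<lambda>y. indicator K y *\<^sub>R f y) x = (\<integral>y. partial_deriv i k (x - y) *\<^sub>R f y \<partial>lborel)"
    by (rule convol_restrict) (rule dk0)
  also have "\<dots> = (\<integral>y. - (partial_deriv i (\<lambda>y. k (x - y)) y *\<^sub>R f y) \<partial>lborel)"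
    by (simp add: partial_deriv_reflect[OF mollifierD(6)[OF k]])
  also have "\<dots> = (\<integral>y. k (x - y) *\<^sub>R g y \<partial>lborel)"
    using weak_partialD(3)[OF w t] by simp
  also have "\<dots> = convol k (\<lambda>y. indicator K y *\<^sub>R g y) x"
    by (rule convol_restrict[symmetric]) (rule k0)
  finally show ?thesis .
qed

text \<open>The fundamental lemma of the calculus of variations. On a compact subset the
  convolutions are integrals against test functions and vanish, yet they converge to
  \<open>h\<close> almost everywhere.\<close>

lemma AE_zero_if_test_integrals_zero:
  fixes h :: "real^'n::finite \<Rightarrow> 'a::{banach, second_countable_topology}"
  assumes \<Omega>: "open \<Omega>" and h: "loc_int \<Omega> h"
    and z: "\<And>\<phi>. \<phi> \<in> test_functions \<Omega> \<Longrightarrow> (\<integral>x. \<phi> x *\<^sub>R h x \<partial>lborel) = 0"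
  shows "AE x in lborel. x \<in> \<Omega> \<longrightarrow> h x = 0"
proof -
  have on_compact: "AE x in lborel. x \<in> C \<longrightarrow> h x = 0" if C: "compact C" "C \<subseteq> \<Omega>" for C
  proof -
    obtain d K where d: "0 < d" and K: "compact K" "K \<subseteq> \<Omega>" "\<And>x. x \<in> C \<Longrightarrow> cball x d \<subseteq> K"
      using compact_enlarge[OF C(1) \<Omega> C(2)] by blast
    let ?F = "\<lambda>y. indicator K y *\<^sub>R h y"
    have F: "integrable lborel ?F" using loc_intD(2)[OF h K(1,2)] .
    obtain k where k: "\<And>n. mollifier d (k n)" "approximated_by ?F k"
      using approximation_exists[of "{?F}" "{}" d] F d by auto
    have zero: "convol (k n) ?F x = 0" if "x \<in> C" for n x
    proof -
      have "convol (k n) ?F x = (\<integral>y. k n (x - y) *\<^sub>R h y \<partial>lborel)"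
        using mollifierD(3)[OF k(1)] K(3)[OF that] by (intro convol_restrict) (force simp: dist_norm)
      also have "\<dots> = 0"
        using K(2) K(3)[OF that] by (intro z mollifier_test_function[OF k(1)]) auto
      finally show ?thesis .
    qed
    have "AE x in lborel. (\<lambda>n. convol (k n) ?F x) \<longlonglongrightarrow> ?F x"
      using k(2) by (simp add: approximated_by_def)
    then show ?thesis
    proof eventually_elim
      case (elim x)
      show ?case
      proof
        assume x: "x \<in> C"
        then have "(\<lambda>n. 0) \<longlonglongrightarrow> ?F x" using elim zero by simp
        then have "?F x = 0" using LIMSEQ_unique tendsto_const by blast
        moreover have "x \<in> K" using K(3)[OF x] d by auto
        ultimately show "h x = 0" by simp
      qed
    qed
  qed
  obtain C where C: "\<And>n::nat. compact (C n)" "\<And>n. C n \<subseteq> \<Omega>" "(\<Union>n. C n) = \<Omega>"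
    using compact_exhaustion[OF \<Omega>] by blast
  have "AE x in lborel. \<forall>n. x \<in> C n \<longrightarrow> h x = 0"
    unfolding AE_all_countable using on_compact[OF C(1,2)] by blast
  then show ?thesis by eventually_elim (use C(3) in auto)
qed

section \<open>The product rule for weak partial derivatives\<close>

lemma integrable_continuous_compact_support:
  fixes h :: "real^'n::finite \<Rightarrow> 'a::euclidean_space"
  assumes "continuous_on UNIV h" "compact S" "\<And>x. x \<notin> S \<Longrightarrow> h x = 0"
  shows "integrable lborel h"
proof -
  have "integrable lborel (\<lambda>x. indicator S x *\<^sub>R h x)"
    using assms by (intro borel_integrable_compact continuous_on_subset[OF assms(1)]) auto
  also have "(\<lambda>x. indicator S x *\<^sub>R h x) = h"
    using assms(3) by (auto simp: fun_eq_iff indicator_def)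
  finally show ?thesis .
qed

text \<open>By translation invariance the difference quotients integrate to 0, and they converge to
  the partial derivative under a bounded, compactly supported majorant.\<close>

lemma integral_partial_eq_0:
  fixes H :: "real^'n::finite \<Rightarrow> 'a::euclidean_space"
  assumes H: "has_partials H H'" and S: "compact S" "\<And>x. x \<notin> S \<Longrightarrow> H x = 0" "\<And>x. x \<notin> S \<Longrightarrow> H' i x = 0"
  shows "(\<integral>x. H' i x \<partial>lborel) = 0"
proof -
  let ?e = "axis i (1::real)"
  have c: "continuous_on UNIV H" "continuous_on UNIV (H' i)"
    using H by (auto simp: has_partials_def)
  have [measurable]: "H \<in> borel_measurable borel" "H' i \<in> borel_measurable borel"
    using c by (auto intro: borel_measurable_continuous_onI)
  have int: "integrable lborel H"
    by (rule integrable_continuous_compact_support[OF c(1) S(1,2)])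
  obtain B where B: "\<And>x. x \<in> S \<Longrightarrow> norm (H' i x) \<le> B"
  proof -
    have "bounded (H' i ` S)"
      by (intro compact_imp_bounded compact_continuous_image continuous_on_subset[OF c(2)] S) auto
    then obtain B where "\<forall>y\<in>H' i ` S. norm y \<le> B" unfolding bounded_iff by blast
    then show thesis by (intro that) auto
  qed
  have B': "norm (H' i x) \<le> max 0 B" for x
    using B[of x] S(3)[of x] by (cases "x \<in> S") auto
  \<comment> \<open>\<open>T\<close> contains every point within distance 1 of \<open>S\<close>,
    hence the supports of all difference quotients with step at most 1.\<close>
  obtain T where T: "compact T" "\<And>x. x \<in> S \<Longrightarrow> cball x 1 \<subseteq> T"
    using compact_minkowski_sum_cball[OF S(1), of 1] by blast
  define h where "h n = 1 / real (Suc n)" for n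
  have h: "0 < h n" "h n \<le> 1" for n by (auto simp: h_def)
  have h0: "h \<longlonglongrightarrow> 0" unfolding h_def using LIMSEQ_Suc[OF lim_1_over_n] by simp
  let ?q = "\<lambda>n x. (1 / h n) *\<^sub>R (H (x + h n *\<^sub>R ?e) - H x)"
  have q0: "(\<integral>x. ?q n x \<partial>lborel) = 0" for n
  proof -
    have 1: "(\<integral>x. H (x + h n *\<^sub>R ?e) \<partial>lborel) = (\<integral>x. H x \<partial>lborel)"
      by (subst (2) lborel_distr_shift[of "- (h n *\<^sub>R ?e)", symmetric]) (simp add: integral_distr)
    have 2: "integrable lborel (\<lambda>x. H (x + h n *\<^sub>R ?e))"
    proof -
      have "integrable (distr lborel borel (\<lambda>y. y - (- (h n *\<^sub>R ?e)))) H"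
        using int by (simp only: lborel_distr_shift)
      then show ?thesis by (subst (asm) integrable_distr_eq) auto
    qed
    show ?thesis using int 1 2 by simp
  qed
  have "(\<lambda>n. \<integral>x. ?q n x \<partial>lborel) \<longlonglongrightarrow> (\<integral>x. H' i x \<partial>lborel)"
  proof (rule integral_dominated_convergence[where w = "\<lambda>x. max 0 B * indicator T x"])
    show "integrable lborel (\<lambda>x. max 0 B * indicator T x)"
      using fmeasurable_compact[OF T(1)] by (auto simp: fmeasurable_def)
    show "AE x in lborel. (\<lambda>n. ?q n x) \<longlonglongrightarrow> H' i x"
    proof (rule AE_I2)
      fix x
      have "((\<lambda>t. H (x + t *\<^sub>R ?e)) has_vector_derivative H' i x) (at 0)"
        using H by (simp add: has_partials_def)
      then have "((\<lambda>t. norm (H (x + t *\<^sub>R ?e) - H x - t *\<^sub>R H' i x) / norm t) \<longlongrightarrow> 0) (at 0)"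
        by (simp add: has_vector_derivative_def has_derivative_at)
      then have "(\<lambda>n. norm (H (x + h n *\<^sub>R ?e) - H x - h n *\<^sub>R H' i x) / norm (h n)) \<longlonglongrightarrow> 0"
        by (rule filterlim_compose) (auto intro!: filterlim_atI h0 simp: less_imp_neq[OF h(1), symmetric])
      also have "(\<lambda>n. norm (H (x + h n *\<^sub>R ?e) - H x - h n *\<^sub>R H' i x) / norm (h n)) = (\<lambda>n. norm (?q n x - H' i x))"
      proof
        fix n
        have "?q n x - H' i x = (1 / h n) *\<^sub>R (H (x + h n *\<^sub>R ?e) - H x - h n *\<^sub>R H' i x)"
          using h(1)[of n] by (simp add: scaleR_diff_right)
        then show "norm (H (x + h n *\<^sub>R ?e) - H x - h n *\<^sub>R H' i x) / norm (h n) = norm (?q n x - H' i x)"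
          by (simp only: norm_scaleR) simp
      qed
      finally show "(\<lambda>n. ?q n x) \<longlonglongrightarrow> H' i x"
        by (rule LIM_zero_cancel[OF tendsto_norm_zero_cancel])
    qed
    show "AE x in lborel. norm (?q n x) \<le> max 0 B * indicator T x" for n
    proof (rule AE_I2)
      fix x
      show "norm (?q n x) \<le> max 0 B * indicator T x"
      proof (cases "x \<in> T")
        case True
        have "norm (H (x + h n *\<^sub>R ?e) - H x) \<le> max 0 B * h n"
          using has_partials_lipschitz[OF H B', of x "h n"] h(1)[of n] by simp
        then show ?thesis using True h(1)[of n] by (simp add: divide_le_eq)
      next
        case False
        have "x \<notin> S" using False T(2)[of x] by (metis centre_in_cball subsetD zero_le_one)
        moreover have "x + h n *\<^sub>R ?e \<notin> S"
        proof
          assume "x + h n *\<^sub>R ?e \<in> S"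
          moreover have "x \<in> cball (x + h n *\<^sub>R ?e) 1" using h[of n] by (simp add: dist_norm)
          ultimately show False using T(2) False by blast
        qed
        ultimately show ?thesis using S(2) False by simp
      qed
    qed
  qed auto
  then have "(\<lambda>n. 0) \<longlonglongrightarrow> (\<integral>x. H' i x \<partial>lborel)" by (simp only: q0)
  then show ?thesis using LIMSEQ_unique tendsto_const by blast
qed

lemma has_partials_mult:
  fixes F G :: "real^'n::finite \<Rightarrow> 'a::real_normed_algebra"
  assumes "has_partials F F'" "has_partials G G'"
  shows "has_partials (\<lambda>x. F x * G x) (\<lambda>i x. F' i x * G x + F x * G' i x)"
  unfolding has_partials_def
proof (intro conjI allI)
  fix i x
  show "((\<lambda>t. F (x + t *\<^sub>R axis i 1) * G (x + t *\<^sub>R axis i 1)) has_vector_derivative F' i x * G x + F x * G' i x) (at 0)"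
    using has_vector_derivative_mult[of "\<lambda>t. F (x + t *\<^sub>R axis i 1)" "F' i x" 0 UNIV "\<lambda>t. G (x + t *\<^sub>R axis i 1)" "G' i x"] assms
    by (simp add: has_partials_def add.commute)
qed (use assms in \<open>auto simp: has_partials_def intro!: continuous_intros\<close>)

lemma has_partials_scaleR:
  fixes F :: "real^'n::finite \<Rightarrow> real" and G :: "real^'n \<Rightarrow> 'a::real_normed_vector"
  assumes "has_partials F F'" "has_partials G G'"
  shows "has_partials (\<lambda>x. F x *\<^sub>R G x) (\<lambda>i x. F' i x *\<^sub>R G x + F x *\<^sub>R G' i x)"
  unfolding has_partials_def
proof (intro conjI allI)
  fix i x
  show "((\<lambda>t. F (x + t *\<^sub>R axis i 1) *\<^sub>R G (x + t *\<^sub>R axis i 1)) has_vector_derivative F' i x *\<^sub>R G x + F x *\<^sub>R G' i x) (at 0)"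
    using has_vector_derivative_scaleR[of "\<lambda>t. F (x + t *\<^sub>R axis i 1)" "F' i x" 0 UNIV "\<lambda>t. G (x + t *\<^sub>R axis i 1)" "G' i x"] assms
    by (simp add: has_partials_def add.commute has_real_derivative_iff_has_vector_derivative)
qed (use assms in \<open>auto simp: has_partials_def intro!: continuous_intros\<close>)

text \<open>Young's inequality supplies the exponents below; this form also covers the case that the
  reciprocal exponents add up to less than one.\<close>

definition young_pair :: "real \<Rightarrow> real \<Rightarrow> bool" where
  "young_pair q r \<longleftrightarrow> 1 \<le> q \<and> 1 \<le> r \<and> (\<forall>a\<ge>0. \<forall>b\<ge>0. a * b \<le> 1 + a powr q + b powr r)"

text \<open>The condition that makes a product locally integrable. The exponents are hidden because
  they change from one term of the Leibniz rule to the next.\<close>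

definition loc_pairing :: "(real^'n::finite) set \<Rightarrow> (real^'n \<Rightarrow> 'a::{banach, second_countable_topology}) \<Rightarrow>
    (real^'n \<Rightarrow> 'b::{banach, second_countable_topology}) \<Rightarrow> bool" where
  "loc_pairing \<Omega> f g \<longleftrightarrow> (\<exists>q r. young_pair q r \<and> loc_int \<Omega> (\<lambda>x. norm (f x) powr q) \<and> loc_int \<Omega> (\<lambda>x. norm (g x) powr r))"

lemma loc_int_mult:
  fixes f g :: "real^'n::finite \<Rightarrow> 'a::{real_normed_field, euclidean_space}"
  assumes "loc_int \<Omega> f" "loc_int \<Omega> g" "loc_pairing \<Omega> f g"
  shows "loc_int \<Omega> (\<lambda>x. f x * g x)"
proof -
  have [measurable]: "f \<in> borel_measurable borel" "g \<in> borel_measurable borel" using assms loc_intD by auto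
  obtain q r where y: "young_pair q r" and i: "loc_int \<Omega> (\<lambda>x. norm (f x) powr q)" "loc_int \<Omega> (\<lambda>x. norm (g x) powr r)"
    using assms(3) by (auto simp: loc_pairing_def)
  show ?thesis
    unfolding loc_int_def
  proof (intro conjI allI impI, measurable, elim conjE)
    fix K assume K: "compact K" "K \<subseteq> \<Omega>"
    have [measurable]: "K \<in> sets borel" using K by (simp add: borel_compact)
    have "integrable lborel (\<lambda>x. indicator K x *\<^sub>R (1::real) + indicator K x *\<^sub>R norm (f x) powr q + indicator K x *\<^sub>R norm (g x) powr r)"
      using loc_intD(2)[OF i(1) K] loc_intD(2)[OF i(2) K] fmeasurable_compact[OF K(1)]
      by (intro Bochner_Integration.integrable_add) (auto simp: fmeasurable_def)
    then show "integrable lborel (\<lambda>x. indicator K x *\<^sub>R (f x * g x))"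
    proof (rule Bochner_Integration.integrable_bound)
      show "AE x in lborel. norm (indicator K x *\<^sub>R (f x * g x)) \<le>
        norm (indicator K x *\<^sub>R (1::real) + indicator K x *\<^sub>R norm (f x) powr q + indicator K x *\<^sub>R norm (g x) powr r)"
        using y by (auto simp: young_pair_def indicator_def norm_mult)
    qed measurable
  qed
qed

text \<open>Young's inequality splits the product of the mollified functions into powers, Jensen's
  inequality puts these under the convolution, and the convolved powers have integrable majorants.
  \<open>\<psi>\<close> confines everything to \<open>S\<close>, where the constant 1 is
  integrable.\<close>

lemma convol_mult_tendsto:
  fixes F G :: "real^'n::finite \<Rightarrow> 'a::{real_normed_field, euclidean_space}"
  assumes S: "compact S" and \<psi>: "\<psi> \<in> borel_measurable borel" "\<And>x. \<bar>\<psi> x\<bar> \<le> B" "\<And>x. x \<notin> S \<Longrightarrow> \<psi> x = 0"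
    and int: "integrable lborel F" "integrable lborel G" "integrable lborel (\<lambda>x. norm (F x) powr q)" "integrable lborel (\<lambda>x. norm (G x) powr r)"
    and y: "young_pair q r" and k: "\<And>n. mollifier d (k n)"
    and a: "approximated_by F k" "approximated_by G k" "approximated_by (\<lambda>x. norm (F x) powr q) k" "approximated_by (\<lambda>x. norm (G x) powr r) k"
  shows "(\<lambda>n. \<integral>x. \<psi> x *\<^sub>R (convol (k n) F x * convol (k n) G x) \<partial>lborel) \<longlonglongrightarrow> (\<integral>x. \<psi> x *\<^sub>R (F x * G x) \<partial>lborel)"
proof -
  have [measurable]: "F \<in> borel_measurable borel" "G \<in> borel_measurable borel" "S \<in> sets borel" "\<And>n. k n \<in> borel_measurable borel"
    using int S mollifierD(7)[OF k] by (auto simp: borel_compact)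
  note [measurable] = \<psi>(1)
  obtain H1 where H1: "integrable lborel H1" "AE x in lborel. \<forall>n. norm (convol (k n) (\<lambda>x. norm (F x) powr q) x) \<le> H1 x"
    using a(3) by (auto simp: approximated_by_def)
  obtain H2 where H2: "integrable lborel H2" "AE x in lborel. \<forall>n. norm (convol (k n) (\<lambda>x. norm (G x) powr r) x) \<le> H2 x"
    using a(4) by (auto simp: approximated_by_def)
  have lim: "AE x in lborel. (\<lambda>n. convol (k n) F x) \<longlonglongrightarrow> F x" "AE x in lborel. (\<lambda>n. convol (k n) G x) \<longlonglongrightarrow> G x"
    using a by (auto simp: approximated_by_def)
  have B: "0 \<le> B" using \<psi>(2)[of 0] by linarith
  let ?w = "\<lambda>x. B * (indicator S x + \<bar>H1 x\<bar> + \<bar>H2 x\<bar>)"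
  show ?thesis
  proof (rule integral_dominated_convergence[where w = ?w])
    show "integrable lborel ?w"
      using H1(1) H2(1) fmeasurable_compact[OF S]
      by (intro integrable_mult_right Bochner_Integration.integrable_add) (auto simp: fmeasurable_def)
    show "AE x in lborel. (\<lambda>n. \<psi> x *\<^sub>R (convol (k n) F x * convol (k n) G x)) \<longlonglongrightarrow> \<psi> x *\<^sub>R (F x * G x)"
      using lim by eventually_elim (intro tendsto_intros)
    show "AE x in lborel. norm (\<psi> x *\<^sub>R (convol (k n) F x * convol (k n) G x)) \<le> ?w x" for n
      using H1(2) H2(2)
    proof eventually_elim
      case (elim x)
      show ?case
      proof (cases "x \<in> S")
        case True
        have "norm (convol (k n) F x) * norm (convol (k n) G x)
            \<le> 1 + norm (convol (k n) F x) powr q + norm (convol (k n) G x) powr r"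
          using y by (simp add: young_pair_def)
        also have "\<dots> \<le> 1 + convol (k n) (\<lambda>x. norm (F x) powr q) x + convol (k n) (\<lambda>x. norm (G x) powr r) x"
          using y by (intro add_mono order_refl convol_Jensen[OF k] int) (auto simp: young_pair_def)
        also have "\<dots> \<le> 1 + \<bar>H1 x\<bar> + \<bar>H2 x\<bar>"
          using elim(1)[rule_format, of n] elim(2)[rule_format, of n] by simp
        finally have "\<bar>\<psi> x\<bar> * (norm (convol (k n) F x) * norm (convol (k n) G x)) \<le> B * (1 + \<bar>H1 x\<bar> + \<bar>H2 x\<bar>)"
          using \<psi>(2) B by (intro mult_mono) auto
        then show ?thesis using True by (simp add: norm_mult)
      next
        case False
        then show ?thesis using B \<psi>(3) by simp
      qed
    qed
  qed auto
qed

text \<open>The classical rule for the mollified functions, followed by a limit. Three pairings are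
  assumed because the three products f g, f' g and f g' must each pass to the limit.\<close>

lemma weak_partial_mult:
  fixes f g :: "real^'n::finite \<Rightarrow> 'a::{real_normed_field, euclidean_space}"
  assumes \<Omega>: "open \<Omega>" and f: "weak_partial \<Omega> i f f'" and g: "weak_partial \<Omega> i g g'"
    and p: "loc_pairing \<Omega> f g" "loc_pairing \<Omega> f' g" "loc_pairing \<Omega> f g'"
  shows "weak_partial \<Omega> i (\<lambda>x. f x * g x) (\<lambda>x. f' x * g x + f x * g' x)"
  unfolding weak_partial_def
proof (intro conjI ballI)
  note F = weak_partialD[OF f] and G = weak_partialD[OF g]
  have l1: "loc_int \<Omega> (\<lambda>x. f x * g x)" by (rule loc_int_mult[OF F(1) G(1) p(1)])
  have l2: "loc_int \<Omega> (\<lambda>x. f' x * g x)" by (rule loc_int_mult[OF F(2) G(1) p(2)])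
  have l3: "loc_int \<Omega> (\<lambda>x. f x * g' x)" by (rule loc_int_mult[OF F(1) G(2) p(3)])
  show "loc_int \<Omega> (\<lambda>x. f x * g x)" by fact
  show "loc_int \<Omega> (\<lambda>x. f' x * g x + f x * g' x)"
    using l2 l3 by (auto simp: loc_int_def scaleR_add_right)
  fix \<phi> assume \<phi>: "\<phi> \<in> test_functions \<Omega>"
  define S where "S = closure {x. \<phi> x \<noteq> 0}"
  note t = test_functionD[OF \<phi>, folded S_def]
  have d0: "partial_deriv i \<phi> x = 0" if "x \<notin> S" for x
    using test_function_partial_deriv(2)[OF \<phi>, folded S_def] that .
  obtain d K where d: "0 < d" and K: "compact K" "K \<subseteq> \<Omega>" "\<And>x. x \<in> S \<Longrightarrow> cball x d \<subseteq> K"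
    using compact_enlarge[OF t(3) \<Omega> t(4)] by blast
  have SK: "S \<subseteq> K" using K(3) d by (metis centre_in_cball less_imp_le subsetD subsetI)
  \<comment> \<open>Mollification needs globally integrable functions. Cutting at \<open>K\<close>
    provides them and changes nothing within distance \<open>d\<close> of the support of
    \<phi>.\<close>
  define cut where "cut h = (\<lambda>x. indicator K x *\<^sub>R h x)" for h :: "real^'n \<Rightarrow> 'a"
  define pw where "pw q h = (\<lambda>x. norm (cut h x) powr q)" for q and h :: "real^'n \<Rightarrow> 'a"
  have int: "integrable lborel (cut h)" if "loc_int \<Omega> h" for h
    using loc_intD(2)[OF that K(1,2)] by (simp add: cut_def)
  have intp: "integrable lborel (pw q h)" if "loc_int \<Omega> (\<lambda>x. norm (h x) powr q)" for q h
  proof -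
    have "pw q h = (\<lambda>x. indicator K x *\<^sub>R norm (h x) powr q)"
      by (auto simp: pw_def cut_def indicator_def)
    then show ?thesis using loc_intD(2)[OF that K(1,2)] by simp
  qed
  obtain q1 r1 where 1: "young_pair q1 r1" "integrable lborel (pw q1 f)" "integrable lborel (pw r1 g)"
    using p(1) intp by (auto simp: loc_pairing_def)
  obtain q2 r2 where 2: "young_pair q2 r2" "integrable lborel (pw q2 f')" "integrable lborel (pw r2 g)"
    using p(2) intp by (auto simp: loc_pairing_def)
  obtain q3 r3 where 3: "young_pair q3 r3" "integrable lborel (pw q3 f)" "integrable lborel (pw r3 g')"
    using p(3) intp by (auto simp: loc_pairing_def)
  note ints = int[OF F(1)] int[OF F(2)] int[OF G(1)] int[OF G(2)]
  obtain k where k: "\<And>n. mollifier d (k n)" and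
    a: "\<forall>h\<in>{cut f, cut f', cut g, cut g'}. approximated_by h k"
      "\<forall>h\<in>{pw q1 f, pw r1 g, pw q2 f', pw r2 g, pw q3 f, pw r3 g'}. approximated_by h k"
    using approximation_exists[of "{cut f, cut f', cut g, cut g'}" "{pw q1 f, pw r1 g, pw q2 f', pw r2 g, pw q3 f, pw r3 g'}" d]
      ints 1 2 3 d by (auto simp del: ball_simps)
  have hp: "has_partials (convol (k n) (cut h)) (\<lambda>i. convol (partial_deriv i (k n)) (cut h))" if "loc_int \<Omega> h" for h n
    by (rule convol_has_partials[OF k int[OF that]])
  have eqf: "convol (partial_deriv i (k n)) (cut f) x = convol (k n) (cut f') x" if "x \<in> S" for n x
    unfolding cut_def by (rule convol_weak_partial[OF f k K(3)[OF that] K(2)])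
  have eqg: "convol (partial_deriv i (k n)) (cut g) x = convol (k n) (cut g') x" if "x \<in> S" for n x
    unfolding cut_def by (rule convol_weak_partial[OF g k K(3)[OF that] K(2)])
  have c\<phi>: "continuous_on UNIV \<phi>" "continuous_on UNIV (partial_deriv i \<phi>)"
    using t(2) by (auto simp: has_partials_def)
  then have [measurable]: "\<phi> \<in> borel_measurable borel" "partial_deriv i \<phi> \<in> borel_measurable borel"
    by (auto intro: borel_measurable_continuous_onI)
  have "compact (\<phi> ` S)" "compact (partial_deriv i \<phi> ` S)"
    using t(3) c\<phi> by (auto intro!: compact_continuous_image intro: continuous_on_subset)
  then have "bounded (\<phi> ` S \<union> partial_deriv i \<phi> ` S)"
    by (simp add: compact_imp_bounded)
  then obtain B where B: "\<forall>y\<in>\<phi> ` S \<union> partial_deriv i \<phi> ` S. norm y \<le> B" unfolding bounded_iff by blast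
  have B1: "\<bar>\<phi> x\<bar> \<le> max 0 B" for x
    using B t(5)[of x] by (cases "x \<in> S") (auto simp: le_max_iff_disj)
  have B2: "\<bar>partial_deriv i \<phi> x\<bar> \<le> max 0 B" for x
    using B d0[of x] by (cases "x \<in> S") (auto simp: le_max_iff_disj)
  let ?f = "\<lambda>n. convol (k n) (cut f)" and ?f' = "\<lambda>n. convol (k n) (cut f')"
  let ?g = "\<lambda>n. convol (k n) (cut g)" and ?g' = "\<lambda>n. convol (k n) (cut g')"
  have lim1: "(\<lambda>n. \<integral>x. partial_deriv i \<phi> x *\<^sub>R (?f n x * ?g n x) \<partial>lborel) \<longlonglongrightarrow> (\<integral>x. partial_deriv i \<phi> x *\<^sub>R (cut f x * cut g x) \<partial>lborel)"
    using a 1 by (intro convol_mult_tendsto[where q = q1 and r = r1, OF t(3) _ B2 d0 ints(1) ints(3) _ _ _ k]) (auto simp: pw_def)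
  have lim2: "(\<lambda>n. \<integral>x. \<phi> x *\<^sub>R (?f' n x * ?g n x) \<partial>lborel) \<longlonglongrightarrow> (\<integral>x. \<phi> x *\<^sub>R (cut f' x * cut g x) \<partial>lborel)"
    using a 2 by (intro convol_mult_tendsto[where q = q2 and r = r2, OF t(3) _ B1 t(5) ints(2) ints(3) _ _ _ k]) (auto simp: pw_def)
  have lim3: "(\<lambda>n. \<integral>x. \<phi> x *\<^sub>R (?f n x * ?g' n x) \<partial>lborel) \<longlonglongrightarrow> (\<integral>x. \<phi> x *\<^sub>R (cut f x * cut g' x) \<partial>lborel)"
    using a 3 by (intro convol_mult_tendsto[where q = q3 and r = r3, OF t(3) _ B1 t(5) ints(1) ints(4) _ _ _ k]) (auto simp: pw_def)
  have cont: "continuous_on UNIV (convol (k n) (cut h))" if "loc_int \<Omega> h" for h n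
    using hp[OF that] by (simp add: has_partials_def)
  \<comment> \<open>Integration by parts for the mollified functions. On \<open>S\<close> the
    derivatives of the convolutions are the convolutions of the weak derivatives; off
    \<open>S\<close> the factor \<phi> removes the difference.\<close>
  have eq: "(\<integral>x. partial_deriv i \<phi> x *\<^sub>R (?f n x * ?g n x) \<partial>lborel) =
     - ((\<integral>x. \<phi> x *\<^sub>R (?f' n x * ?g n x) \<partial>lborel) + (\<integral>x. \<phi> x *\<^sub>R (?f n x * ?g' n x) \<partial>lborel))" for n
  proof -
    let ?H' = "\<lambda>i x. partial_deriv i \<phi> x *\<^sub>R (?f n x * ?g n x) + \<phi> x *\<^sub>R
        (convol (partial_deriv i (k n)) (cut f) x * ?g n x + ?f n x * convol (partial_deriv i (k n)) (cut g) x)"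
    have H: "has_partials (\<lambda>x. \<phi> x *\<^sub>R (?f n x * ?g n x)) ?H'"
      by (rule has_partials_scaleR[OF t(2) has_partials_mult[OF hp[OF F(1)] hp[OF G(1)]]])
    have "?H' i x = 0" if "x \<notin> S" for x using t(5)[OF that] d0[OF that] by simp
    moreover have "\<phi> x *\<^sub>R (?f n x * ?g n x) = 0" if "x \<notin> S" for x using t(5)[OF that] by simp
    ultimately have "(\<integral>x. ?H' i x \<partial>lborel) = 0"
      using integral_partial_eq_0[OF H t(3), of i] by blast
    also have "?H' i = (\<lambda>x. partial_deriv i \<phi> x *\<^sub>R (?f n x * ?g n x) + (\<phi> x *\<^sub>R (?f' n x * ?g n x) + \<phi> x *\<^sub>R (?f n x * ?g' n x)))"
    proof
      fix x
      show "?H' i x = partial_deriv i \<phi> x *\<^sub>R (?f n x * ?g n x) + (\<phi> x *\<^sub>R (?f' n x * ?g n x) + \<phi> x *\<^sub>R (?f n x * ?g' n x))"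
        by (cases "x \<in> S") (simp_all add: eqf eqg t(5) scaleR_add_right)
    qed
    finally have sum0: "(\<integral>x. partial_deriv i \<phi> x *\<^sub>R (?f n x * ?g n x) + (\<phi> x *\<^sub>R (?f' n x * ?g n x) + \<phi> x *\<^sub>R (?f n x * ?g' n x)) \<partial>lborel) = 0" .
    have i1: "integrable lborel (\<lambda>x. partial_deriv i \<phi> x *\<^sub>R (?f n x * ?g n x))"
      using d0 by (intro integrable_continuous_compact_support[OF _ t(3)] continuous_intros c\<phi> cont F G) auto
    have i2: "integrable lborel (\<lambda>x. \<phi> x *\<^sub>R (?f' n x * ?g n x))"
      using t(5) by (intro integrable_continuous_compact_support[OF _ t(3)] continuous_intros c\<phi> cont F G) auto
    have i3: "integrable lborel (\<lambda>x. \<phi> x *\<^sub>R (?f n x * ?g' n x))"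
      using t(5) by (intro integrable_continuous_compact_support[OF _ t(3)] continuous_intros c\<phi> cont F G) auto
    show ?thesis
      using sum0 unfolding Bochner_Integration.integral_add[OF i1 Bochner_Integration.integrable_add[OF i2 i3]]
        Bochner_Integration.integral_add[OF i2 i3] by (rule eq_neg_iff_add_eq_0[THEN iffD2])
  qed
  have "(\<integral>x. partial_deriv i \<phi> x *\<^sub>R (cut f x * cut g x) \<partial>lborel) =
     - ((\<integral>x. \<phi> x *\<^sub>R (cut f' x * cut g x) \<partial>lborel) + (\<integral>x. \<phi> x *\<^sub>R (cut f x * cut g' x) \<partial>lborel))"
    by (rule LIMSEQ_unique[OF lim1]) (unfold eq, intro tendsto_intros lim2 lim3)
  moreover have drop: "(\<lambda>x. \<psi> x *\<^sub>R (cut h x * cut h' x)) = (\<lambda>x. \<psi> x *\<^sub>R (h x * h' x))"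
    if "\<And>x. x \<notin> S \<Longrightarrow> \<psi> x = 0" for \<psi> h h'
    using that SK by (force simp: cut_def indicator_def fun_eq_iff)
  moreover have supp: "integrable lborel (\<lambda>x. \<phi> x *\<^sub>R h x)" if h: "loc_int \<Omega> h" for h :: "real^'n \<Rightarrow> 'a"
  proof -
    have "integrable lborel (\<lambda>x. \<phi> x *\<^sub>R (indicator K x *\<^sub>R h x))"
      by (rule integrable_bounded_scaleR[OF loc_intD(2)[OF h K(1,2)] _ B1]) simp
    also have "(\<lambda>x. \<phi> x *\<^sub>R (indicator K x *\<^sub>R h x)) = (\<lambda>x. \<phi> x *\<^sub>R h x)"
      using SK t(5) by (force simp: indicator_def fun_eq_iff)
    finally show ?thesis .
  qed
  ultimately show "(\<integral>x. partial_deriv i \<phi> x *\<^sub>R (f x * g x) \<partial>lborel) = - (\<integral>x. \<phi> x *\<^sub>R (f' x * g x + f x * g' x) \<partial>lborel)"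
    using supp[OF l2] supp[OF l3] d0 t(5) by (simp add: drop scaleR_add_right)
qed

subsection \<open>Sobolev inequality with a compactly supported weight\<close>

lemma abs_add_powr_le:
  fixes a b p :: real assumes "0 \<le> p"
  shows "\<bar>a + b\<bar> powr p \<le> 2 powr p * (\<bar>a\<bar> powr p + \<bar>b\<bar> powr p)"
proof -
  have "\<bar>a + b\<bar> powr p \<le> (2 * max \<bar>a\<bar> \<bar>b\<bar>) powr p"
    using assms by (intro powr_mono2) auto
  also have "\<dots> = 2 powr p * max \<bar>a\<bar> \<bar>b\<bar> powr p" by (simp add: powr_mult)
  also have "\<dots> \<le> 2 powr p * (\<bar>a\<bar> powr p + \<bar>b\<bar> powr p)"
    by (intro mult_left_mono) (auto simp: max_def)
  finally show ?thesis .
qed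

text \<open>The classical inequality is applied to \<open>w\<close> times the mollified
  \<open>f\<close>; the limit uses Fatou's lemma on the left and dominated convergence on the right.
  The bound sees \<open>w\<close> and \<open>S\<close> only through \<open>D\<close>, which allows
  cutoffs to be removed later.\<close>

lemma sobolev_compact_weight:
  fixes f :: "real^'n::finite \<Rightarrow> real" and p D :: real
  defines "n \<equiv> real CARD('n)"
  assumes p: "1 < p" "p < n" and \<Omega>: "open \<Omega>" and f: "\<And>i. weak_partial \<Omega> i f (f' i)"
    and fp: "loc_int \<Omega> (\<lambda>x. norm (f x) powr p)" "\<And>i. loc_int \<Omega> (\<lambda>x. norm (f' i x) powr p)"
    and w: "has_partials w w'" and S: "compact S" "S \<subseteq> \<Omega>" "\<And>x. x \<notin> S \<Longrightarrow> w x = 0" "\<And>i x. x \<notin> S \<Longrightarrow> w' i x = 0"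
    and D: "\<And>i. (\<integral>\<^sup>+x. ennreal (\<bar>w' i x * f x + w x * f' i x\<bar> powr p) \<partial>lborel) \<le> ennreal D" "0 \<le> D"
  shows "(\<integral>\<^sup>+x. ennreal (\<bar>w x * f x\<bar> powr (n * p / (n - p))) \<partial>lborel)
    \<le> ennreal (((p * (n - 1) / (n - p)) * (n * D) powr (1 / p)) powr (n * p / (n - p)))"
proof -
  define s where "s = n * p / (n - p)"
  define g where "g = p * (n - 1) / (n - p)"
  have n1: "1 < n" using p by simp
  have s0: "0 < s" using p n1 by (simp add: s_def)
  have g0: "0 < g" using p n1 by (simp add: g_def)
  note F = weak_partialD[OF f]
  obtain d K where d: "0 < d" and K: "compact K" "K \<subseteq> \<Omega>" "\<And>x. x \<in> S \<Longrightarrow> cball x d \<subseteq> K"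
    using compact_enlarge[OF S(1) \<Omega> S(2)] by blast
  have SK: "S \<subseteq> K" using K(3) d by (metis centre_in_cball less_imp_le subsetD subsetI)
  define cut where "cut h = (\<lambda>x. indicator K x *\<^sub>R h x)" for h :: "real^'n \<Rightarrow> real"
  define pw where "pw h = (\<lambda>x. norm (cut h x) powr p)" for h :: "real^'n \<Rightarrow> real"
  have int: "integrable lborel (cut h)" if "loc_int \<Omega> h" for h
    using loc_intD(2)[OF that K(1,2)] by (simp add: cut_def)
  have intp: "integrable lborel (pw h)" if "loc_int \<Omega> (\<lambda>x. norm (h x) powr p)" for h
  proof -
    have "pw h = (\<lambda>x. indicator K x *\<^sub>R norm (h x) powr p)"
      by (auto simp: pw_def cut_def indicator_def)
    then show ?thesis using loc_intD(2)[OF that K(1,2)] by simp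
  qed
  have a1: "integrable lborel h" if "h \<in> insert (cut f) (range (\<lambda>i. cut (f' i)))" for h
    using that int F(1,2) by auto
  have a2: "integrable lborel h" if "h \<in> insert (pw f) (range (\<lambda>i. pw (f' i)))" for h
    using that intp fp by auto
  obtain k where k: "\<And>m. mollifier d (k m)" and
    a: "\<forall>h\<in>insert (cut f) (range (\<lambda>i. cut (f' i))). approximated_by h k"
      "\<forall>h\<in>insert (pw f) (range (\<lambda>i. pw (f' i))). approximated_by h k"
    using approximation_exists[OF _ _ a1 a2 d] by (metis finite_imageI finite_insert finite_code)
  have hp: "has_partials (convol (k m) (cut f)) (\<lambda>i. convol (partial_deriv i (k m)) (cut f))" for m
    by (rule convol_has_partials[OF k int[OF F(1)]])
  have eqf: "convol (partial_deriv i (k m)) (cut f) x = convol (k m) (cut (f' i)) x" if "x \<in> S" for i m x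
    unfolding cut_def by (rule convol_weak_partial[OF f k K(3)[OF that] K(2)])
  have cw: "continuous_on UNIV w" "\<And>i. continuous_on UNIV (w' i)"
    using w by (auto simp: has_partials_def)
  have [measurable]: "w \<in> borel_measurable borel" "\<And>i. w' i \<in> borel_measurable borel"
    using cw by (auto intro: borel_measurable_continuous_onI)
  have [measurable]: "f \<in> borel_measurable borel" "\<And>i. f' i \<in> borel_measurable borel" "\<And>m. k m \<in> borel_measurable borel"
    "K \<in> sets borel" "S \<in> sets borel"
    using F(1,2) loc_intD(1) mollifierD(7)[OF k] K(1) S(1) by (auto simp: borel_compact)
  have [measurable]: "cut f \<in> borel_measurable borel" "\<And>i. cut (f' i) \<in> borel_measurable borel"
    unfolding cut_def by measurable
  have "\<exists>B\<ge>0. \<forall>x. \<bar>h x\<bar> \<le> B" if h: "continuous_on UNIV h" "\<And>x. x \<notin> S \<Longrightarrow> h x = 0" for h :: "real^'n \<Rightarrow> real"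
  proof -
    obtain R where "\<And>x. x \<in> S \<Longrightarrow> norm x \<le> R"
      using compact_imp_bounded[OF S(1)] unfolding bounded_iff by blast
    then have "h x = 0" if "R < norm x" for x using h(2)[of x] that by force
    then show ?thesis using compact_support_bounded[OF h(1)] by blast
  qed
  from this[OF cw(1) S(3)] this[OF cw(2) S(4)]
  obtain B B' where B: "\<And>x. \<bar>w x\<bar> \<le> B" "\<And>i x. \<bar>w' i x\<bar> \<le> B' i" by metis
  \<comment> \<open>The gradient of \<open>w\<close> times the mollified \<open>f\<close>, with the
    mollified weak derivative in place of the derivative of the mollified function; the two agree
    wherever \<open>w\<close> is nonzero.\<close>
  define u where "u m i x = w' i x * convol (k m) (cut f) x + w x * convol (k m) (cut (f' i)) x" for m i x
  define v where "v i x = w' i x * f x + w x * f' i x" for i x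
  have [measurable]: "u m i \<in> borel_measurable borel" "v i \<in> borel_measurable borel" for m i
    unfolding u_def v_def by measurable
  have vcut: "v i x = w' i x * cut f x + w x * cut (f' i) x" for i x
    using S(3)[of x] S(4)[of x] SK by (cases "x \<in> S") (auto simp: v_def cut_def)
  have lim_f: "AE x in lborel. (\<lambda>m. convol (k m) (cut f) x) \<longlonglongrightarrow> cut f x"
    and lim_f': "\<And>i. AE x in lborel. (\<lambda>m. convol (k m) (cut (f' i)) x) \<longlonglongrightarrow> cut (f' i) x"
    using a by (auto simp: approximated_by_def)
  have u_int: "integrable lborel (\<lambda>x. \<bar>u m i x\<bar> powr p)" and v_int: "integrable lborel (\<lambda>x. \<bar>v i x\<bar> powr p)"
    and u_lim: "(\<lambda>m. \<integral>x. \<bar>u m i x\<bar> powr p \<partial>lborel) \<longlonglongrightarrow> (\<integral>x. \<bar>v i x\<bar> powr p \<partial>lborel)" for i m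
  proof -
    obtain H1 where H1: "integrable lborel H1" "AE x in lborel. \<forall>m. norm (convol (k m) (pw f) x) \<le> H1 x"
      using a(2) by (auto simp: approximated_by_def)
    obtain H2 where H2: "integrable lborel H2" "AE x in lborel. \<forall>m. norm (convol (k m) (pw (f' i)) x) \<le> H2 x"
      using a(2) by (auto simp: approximated_by_def)
    let ?W = "\<lambda>x. 2 powr p * (B' i powr p * H1 x + B powr p * H2 x)"
    have W: "integrable lborel ?W" using H1(1) H2(1) by auto
    have lim: "AE x in lborel. (\<lambda>m. \<bar>u m i x\<bar> powr p) \<longlonglongrightarrow> \<bar>v i x\<bar> powr p"
      using lim_f lim_f'[of i]
    proof eventually_elim
      case (elim x)
      have "(\<lambda>m. u m i x) \<longlonglongrightarrow> v i x"
        unfolding u_def vcut by (intro tendsto_intros elim)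
      then show ?case using p by (intro tendsto_powr' tendsto_intros) auto
    qed
    have bound: "AE x in lborel. norm (\<bar>u m i x\<bar> powr p) \<le> ?W x" for m
      using H1(2) H2(2)
    proof eventually_elim
      case (elim x)
      have "\<bar>u m i x\<bar> powr p \<le> 2 powr p * (\<bar>w' i x * convol (k m) (cut f) x\<bar> powr p + \<bar>w x * convol (k m) (cut (f' i)) x\<bar> powr p)"
        unfolding u_def using p by (intro abs_add_powr_le) auto
      also have "\<dots> = 2 powr p * (\<bar>w' i x\<bar> powr p * norm (convol (k m) (cut f) x) powr p + \<bar>w x\<bar> powr p * norm (convol (k m) (cut (f' i)) x) powr p)"
        by (simp add: abs_mult powr_mult)
      also have "\<dots> \<le> ?W x"
      proof (intro mult_left_mono add_mono mult_mono powr_mono2)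
        have "norm (convol (k m) (cut f) x) powr p \<le> convol (k m) (pw f) x"
          unfolding pw_def using a2 p
          by (intro convol_Jensen[OF k int[OF F(1)]]) (auto simp: pw_def)
        also have "\<dots> \<le> H1 x" using elim(1)[rule_format, of m] by simp
        finally show "norm (convol (k m) (cut f) x) powr p \<le> H1 x" .
        have "norm (convol (k m) (cut (f' i)) x) powr p \<le> convol (k m) (pw (f' i)) x"
          unfolding pw_def using a2 p
          by (intro convol_Jensen[OF k int[OF F(2)]]) (auto simp: pw_def)
        also have "\<dots> \<le> H2 x" using elim(2)[rule_format, of m] by simp
        finally show "norm (convol (k m) (cut (f' i)) x) powr p \<le> H2 x" .
      qed (use B p in auto)
      finally show ?case by simp
    qed
    show "integrable lborel (\<lambda>x. \<bar>v i x\<bar> powr p)"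
      by (rule integrable_dominated_convergence[OF _ _ W lim bound]) auto
    show "(\<lambda>m. \<integral>x. \<bar>u m i x\<bar> powr p \<partial>lborel) \<longlonglongrightarrow> (\<integral>x. \<bar>v i x\<bar> powr p \<partial>lborel)"
      by (rule integral_dominated_convergence[OF _ _ W lim bound]) auto
    show "integrable lborel (\<lambda>x. \<bar>u m i x\<bar> powr p)"
      by (rule Bochner_Integration.integrable_bound[OF W])
        (use bound[of m] in \<open>auto elim!: eventually_mono intro: order_trans[OF _ abs_ge_self]\<close>)
  qed
  \<comment> \<open>The classical inequality wants one bound for all directions. The sum over
    \<open>i\<close> is such a bound and it converges in \<open>m\<close>, at the price of the
    factor \<open>n\<close>.\<close>
  define E where "E m = (\<Sum>i\<in>UNIV. \<integral>x. \<bar>u m i x\<bar> powr p \<partial>lborel)" for m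
  define E0 where "E0 = (\<Sum>i\<in>UNIV. \<integral>x. \<bar>v i x\<bar> powr p \<partial>lborel)"
  have E_lim: "E \<longlonglongrightarrow> E0" unfolding E_def E0_def by (intro tendsto_sum u_lim)
  have E0_le: "E0 \<le> n * D"
  proof -
    have "(\<integral>x. \<bar>v i x\<bar> powr p \<partial>lborel) \<le> D" for i
    proof -
      have "ennreal (\<integral>x. \<bar>v i x\<bar> powr p \<partial>lborel) = (\<integral>\<^sup>+x. ennreal (\<bar>v i x\<bar> powr p) \<partial>lborel)"
        using v_int by (intro nn_integral_eq_integral[symmetric]) auto
      also have "\<dots> \<le> ennreal D" unfolding v_def by (rule D)
      finally show ?thesis using D(2) by simp
    qed
    then have "E0 \<le> (\<Sum>i\<in>(UNIV :: 'n set). D)" unfolding E0_def by (intro sum_mono)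
    then show ?thesis by (simp add: n_def)
  qed
  have E_nonneg: "0 \<le> E m" "0 \<le> E0" for m unfolding E_def E0_def by (auto intro!: sum_nonneg)
  let ?\<Phi> = "\<lambda>t. (g * t powr (1 / p)) powr s"
  have X: "(\<integral>\<^sup>+x. ennreal (\<bar>w x * convol (k m) (cut f) x\<bar> powr s) \<partial>lborel) \<le> ennreal (?\<Phi> (E m))" for m
  proof -
    obtain R where R: "\<And>x. x \<in> S \<Longrightarrow> norm x \<le> R"
      using compact_imp_bounded[OF S(1)] unfolding bounded_iff by blast
    have H: "has_partials (\<lambda>x. w x * convol (k m) (cut f) x)
        (\<lambda>i x. w' i x * convol (k m) (cut f) x + w x * convol (partial_deriv i (k m)) (cut f) x)"
      by (rule has_partials_mult[OF w hp])
    have eq: "w' i x * convol (k m) (cut f) x + w x * convol (partial_deriv i (k m)) (cut f) x = u m i x" for i x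
      unfolding u_def using eqf S(3) by (cases "x \<in> S") auto
    have Hu: "has_partials (\<lambda>x. w x * convol (k m) (cut f) x) (u m)"
      using H unfolding eq by (simp add: eta_contract_eq)
    show ?thesis
      unfolding s_def g_def n_def
    proof (rule gagliardo_nirenberg_sobolev[OF p(1) p(2)[unfolded n_def] Hu])
      show "w x * convol (k m) (cut f) x = 0" if "R < norm x" for x
        using R[of x] S(3)[of x] that by fastforce
      show "(\<integral>\<^sup>+x. ennreal (\<bar>u m i x\<bar> powr p) \<partial>lborel) \<le> ennreal (E m)" for i
      proof -
        have "(\<integral>\<^sup>+x. ennreal (\<bar>u m i x\<bar> powr p) \<partial>lborel) = ennreal (\<integral>x. \<bar>u m i x\<bar> powr p \<partial>lborel)"
          using u_int by (intro nn_integral_eq_integral) auto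
        also have "\<dots> \<le> ennreal (E m)"
          unfolding E_def by (intro ennreal_leI member_le_sum) auto
        finally show ?thesis .
      qed
    qed (rule E_nonneg)
  qed
  have "(\<integral>\<^sup>+x. ennreal (\<bar>w x * f x\<bar> powr s) \<partial>lborel)
      = (\<integral>\<^sup>+x. liminf (\<lambda>m. ennreal (\<bar>w x * convol (k m) (cut f) x\<bar> powr s)) \<partial>lborel)"
  proof (rule nn_integral_cong_AE)
    show "AE x in lborel. ennreal (\<bar>w x * f x\<bar> powr s) = liminf (\<lambda>m. ennreal (\<bar>w x * convol (k m) (cut f) x\<bar> powr s))"
      using lim_f
    proof eventually_elim
      case (elim x)
      have wc: "w x * cut f x = w x * f x"
        using S(3)[of x] SK by (cases "x \<in> S") (auto simp: cut_def)
      have "(\<lambda>m. w x * convol (k m) (cut f) x) \<longlonglongrightarrow> w x * f x"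
        unfolding wc[symmetric] by (intro tendsto_intros elim)
      then have "(\<lambda>m. ennreal (\<bar>w x * convol (k m) (cut f) x\<bar> powr s)) \<longlonglongrightarrow> ennreal (\<bar>w x * f x\<bar> powr s)"
        using s0 by (intro tendsto_ennrealI tendsto_powr' tendsto_rabs tendsto_const) auto
      then show ?case by (rule lim_imp_Liminf[OF trivial_limit_sequentially, symmetric])
    qed
  qed
  also have "\<dots> \<le> liminf (\<lambda>m. \<integral>\<^sup>+x. ennreal (\<bar>w x * convol (k m) (cut f) x\<bar> powr s) \<partial>lborel)"
    by (intro nn_integral_liminf) measurable
  also have "\<dots> \<le> liminf (\<lambda>m. ennreal (?\<Phi> (E m)))"
    by (intro Liminf_mono always_eventually allI X)
  also have "\<dots> = ennreal (?\<Phi> E0)"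
  proof -
    have L: "(\<lambda>m. E m powr (1 / p)) \<longlonglongrightarrow> E0 powr (1 / p)"
      using p E_nonneg by (intro tendsto_powr' E_lim tendsto_const) auto
    then have "(\<lambda>m. ennreal (?\<Phi> (E m))) \<longlonglongrightarrow> ennreal (?\<Phi> E0)"
      using s0 g0 by (intro tendsto_ennrealI tendsto_powr'[OF tendsto_mult[OF tendsto_const L] tendsto_const]) auto
    then show ?thesis by (rule lim_imp_Liminf[OF trivial_limit_sequentially])
  qed
  also have "\<dots> \<le> ennreal (?\<Phi> (n * D))"
    using s0 g0 p E_nonneg E0_le by (intro ennreal_leI powr_mono2 mult_left_mono) auto
  finally show ?thesis unfolding s_def g_def .
qed

subsection \<open>The distance weight and its cutoffs\<close>

text \<open>The squared distance to the subspace where the coordinates in \<open>N\<close> vanish;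
  unlike the distance it is smooth everywhere.\<close>

definition coord_sqsum :: "'n set \<Rightarrow> real^'n::finite \<Rightarrow> real" where
  "coord_sqsum N x = (\<Sum>i\<in>N. (x $ i)\<^sup>2)"

lemma coord_sqsum_nonneg: "0 \<le> coord_sqsum N x"
  by (auto simp: coord_sqsum_def intro: sum_nonneg)

lemma coord_le_sqrt_sqsum: "i \<in> N \<Longrightarrow> \<bar>x $ i\<bar> \<le> sqrt (coord_sqsum N x)"
  unfolding coord_sqsum_def
  by (subst real_sqrt_abs[symmetric], intro real_sqrt_le_mono member_le_sum) auto

lemma coord_sqsum_UNIV: "coord_sqsum UNIV x = (norm x)\<^sup>2"
  by (simp add: coord_sqsum_def norm_vec_def L2_set_def sum_nonneg)

lemma coord_sqsum_has_partials:
  "has_partials (coord_sqsum N) (\<lambda>i x. if i \<in> N then 2 * x $ i else 0)"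
  unfolding has_partials_def
proof (intro conjI allI)
  show "continuous_on UNIV (coord_sqsum N)"
    unfolding coord_sqsum_def by (intro continuous_intros)
  fix i :: 'a
  show "continuous_on UNIV (\<lambda>x::real^'a. if i \<in> N then 2 * x $ i else 0)"
    by (cases "i \<in> N") (auto intro!: continuous_intros)
  fix x :: "real^'a"
  have "((\<lambda>t. \<Sum>j\<in>N. (x $ j + t * axis i 1 $ j)\<^sup>2) has_real_derivative (\<Sum>j\<in>N. 2 * x $ j * axis i 1 $ j)) (at 0)"
    by (rule derivative_eq_intros refl | simp add: mult_ac)+
  moreover have "(\<Sum>j\<in>N. 2 * x $ j * axis i 1 $ j) = (if i \<in> N then 2 * x $ i else 0)"
    by (simp add: axis_def if_distrib sum.delta' cong: if_cong)
  ultimately show "((\<lambda>t. coord_sqsum N (x + t *\<^sub>R axis i 1)) has_vector_derivative (if i \<in> N then 2 * x $ i else 0)) (at 0)"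
    by (simp add: coord_sqsum_def has_real_derivative_iff_has_vector_derivative)
qed

lemma has_partials_compose:
  fixes h :: "real \<Rightarrow> real"
  assumes h: "\<And>t. (h has_real_derivative h' t) (at t)" "\<And>t. isCont h' t" and Q: "has_partials Q Q'"
  shows "has_partials (\<lambda>x. h (Q x)) (\<lambda>i x. h' (Q x) * Q' i x)"
  unfolding has_partials_def
proof (intro conjI allI)
  have cQ: "continuous_on UNIV Q" "\<And>i. continuous_on UNIV (Q' i)"
    using Q by (auto simp: has_partials_def)
  have "continuous_on UNIV h" "continuous_on UNIV h'"
    using DERIV_isCont[OF h(1)] h(2) by (auto intro!: continuous_at_imp_continuous_on)
  then have "continuous_on UNIV (\<lambda>x. h (Q x))" "continuous_on UNIV (\<lambda>x. h' (Q x))"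
    using cQ(1) by (auto intro: continuous_on_compose2)
  then show "continuous_on UNIV (\<lambda>x. h (Q x))" "\<And>i. continuous_on UNIV (\<lambda>x. h' (Q x) * Q' i x)"
    using cQ by (auto intro: continuous_on_mult)
  fix i x
  have "((\<lambda>t. Q (x + t *\<^sub>R axis i 1)) has_real_derivative Q' i x) (at 0)"
    using Q by (simp add: has_partials_def has_real_derivative_iff_has_vector_derivative)
  moreover have "(h has_real_derivative h' (Q x)) (at (Q (x + 0 *\<^sub>R axis i 1)))" using h by simp
  ultimately show "((\<lambda>t. h (Q (x + t *\<^sub>R axis i 1))) has_vector_derivative h' (Q x) * Q' i x) (at 0)"
    unfolding has_real_derivative_iff_has_vector_derivative[symmetric] by (rule DERIV_chain2[rotated])
qed

text \<open>With \<open>t\<close> the squared distance to the singular set, \<open>t / (1 + t)\<close> is a smooth substitute for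
  the squared weight; the first factor removes a neighbourhood of the singular set.\<close>

definition inner_cutoff :: "real \<Rightarrow> real \<Rightarrow> real \<Rightarrow> real" where
  "inner_cutoff A e t = (if 0 < t then max (1 - 1 / (A * t)) 0 powr 2 * (t / (1 + t)) powr e else 0)"

definition inner_cutoff' :: "real \<Rightarrow> real \<Rightarrow> real \<Rightarrow> real" where
  "inner_cutoff' A e t = (if 0 < t then (2 * max (1 - 1 / (A * t)) 0 * (1 / (A * t) * (1 / t))
     + max (1 - 1 / (A * t)) 0 powr 2 * (e / (t * (1 + t)))) * (t / (1 + t)) powr e else 0)"

lemma inner_cutoff_eq_0:
  assumes "0 < A" "t < 1 / A" shows "inner_cutoff A e t = 0" "inner_cutoff' A e t = 0"
proof -
  have "max (1 - 1 / (A * t)) 0 = 0" if "0 < t"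
  proof -
    have "1 \<le> 1 / (A * t)" using assms that by (simp add: field_simps)
    then show ?thesis by simp
  qed
  then show "inner_cutoff A e t = 0" "inner_cutoff' A e t = 0"
    by (auto simp: inner_cutoff_def inner_cutoff'_def)
qed

lemma inner_cutoff_has_derivative:
  assumes A: "0 < A" shows "(inner_cutoff A e has_real_derivative inner_cutoff' A e t) (at t)"
proof (cases "0 < t")
  case True
  let ?m = "max (1 - 1 / (A * t)) 0"
  have d1: "((\<lambda>t. 1 - 1 / (A * t)) has_real_derivative 1 / (A * t) * (1 / t)) (at t)"
    using True A by (auto intro!: derivative_eq_intros simp: power2_eq_square)
  have "((\<lambda>t. max (1 - 1 / (A * t)) 0 powr 2) has_real_derivative 2 * ?m powr (2 - 1) * (1 / (A * t) * (1 / t))) (at t)"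
    by (rule DERIV_chain2[OF max_powr_has_derivative d1]) simp
  then have d2: "((\<lambda>t. max (1 - 1 / (A * t)) 0 powr 2) has_real_derivative 2 * ?m * (1 / (A * t) * (1 / t))) (at t)"
    by simp
  have d3: "((\<lambda>t. t / (1 + t)) has_real_derivative 1 / (1 + t) ^ 2) (at t)"
    using True by (auto intro!: derivative_eq_intros simp: power2_eq_square)
  have pos: "0 < t / (1 + t)" using True by simp
  have "((\<lambda>t. (t / (1 + t)) powr e) has_real_derivative e * (t / (1 + t)) powr (e - 1) * (1 / (1 + t) ^ 2)) (at t)"
    by (rule DERIV_chain2[OF has_real_derivative_powr[OF pos] d3])
  moreover have "e * (t / (1 + t)) powr (e - 1) * (1 / (1 + t) ^ 2) = e / (t * (1 + t)) * (t / (1 + t)) powr e"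
    unfolding powr_diff using True by (simp add: power2_eq_square)
  ultimately have d4: "((\<lambda>t. (t / (1 + t)) powr e) has_real_derivative e / (t * (1 + t)) * (t / (1 + t)) powr e) (at t)"
    by simp
  have "((\<lambda>t. max (1 - 1 / (A * t)) 0 powr 2 * (t / (1 + t)) powr e) has_real_derivative inner_cutoff' A e t) (at t)"
    using DERIV_mult[OF d2 d4] True by (simp add: inner_cutoff'_def algebra_simps)
  moreover have "\<forall>\<^sub>F z in nhds t. max (1 - 1 / (A * z)) 0 powr 2 * (z / (1 + z)) powr e = inner_cutoff A e z"
    using True eventually_nhds_in_open[of "{0<..}" t] by (auto elim!: eventually_mono simp: inner_cutoff_def)
  ultimately show ?thesis
    by (rule DERIV_cong_ev[OF refl _ refl, THEN iffD1, rotated])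
next
  case False
  then have t: "t < 1 / A" using A by (meson divide_pos_pos le_less_trans not_less zero_less_one)
  have "((\<lambda>t. 0) has_real_derivative 0) (at t)" by simp
  moreover have "\<forall>\<^sub>F z in nhds t. 0 = inner_cutoff A e z"
    using t eventually_nhds_in_open[of "{..<1 / A}" t] by (auto elim!: eventually_mono simp: inner_cutoff_eq_0[OF A])
  ultimately have "(inner_cutoff A e has_real_derivative 0) (at t)"
    by (rule DERIV_cong_ev[OF refl _ refl, THEN iffD1, rotated])
  then show ?thesis using False by (simp add: inner_cutoff'_def)
qed

lemma inner_cutoff'_continuous:
  assumes A: "0 < A" shows "isCont (inner_cutoff' A e) t"
proof (cases "0 < t")
  case True
  let ?h = "\<lambda>t. (2 * max (1 - 1 / (A * t)) 0 * (1 / (A * t) * (1 / t))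
     + max (1 - 1 / (A * t)) 0 powr 2 * (e / (t * (1 + t)))) * (t / (1 + t)) powr e"
  have c1: "continuous_on {0<..} (\<lambda>t. max (1 - 1 / (A * t)) 0)"
    using A by (intro continuous_on_max continuous_on_diff continuous_on_divide continuous_on_const continuous_on_mult continuous_on_id) auto
  have c2: "continuous_on {0<..} (\<lambda>t::real. (t / (1 + t)) powr e)"
    by (intro continuous_on_powr continuous_on_divide continuous_on_const continuous_on_add continuous_on_id) auto
  have c3: "continuous_on {0<..} (\<lambda>t::real. 1 / (A * t) * (1 / t))" "continuous_on {0<..} (\<lambda>t::real. e / (t * (1 + t)))"
    using A by (intro continuous_on_divide continuous_on_const continuous_on_mult continuous_on_add continuous_on_id; auto)+
  have c4: "continuous_on {0<..} (\<lambda>t. max (1 - 1 / (A * t)) 0 powr 2)"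
    by (rule continuous_on_powr'[OF c1 continuous_on_const]) auto
  have "continuous_on {0<..} ?h"
    by (intro continuous_on_mult[OF continuous_on_add[OF continuous_on_mult[OF continuous_on_mult[OF continuous_on_const c1] c3(1)]
        continuous_on_mult[OF c4 c3(2)]] c2])
  then have "continuous_on {0<..} (inner_cutoff' A e)"
    by (rule continuous_on_eq) (auto simp: inner_cutoff'_def)
  then show ?thesis using True by (simp add: continuous_on_eq_continuous_at)
next
  case False
  then have t: "t < 1 / A" using A by (meson divide_pos_pos le_less_trans not_less zero_less_one)
  have "continuous_on {..<1 / A} (\<lambda>t. 0 :: real)" by simp
  then have "continuous_on {..<1 / A} (inner_cutoff' A e)"
    by (rule continuous_on_eq) (auto simp: inner_cutoff_eq_0[OF A])
  then show ?thesis using t by (simp add: continuous_on_eq_continuous_at)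
qed

text \<open>The point is independence of \<open>A\<close>. Differentiating the cutoff yields a
  factor 1/(A t) times 1/t; where the cutoff is positive, A t is at least 1, so this costs at most
  1/t, the same as differentiating the power.\<close>

lemma inner_cutoff_bounds:
  assumes A: "0 < A" and t: "0 < t"
  shows "\<bar>inner_cutoff A e t\<bar> \<le> (t / (1 + t)) powr e"
    and "\<bar>inner_cutoff' A e t\<bar> \<le> (2 + \<bar>e\<bar>) / t * (t / (1 + t)) powr e"
proof -
  let ?m = "max (1 - 1 / (A * t)) 0"
  have m: "0 \<le> ?m" "?m \<le> 1" using A t by auto
  have m2: "0 \<le> ?m powr 2" "?m powr 2 \<le> 1"
    using m powr_mono2[of 2 ?m 1] by auto
  show "\<bar>inner_cutoff A e t\<bar> \<le> (t / (1 + t)) powr e"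
    using t m2 mult_right_mono[OF m2(2), of "(t / (1 + t)) powr e"] by (simp add: inner_cutoff_def abs_mult)
  have "2 * ?m * (1 / (A * t) * (1 / t)) \<le> 2 * (1 / t)"
  proof (cases "1 \<le> A * t")
    case True
    then have "1 / (A * t) \<le> 1" by simp
    then have "?m * (1 / (A * t)) \<le> 1 * 1" using m A t by (intro mult_mono) auto
    from mult_right_mono[OF this, of "2 * (1 / t)"] show ?thesis using t by (simp add: mult_ac)
  next
    case False
    then have "?m = 0" using A t by (simp add: field_simps)
    then show ?thesis using t by simp
  qed
  moreover have "0 \<le> 2 * ?m * (1 / (A * t) * (1 / t))" using m A t by simp
  moreover have "\<bar>?m powr 2 * (e / (t * (1 + t)))\<bar> \<le> \<bar>e\<bar> / t"
  proof -
    have "\<bar>?m powr 2 * (e / (t * (1 + t)))\<bar> = ?m powr 2 * (\<bar>e\<bar> / (t * (1 + t)))"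
      using t by (simp add: abs_mult)
    also have "\<dots> \<le> 1 * (\<bar>e\<bar> / (t * 1))"
      using t m2 by (intro mult_mono divide_left_mono mult_left_mono) auto
    finally show ?thesis by simp
  qed
  ultimately have "\<bar>2 * ?m * (1 / (A * t) * (1 / t)) + ?m powr 2 * (e / (t * (1 + t)))\<bar> \<le> (2 + \<bar>e\<bar>) / t"
    by (simp only: add_divide_distrib)
  from mult_right_mono[OF this, of "(t / (1 + t)) powr e"]
  show "\<bar>inner_cutoff' A e t\<bar> \<le> (2 + \<bar>e\<bar>) / t * (t / (1 + t)) powr e"
    using t by (simp add: inner_cutoff'_def abs_mult)
qed

text \<open>This one makes the support bounded. It is evaluated at the squared norm, and squaring
  the positive part makes it continuously differentiable.\<close>

definition outer_cutoff :: "real \<Rightarrow> real \<Rightarrow> real" where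
  "outer_cutoff A t = max (1 - t / A) 0 powr 2"

definition outer_cutoff' :: "real \<Rightarrow> real \<Rightarrow> real" where
  "outer_cutoff' A t = - (2 / A) * max (1 - t / A) 0"

lemma outer_cutoff_has_derivative:
  assumes "0 < A" shows "(outer_cutoff A has_real_derivative outer_cutoff' A t) (at t)"
proof -
  have d: "((\<lambda>t. 1 - t / A) has_real_derivative - (1 / A)) (at t)"
    using assms by (auto intro!: derivative_eq_intros)
  have "(outer_cutoff A has_real_derivative 2 * max (1 - t / A) 0 powr (2 - 1) * - (1 / A)) (at t)"
    unfolding outer_cutoff_def by (rule DERIV_chain2[OF max_powr_has_derivative d]) simp
  then show ?thesis by (simp add: outer_cutoff'_def)
qed

lemma outer_cutoff'_continuous: "isCont (outer_cutoff' A) t"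
proof -
  have "continuous_on UNIV (outer_cutoff' A)"
    unfolding outer_cutoff'_def divide_inverse by (intro continuous_intros)
  then show ?thesis by (simp add: continuous_on_eq_continuous_at)
qed

definition cutoff_weight :: "'n set \<Rightarrow> real \<Rightarrow> real \<Rightarrow> real^'n::finite \<Rightarrow> real" where
  "cutoff_weight N A e x = inner_cutoff A e (coord_sqsum N x) * outer_cutoff A (coord_sqsum UNIV x)"

definition cutoff_weight' :: "'n set \<Rightarrow> real \<Rightarrow> real \<Rightarrow> 'n \<Rightarrow> real^'n::finite \<Rightarrow> real" where
  "cutoff_weight' N A e i x =
     inner_cutoff' A e (coord_sqsum N x) * (if i \<in> N then 2 * x $ i else 0) * outer_cutoff A (coord_sqsum UNIV x) +
     inner_cutoff A e (coord_sqsum N x) * (outer_cutoff' A (coord_sqsum UNIV x) * (2 * x $ i))"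

lemma cutoff_weight_has_partials:
  assumes "0 < A" shows "has_partials (cutoff_weight N A e) (cutoff_weight' N A e)"
  using has_partials_mult[OF
      has_partials_compose[OF inner_cutoff_has_derivative[OF assms] inner_cutoff'_continuous[OF assms] coord_sqsum_has_partials]
      has_partials_compose[OF outer_cutoff_has_derivative[OF assms] outer_cutoff'_continuous coord_sqsum_has_partials[of UNIV]], of e N]
  by (simp add: cutoff_weight_def[abs_def] cutoff_weight'_def[abs_def])

lemma coord_sqsum_continuous: "continuous_on UNIV (coord_sqsum N)"
  using coord_sqsum_has_partials[of N] by (simp add: has_partials_def)

lemma cutoff_weight_support:
  fixes N :: "'n::finite set"
  assumes A: "0 < A"
  defines "S \<equiv> {x. 1 / A \<le> coord_sqsum N x \<and> coord_sqsum UNIV x \<le> A}"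
  shows "compact S" and "S \<subseteq> {x. 0 < coord_sqsum N x}"
    and "\<And>x. x \<notin> S \<Longrightarrow> cutoff_weight N A e x = 0" and "\<And>i x. x \<notin> S \<Longrightarrow> cutoff_weight' N A e i x = 0"
proof -
  have "S = {x. 1 / A \<le> coord_sqsum N x} \<inter> {x. coord_sqsum UNIV x \<le> A}" by (auto simp: S_def)
  moreover have "closed {x. 1 / A \<le> coord_sqsum N x}" "closed {x::real^'n. coord_sqsum UNIV x \<le> A}"
    by (intro closed_Collect_le continuous_on_const coord_sqsum_continuous)+
  ultimately have "closed S" by auto
  moreover have "bounded S"
  proof (rule boundedI)
    fix x assume "x \<in> S"
    then have "(norm x)\<^sup>2 \<le> A" by (simp add: S_def coord_sqsum_UNIV)
    then show "norm x \<le> sqrt A" by (rule real_le_rsqrt)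
  qed
  ultimately show "compact S" by (simp add: compact_eq_bounded_closed)
  show "S \<subseteq> {x. 0 < coord_sqsum N x}"
    using A by (auto simp: S_def intro: less_le_trans[of 0 "1 / A"])
  have "(inner_cutoff A e (coord_sqsum N x) = 0 \<and> inner_cutoff' A e (coord_sqsum N x) = 0) \<or>
     (outer_cutoff A (coord_sqsum UNIV x) = 0 \<and> outer_cutoff' A (coord_sqsum UNIV x) = 0)" if "x \<notin> S" for x
  proof (cases "coord_sqsum N x < 1 / A")
    case True
    then show ?thesis using inner_cutoff_eq_0[OF A] by blast
  next
    case False
    then have "A < coord_sqsum UNIV x" using that by (simp add: S_def)
    then have "max (1 - coord_sqsum UNIV x / A) 0 = 0" using A by simp
    then show ?thesis by (simp add: outer_cutoff_def outer_cutoff'_def)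
  qed
  then show "\<And>x. x \<notin> S \<Longrightarrow> cutoff_weight N A e x = 0" "\<And>i x. x \<notin> S \<Longrightarrow> cutoff_weight' N A e i x = 0"
    by (fastforce simp: cutoff_weight_def cutoff_weight'_def)+
qed

text \<open>The inner part contributes (2 + |e|) / R times 2 sqrt R, one inverse power of the
  distance. The outer part contributes at most 4, since |x| \<le> sqrt A \<le> A on its support.
  Both are estimated by the inverse of min 1 (sqrt R), and the constants add up to 8 + 2
  |e|.\<close>

lemma cutoff_weight_bounds:
  fixes N :: "'n::finite set"
  assumes A: "1 \<le> A" and x: "0 < coord_sqsum N x"
  defines "R \<equiv> coord_sqsum N x"
  shows "\<bar>cutoff_weight N A e x\<bar> \<le> (R / (1 + R)) powr e"
    and "\<bar>cutoff_weight' N A e i x\<bar> \<le> (8 + 2 * \<bar>e\<bar>) / min 1 (sqrt R) * (R / (1 + R)) powr e"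
proof -
  have A0: "0 < A" and R: "0 < R" using A x by (auto simp: R_def)
  let ?q = "coord_sqsum UNIV x" and ?W = "(R / (1 + R)) powr e"
  have q: "0 \<le> ?q" by (rule coord_sqsum_nonneg)
  let ?m = "max (1 - ?q / A) 0"
  have m: "0 \<le> ?m" "?m \<le> 1" using A0 q by auto
  have o: "0 \<le> outer_cutoff A ?q" "outer_cutoff A ?q \<le> 1"
    using m powr_mono2[of 2 ?m 1] by (auto simp: outer_cutoff_def)
  note ic = inner_cutoff_bounds[OF A0 R, of e]
  show "\<bar>cutoff_weight N A e x\<bar> \<le> ?W"
    using mult_mono[OF ic(1) o(2)] o by (simp add: cutoff_weight_def abs_mult R_def)
  have xi: "\<bar>if i \<in> N then 2 * x $ i else 0\<bar> \<le> 2 * sqrt R"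
    using coord_le_sqrt_sqsum[of i N x] R by (auto simp: R_def abs_mult coord_sqsum_nonneg)
  have t1: "\<bar>inner_cutoff' A e R * (if i \<in> N then 2 * x $ i else 0) * outer_cutoff A ?q\<bar> \<le> ((2 + \<bar>e\<bar>) / R * ?W) * (2 * sqrt R) * 1"
    unfolding abs_mult using xi ic(2) o R by (intro mult_mono) auto
  have t2: "\<bar>outer_cutoff' A ?q * (2 * x $ i)\<bar> \<le> 4"
  proof (cases "?q \<le> A")
    case True
    have "\<bar>x $ i\<bar> \<le> sqrt ?q" by (rule coord_le_sqrt_sqsum) simp
    also have "\<dots> \<le> sqrt A" using True by simp
    also have "\<dots> \<le> A" using A real_sqrt_le_mono[of A "A * A"] by (simp add: real_sqrt_mult)
    finally have "\<bar>x $ i\<bar> / A \<le> 1" using A0 by simp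
    then have "?m * (\<bar>x $ i\<bar> / A) \<le> 1 * 1" using m A0 by (intro mult_mono) auto
    then show ?thesis using A0 m by (simp add: outer_cutoff'_def abs_mult divide_le_eq)
  next
    case False
    then have "?m = 0" using A0 by simp
    then show ?thesis by (simp add: outer_cutoff'_def)
  qed
  have t3: "\<bar>inner_cutoff A e R * (outer_cutoff' A ?q * (2 * x $ i))\<bar> \<le> ?W * 4"
    unfolding abs_mult[of "inner_cutoff A e R"] using ic(1) t2 by (intro mult_mono) auto
  have "\<bar>cutoff_weight' N A e i x\<bar> \<le> ((2 + \<bar>e\<bar>) / R * ?W) * (2 * sqrt R) * 1 + ?W * 4"
    unfolding cutoff_weight'_def R_def[symmetric] using t1 t3 by (intro order_trans[OF abs_triangle_ineq] add_mono)
  also have "\<dots> = ((4 + 2 * \<bar>e\<bar>) * (1 / sqrt R) + 4 * 1) * ?W"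
  proof -
    have "1 / R * sqrt R = 1 / sqrt R" using R by (simp add: real_div_sqrt field_simps)
    then have "(2 + \<bar>e\<bar>) * 2 * (1 / R * sqrt R) = (4 + 2 * \<bar>e\<bar>) * (1 / sqrt R)" by simp
    then have *: "(2 + \<bar>e\<bar>) / R * (2 * sqrt R) = (4 + 2 * \<bar>e\<bar>) * (1 / sqrt R)" by (simp add: mult_ac)
    have "((2 + \<bar>e\<bar>) / R * ?W) * (2 * sqrt R) * 1 + ?W * 4 = ((2 + \<bar>e\<bar>) / R * (2 * sqrt R) + 4 * 1) * ?W"
      by (simp add: algebra_simps)
    then show ?thesis unfolding * .
  qed
  also have "\<dots> \<le> ((4 + 2 * \<bar>e\<bar>) * (1 / min 1 (sqrt R)) + 4 * (1 / min 1 (sqrt R))) * ?W"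
    using R by (intro mult_right_mono add_mono mult_left_mono divide_left_mono) (auto simp: min_def)
  also have "\<dots> = (8 + 2 * \<bar>e\<bar>) / min 1 (sqrt R) * ?W"
    by (simp add: add_divide_distrib distrib_right)
  finally show "\<bar>cutoff_weight' N A e i x\<bar> \<le> (8 + 2 * \<bar>e\<bar>) / min 1 (sqrt R) * ?W" .
qed

lemma cutoff_weight_tendsto:
  assumes "0 < coord_sqsum N x"
  defines "R \<equiv> coord_sqsum N x"
  shows "(\<lambda>m. cutoff_weight N (real (Suc m)) e x) \<longlonglongrightarrow> (R / (1 + R)) powr e"
proof -
  have R: "0 < R" using assms by (simp add: R_def)
  have n: "(\<lambda>m. 1 / real (Suc m)) \<longlonglongrightarrow> 0" using LIMSEQ_Suc[OF lim_1_over_n] by simp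
  have "(\<lambda>m. max (1 - 1 / real (Suc m) * (1 / R)) 0 powr 2 * (R / (1 + R)) powr e * (max (1 - 1 / real (Suc m) * coord_sqsum UNIV x) 0 powr 2))
      \<longlonglongrightarrow> max (1 - 0 * (1 / R)) 0 powr 2 * (R / (1 + R)) powr e * (max (1 - 0 * coord_sqsum UNIV x) 0 powr 2)"
    by (intro tendsto_mult tendsto_powr' tendsto_max tendsto_diff tendsto_const n) auto
  moreover have "cutoff_weight N (real (Suc m)) e x =
     max (1 - 1 / real (Suc m) * (1 / R)) 0 powr 2 * (R / (1 + R)) powr e * (max (1 - 1 / real (Suc m) * coord_sqsum UNIV x) 0 powr 2)" for m
    using R unfolding cutoff_weight_def inner_cutoff_def outer_cutoff_def R_def[symmetric] by simp
  ultimately show ?thesis by simp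
qed

subsection \<open>The weighted Sobolev inequality\<close>

lemma rho_eq: "rho l x = min 1 (sqrt (coord_sqsum (normal_coords l) x))"
  by (simp add: rho_def coord_sqsum_def)

lemma singular_set_compl:
  "(- singular_set l :: (real^'n::{finite,linorder}) set) = {x. 0 < coord_sqsum (normal_coords l) x}"
proof -
  have "x \<in> singular_set l \<longleftrightarrow> coord_sqsum (normal_coords l) x = 0" for x :: "(real, 'n) vec"
    unfolding singular_set_def coord_sqsum_def by (subst sum_nonneg_eq_0_iff) auto
  then show ?thesis using coord_sqsum_nonneg by (auto simp: less_le)
qed

lemma open_singular_compl: "open (- singular_set l)"
  unfolding singular_set_compl by (intro open_Collect_less continuous_on_const coord_sqsum_continuous)

lemma rho_continuous: "continuous_on UNIV (rho l)"
  unfolding rho_eq by (intro continuous_on_min continuous_on_const continuous_on_real_sqrt coord_sqsum_continuous)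

lemma rho_measurable [measurable]: "rho l \<in> borel_measurable borel"
  by (intro borel_measurable_continuous_onI rho_continuous)

lemma singular_compl_measurable [measurable]: "- singular_set l \<in> sets borel"
  by (rule borel_open[OF open_singular_compl])

lemma rho_pos: "x \<in> - singular_set l \<Longrightarrow> 0 < rho l x"
  by (simp add: singular_set_compl rho_eq)

section \<open>Comparing the weight with its smooth substitute\<close>

lemma powr_le_comparable:
  fixes a b e :: real
  assumes "0 < a" "a \<le> b" "b \<le> 2 * a"
  shows "a powr e \<le> 2 powr \<bar>e\<bar> * b powr e" "b powr e \<le> 2 powr \<bar>e\<bar> * a powr e"
proof -
  have b: "0 < b" using assms by simp
  have one: "1 \<le> (2::real) powr \<bar>e\<bar>" by (simp add: ge_one_powr_ge_zero)
  show "a powr e \<le> 2 powr \<bar>e\<bar> * b powr e"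
  proof (cases "0 \<le> e")
    case True
    have "a powr e \<le> 1 * b powr e" using assms True by (simp add: powr_mono2)
    also have "\<dots> \<le> 2 powr \<bar>e\<bar> * b powr e" by (intro mult_right_mono one) auto
    finally show ?thesis .
  next
    case False
    have "2 powr e * a powr e = (2 * a) powr e" using assms by (simp add: powr_mult)
    also have "\<dots> \<le> b powr e" using assms False b by (intro powr_mono2') auto
    finally have "2 powr (- e) * (2 powr e * a powr e) \<le> 2 powr (- e) * b powr e"
      by (intro mult_left_mono) auto
    then show ?thesis using False by (simp add: powr_minus field_simps)
  qed
  show "b powr e \<le> 2 powr \<bar>e\<bar> * a powr e"
  proof (cases "0 \<le> e")
    case True
    have "b powr e \<le> (2 * a) powr e" using assms True b by (intro powr_mono2) auto
    then show ?thesis using True by (simp add: powr_mult)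
  next
    case False
    have "b powr e \<le> 1 * a powr e" using assms False by (simp add: powr_mono2')
    also have "\<dots> \<le> 2 powr \<bar>e\<bar> * a powr e" by (intro mult_right_mono one) auto
    finally show ?thesis .
  qed
qed

text \<open>\<open>rho\<close> is the square root of min 1 R, and this minimum lies between R / (1 +
  R) and twice that quotient; the square root turns \<open>s\<close> into s / 2.\<close>

lemma rho_powr_comparable:
  assumes x: "x \<in> - singular_set l"
  defines "R \<equiv> coord_sqsum (normal_coords l) x"
  shows "rho l x powr s \<le> 2 powr \<bar>s / 2\<bar> * (R / (1 + R)) powr (s / 2)"
    and "(R / (1 + R)) powr (s / 2) \<le> 2 powr \<bar>s / 2\<bar> * rho l x powr s"
proof -
  have R: "0 < R" using x by (simp add: R_def singular_set_compl)
  have "rho l x = sqrt (min 1 R)" using R by (auto simp: rho_eq R_def min_def)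
  then have eq: "rho l x powr s = min 1 R powr (s / 2)"
    using R by (simp add: powr_half_sqrt[symmetric] powr_powr)
  have "R / (1 + R) \<le> min 1 R" "min 1 R \<le> 2 * (R / (1 + R))" "0 < R / (1 + R)"
    using R by (auto simp: min_def field_simps)
  from powr_le_comparable[OF this(3,1,2), of "s / 2"]
  show "rho l x powr s \<le> 2 powr \<bar>s / 2\<bar> * (R / (1 + R)) powr (s / 2)"
    and "(R / (1 + R)) powr (s / 2) \<le> 2 powr \<bar>s / 2\<bar> * rho l x powr s"
    unfolding eq by auto
qed

text \<open>On a compact set away from the singular set the continuous weight has a positive lower
  bound, so it can be divided out.\<close>

lemma loc_int_powr_weighted:
  fixes f :: "real^'n::{finite,linorder} \<Rightarrow> 'a::{banach, second_countable_topology}"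
  assumes [measurable]: "f \<in> borel_measurable borel" and q: "0 \<le> q"
    and fin: "(\<integral>\<^sup>+x. indicator (- singular_set l) x * ennreal ((rho l x powr e * norm (f x)) powr q) \<partial>lborel) < \<infinity>"
  shows "loc_int (- singular_set l) (\<lambda>x. norm (f x) powr q)"
  unfolding loc_int_def
proof (intro conjI allI impI, measurable, elim conjE)
  fix K :: "(real, 'n) vec set" assume K: "compact K" "K \<subseteq> - singular_set l"
  have [measurable]: "K \<in> sets borel" using K by (simp add: borel_compact)
  obtain b where b: "0 < b" "\<And>x. x \<in> K \<Longrightarrow> b \<le> rho l x powr e"
  proof (cases "K = {}")
    case True
    then show ?thesis using that[of 1] by simp
  next
    case False
    have "continuous_on K (\<lambda>x. rho l x powr e)"
      using K(2) rho_pos by (intro continuous_on_powr continuous_on_const continuous_on_subset[OF rho_continuous]) force+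
    then obtain y where "y \<in> K" "\<And>x. x \<in> K \<Longrightarrow> rho l y powr e \<le> rho l x powr e"
      using continuous_attains_inf[OF K(1) False] by blast
    moreover have "0 < rho l y powr e" using rho_pos[of y l] K(2) \<open>y \<in> K\<close> by auto
    ultimately show ?thesis using that by blast
  qed
  have "(\<integral>\<^sup>+x. ennreal (norm (indicator K x *\<^sub>R norm (f x) powr q)) \<partial>lborel) \<le>
    (\<integral>\<^sup>+x. ennreal (1 / b powr q) * (indicator (- singular_set l) x * ennreal ((rho l x powr e * norm (f x)) powr q)) \<partial>lborel)"
  proof (intro nn_integral_mono)
    fix x
    show "ennreal (norm (indicator K x *\<^sub>R norm (f x) powr q)) \<le>
      ennreal (1 / b powr q) * (indicator (- singular_set l) x * ennreal ((rho l x powr e * norm (f x)) powr q))"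
    proof (cases "x \<in> K")
      case True
      have "b powr q * norm (f x) powr q = (b * norm (f x)) powr q" using b by (simp add: powr_mult)
      also have "\<dots> \<le> (rho l x powr e * norm (f x)) powr q"
        using b True q by (intro powr_mono2 mult_right_mono) auto
      finally have "norm (f x) powr q \<le> 1 / b powr q * (rho l x powr e * norm (f x)) powr q"
        using b by (simp add: field_simps)
      then show ?thesis using True K(2) by (auto simp: ennreal_mult[symmetric] intro!: ennreal_leI)
    qed simp
  qed
  also have "\<dots> = ennreal (1 / b powr q) * (\<integral>\<^sup>+x. indicator (- singular_set l) x * ennreal ((rho l x powr e * norm (f x)) powr q) \<partial>lborel)"
    by (rule nn_integral_cmult) measurable
  also have "\<dots> < \<infinity>" using fin by (simp add: ennreal_mult_less_top)
  finally show "integrable lborel (\<lambda>x. indicator K x *\<^sub>R norm (f x) powr q)"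
    by (intro integrableI_bounded) measurable
qed

text \<open>The cut-off weights and their gradients are bounded by \<open>rho powr s\<close> and
  \<open>rho powr (s - 1)\<close> uniformly in the cutoff, so \<open>sobolev_compact_weight\<close>
  gives one bound for all of them and Fatou's lemma removes the cutoff. \<open>E\<close> bounds p-th
  powers, hence its exponent n / (n - p).\<close>

lemma weighted_sobolev:
  fixes p s :: real and l :: nat
  defines "n \<equiv> real CARD('n::{finite,linorder})"
  assumes p: "1 < p" "p < n"
  shows "\<exists>c\<ge>0. \<forall>(f :: (real, 'n) vec \<Rightarrow> real) f' E. (\<forall>i. weak_partial (- singular_set l) i f (f' i)) \<longrightarrow> 0 \<le> E \<longrightarrow>
    (\<integral>\<^sup>+x. indicator (- singular_set l) x * ennreal ((rho l x powr (s - 1) * \<bar>f x\<bar>) powr p) \<partial>lborel) \<le> ennreal E \<longrightarrow>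
    (\<forall>i. (\<integral>\<^sup>+x. indicator (- singular_set l) x * ennreal ((rho l x powr s * \<bar>f' i x\<bar>) powr p) \<partial>lborel) \<le> ennreal E) \<longrightarrow>
    (\<integral>\<^sup>+x. indicator (- singular_set l) x * ennreal ((rho l x powr s * \<bar>f x\<bar>) powr (n * p / (n - p))) \<partial>lborel)
      \<le> ennreal (c * E powr (n / (n - p)))"
proof -
  let ?\<Omega> = "- singular_set l :: (real, 'n) vec set" and ?N = "normal_coords l :: 'n set"
  define ps where "ps = n * p / (n - p)"
  define g where "g = p * (n - 1) / (n - p)"
  \<comment> \<open>\<open>C\<close> compares \<open>rho powr s\<close> with its substitute,
    \<open>C'\<close> bounds the gradient of the weight, where 8 + 2 |s/2| = 8 + |s|, and
    \<open>M\<close> joins the two by |a + b|^p \<le> 2^p (|a|^p + |b|^p).\<close>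
  define C where "C = 2 powr \<bar>s / 2\<bar>"
  define C' where "C' = (8 + \<bar>s\<bar>) * C"
  define M where "M = 2 powr p * (C' powr p + C powr p)"
  define c0 where "c0 = (g * (n * M) powr (1 / p)) powr ps"
  have ps0: "0 < ps" and g0: "0 < g" and C0: "0 < C" and C'0: "0 \<le> C'"
    using p by (auto simp: ps_def g_def C_def C'_def)
  have M0: "0 \<le> M" by (simp add: M_def)
  have main: "(\<integral>\<^sup>+x. indicator ?\<Omega> x * ennreal ((rho l x powr s * \<bar>f x\<bar>) powr ps) \<partial>lborel) \<le> ennreal (C powr ps * c0 * E powr (n / (n - p)))"
    if f: "\<And>i. weak_partial ?\<Omega> i f (f' i)" and E: "0 \<le> E"
      and E1: "(\<integral>\<^sup>+x. indicator ?\<Omega> x * ennreal ((rho l x powr (s - 1) * \<bar>f x\<bar>) powr p) \<partial>lborel) \<le> ennreal E"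
      and E2: "\<And>i. (\<integral>\<^sup>+x. indicator ?\<Omega> x * ennreal ((rho l x powr s * \<bar>f' i x\<bar>) powr p) \<partial>lborel) \<le> ennreal E"
    for f :: "(real, 'n) vec \<Rightarrow> real" and f' E
  proof -
    have [measurable]: "f \<in> borel_measurable borel" "\<And>i. f' i \<in> borel_measurable borel"
      using weak_partialD(1,2)[OF f] loc_intD(1) by blast+
    have lf: "loc_int ?\<Omega> (\<lambda>x. norm (f x) powr p)"
      by (rule loc_int_powr_weighted[where e = "s - 1"]) (use p le_less_trans[OF E1 ennreal_less_top] in auto)
    have lf': "loc_int ?\<Omega> (\<lambda>x. norm (f' i x) powr p)" for i
      by (rule loc_int_powr_weighted[where e = s]) (use p le_less_trans[OF E2[of i] ennreal_less_top] in auto)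
    let ?w = "\<lambda>m. cutoff_weight ?N (real (Suc m)) (s / 2)" and ?w' = "\<lambda>m. cutoff_weight' ?N (real (Suc m)) (s / 2)"
    let ?S = "\<lambda>m. {x. 1 / real (Suc m) \<le> coord_sqsum ?N x \<and> coord_sqsum UNIV x \<le> real (Suc m)}"
    let ?W = "\<lambda>x. (coord_sqsum ?N x / (1 + coord_sqsum ?N x)) powr (s / 2)"
    have [measurable]: "coord_sqsum ?N \<in> borel_measurable borel"
      by (intro borel_measurable_continuous_onI coord_sqsum_continuous)
    have S: "compact (?S m)" "?S m \<subseteq> ?\<Omega>" "\<And>x. x \<notin> ?S m \<Longrightarrow> ?w m x = 0" "\<And>i x. x \<notin> ?S m \<Longrightarrow> ?w' m i x = 0" for m
      using cutoff_weight_support(1,2)[where A = "real (Suc m)" and N = ?N]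
        cutoff_weight_support(3,4)[where A = "real (Suc m)" and N = ?N and e = "s / 2"] unfolding singular_set_compl by auto
    have hp: "has_partials (?w m) (?w' m)" for m
      by (rule cutoff_weight_has_partials) simp
    then have [measurable]: "?w m \<in> borel_measurable borel" "?w' m i \<in> borel_measurable borel" for m i
      by (auto simp: has_partials_def intro: borel_measurable_continuous_onI)
    have bw: "\<bar>?w m x\<bar> \<le> C * rho l x powr s" and bw': "\<bar>?w' m i x\<bar> \<le> C' * rho l x powr (s - 1)" if x: "x \<in> ?\<Omega>" for m i x
    proof -
      have R: "0 < coord_sqsum ?N x" using x by (simp add: singular_set_compl)
      note b = cutoff_weight_bounds[OF _ R, of "real (Suc m)" "s / 2"]
      note r = rho_powr_comparable(2)[OF x, of s, folded C_def]
      show "\<bar>?w m x\<bar> \<le> C * rho l x powr s" using b(1) r by simp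
      have "\<bar>?w' m i x\<bar> \<le> (8 + 2 * \<bar>s / 2\<bar>) / rho l x * ?W x"
        using b(2)[of i] by (simp add: rho_eq)
      also have "\<dots> \<le> (8 + 2 * \<bar>s / 2\<bar>) / rho l x * (C * rho l x powr s)"
        using rho_pos[OF x] by (intro mult_left_mono r) auto
      also have "\<dots> = C' * rho l x powr (s - 1)"
        using rho_pos[OF x] by (simp add: C'_def powr_diff)
      finally show "\<bar>?w' m i x\<bar> \<le> C' * rho l x powr (s - 1)" .
    qed
    have D: "(\<integral>\<^sup>+x. ennreal (\<bar>?w' m i x * f x + ?w m x * f' i x\<bar> powr p) \<partial>lborel) \<le> ennreal (M * E)" for m i
    proof -
      have "(\<integral>\<^sup>+x. ennreal (\<bar>?w' m i x * f x + ?w m x * f' i x\<bar> powr p) \<partial>lborel) \<le>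
        (\<integral>\<^sup>+x. ennreal (2 powr p * C' powr p) * (indicator ?\<Omega> x * ennreal ((rho l x powr (s - 1) * \<bar>f x\<bar>) powr p)) +
           ennreal (2 powr p * C powr p) * (indicator ?\<Omega> x * ennreal ((rho l x powr s * \<bar>f' i x\<bar>) powr p)) \<partial>lborel)"
      proof (intro nn_integral_mono)
        fix x
        show "ennreal (\<bar>?w' m i x * f x + ?w m x * f' i x\<bar> powr p) \<le>
          ennreal (2 powr p * C' powr p) * (indicator ?\<Omega> x * ennreal ((rho l x powr (s - 1) * \<bar>f x\<bar>) powr p)) +
           ennreal (2 powr p * C powr p) * (indicator ?\<Omega> x * ennreal ((rho l x powr s * \<bar>f' i x\<bar>) powr p))"
        proof (cases "x \<in> ?\<Omega>")
          case True
          have "\<bar>?w' m i x * f x + ?w m x * f' i x\<bar> powr p \<le> 2 powr p * (\<bar>?w' m i x * f x\<bar> powr p + \<bar>?w m x * f' i x\<bar> powr p)"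
            using p by (intro abs_add_powr_le) auto
          also have "\<dots> \<le> 2 powr p * ((C' * rho l x powr (s - 1) * \<bar>f x\<bar>) powr p + (C * rho l x powr s * \<bar>f' i x\<bar>) powr p)"
            unfolding abs_mult using p bw[OF True] bw'[OF True]
            by (intro mult_left_mono add_mono powr_mono2 mult_right_mono) auto
          also have "\<dots> = 2 powr p * C' powr p * (rho l x powr (s - 1) * \<bar>f x\<bar>) powr p + 2 powr p * C powr p * (rho l x powr s * \<bar>f' i x\<bar>) powr p"
            using C0 C'0 by (simp add: powr_mult distrib_left mult.assoc)
          finally show ?thesis
            using True by (simp add: ennreal_mult[symmetric] ennreal_plus[symmetric] ennreal_leI del: ennreal_plus)
        next
          case False
          then have "x \<notin> ?S m" using S(2) by blast
          then show ?thesis using S(3,4)[of x m] by simp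
        qed
      qed
      also have "\<dots> = ennreal (2 powr p * C' powr p) * (\<integral>\<^sup>+x. indicator ?\<Omega> x * ennreal ((rho l x powr (s - 1) * \<bar>f x\<bar>) powr p) \<partial>lborel) +
           ennreal (2 powr p * C powr p) * (\<integral>\<^sup>+x. indicator ?\<Omega> x * ennreal ((rho l x powr s * \<bar>f' i x\<bar>) powr p) \<partial>lborel)"
        by (subst nn_integral_add, measurable, subst nn_integral_cmult, measurable, subst nn_integral_cmult, measurable)
      also have "\<dots> \<le> ennreal (2 powr p * C' powr p) * ennreal E + ennreal (2 powr p * C powr p) * ennreal E"
        by (intro add_mono mult_left_mono E1 E2) auto
      also have "\<dots> = ennreal (M * E)"
        using E by (simp add: M_def ennreal_mult[symmetric] ennreal_plus[symmetric] algebra_simps del: ennreal_plus)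
      finally show ?thesis .
    qed
    have X: "(\<integral>\<^sup>+x. ennreal (\<bar>?w m x * f x\<bar> powr ps) \<partial>lborel) \<le> ennreal (c0 * E powr (n / (n - p)))" for m
    proof -
      have S3: "\<And>x. x \<notin> ?S m \<Longrightarrow> ?w m x = 0" and S4: "\<And>i x. x \<notin> ?S m \<Longrightarrow> ?w' m i x = 0"
        by (fact S(3), fact S(4))
      have "(\<integral>\<^sup>+x. ennreal (\<bar>?w m x * f x\<bar> powr ps) \<partial>lborel) \<le> ennreal ((g * (n * (M * E)) powr (1 / p)) powr ps)"
        unfolding ps_def g_def n_def
        by (rule sobolev_compact_weight[OF p(1) p(2)[unfolded n_def] open_singular_compl f lf lf' hp S(1,2)[of m] S3 S4 D]) (assumption | rule mult_nonneg_nonneg[OF M0 E])+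
      also have "(g * (n * (M * E)) powr (1 / p)) powr ps = c0 * E powr (n / (n - p))"
      proof -
        have "(n * (M * E)) powr (1 / p) = (n * M) powr (1 / p) * E powr (1 / p)"
          using M0 E by (simp add: powr_mult mult.assoc[symmetric] n_def)
        then have "(g * (n * (M * E)) powr (1 / p)) powr ps = ((g * (n * M) powr (1 / p)) * E powr (1 / p)) powr ps"
          by (simp add: mult.assoc)
        also have "\<dots> = c0 * (E powr (1 / p)) powr ps"
          using g0 by (simp add: powr_mult c0_def)
        also have "(E powr (1 / p)) powr ps = E powr (n / (n - p))"
          using p by (simp add: powr_powr ps_def)
        finally show ?thesis .
      qed
      finally show ?thesis .
    qed
    have fatou: "(\<integral>\<^sup>+x. liminf (\<lambda>m. ennreal (\<bar>W m x * f x\<bar> powr ps)) \<partial>lborel) \<le>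
        liminf (\<lambda>m. \<integral>\<^sup>+x. ennreal (\<bar>W m x * f x\<bar> powr ps) \<partial>lborel)"
      if [measurable]: "\<And>m. W m \<in> borel_measurable borel" for W :: "nat \<Rightarrow> (real, 'n) vec \<Rightarrow> real"
      by (intro nn_integral_liminf) measurable
    have "(\<integral>\<^sup>+x. indicator ?\<Omega> x * ennreal ((rho l x powr s * \<bar>f x\<bar>) powr ps) \<partial>lborel) \<le>
       (\<integral>\<^sup>+x. ennreal (C powr ps) * liminf (\<lambda>m. ennreal (\<bar>?w m x * f x\<bar> powr ps)) \<partial>lborel)"
    proof (intro nn_integral_mono)
      fix x
      show "indicator ?\<Omega> x * ennreal ((rho l x powr s * \<bar>f x\<bar>) powr ps) \<le> ennreal (C powr ps) * liminf (\<lambda>m. ennreal (\<bar>?w m x * f x\<bar> powr ps))"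
      proof (cases "x \<in> ?\<Omega>")
        case True
        then have R: "0 < coord_sqsum ?N x" by (simp add: singular_set_compl)
        have "(\<lambda>m. ennreal (\<bar>?w m x * f x\<bar> powr ps)) \<longlonglongrightarrow> ennreal (\<bar>?W x * f x\<bar> powr ps)"
          using ps0 by (intro tendsto_ennrealI tendsto_powr'[OF tendsto_rabs[OF tendsto_mult[OF cutoff_weight_tendsto[OF R] tendsto_const]] tendsto_const]) auto
        then have l: "liminf (\<lambda>m. ennreal (\<bar>?w m x * f x\<bar> powr ps)) = ennreal (\<bar>?W x * f x\<bar> powr ps)"
          by (rule lim_imp_Liminf[OF trivial_limit_sequentially])
        have "(rho l x powr s * \<bar>f x\<bar>) powr ps \<le> (C * ?W x * \<bar>f x\<bar>) powr ps"
          using ps0 rho_powr_comparable(1)[OF True, of s, folded C_def] by (intro powr_mono2 mult_right_mono) auto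
        also have "\<dots> = C powr ps * \<bar>?W x * f x\<bar> powr ps"
          using C0 by (simp add: powr_mult abs_mult)
        finally show ?thesis
          unfolding l using True by (simp add: ennreal_mult[symmetric] ennreal_leI)
      qed simp
    qed
    also have "\<dots> = ennreal (C powr ps) * (\<integral>\<^sup>+x. liminf (\<lambda>m. ennreal (\<bar>?w m x * f x\<bar> powr ps)) \<partial>lborel)"
      by (rule nn_integral_cmult) measurable
    also have "\<dots> \<le> ennreal (C powr ps) * liminf (\<lambda>m. \<integral>\<^sup>+x. ennreal (\<bar>?w m x * f x\<bar> powr ps) \<partial>lborel)"
      by (intro mult_left_mono fatou) (fact, simp)
    also have "\<dots> \<le> ennreal (C powr ps) * liminf (\<lambda>m::nat. ennreal (c0 * E powr (n / (n - p))))"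
      by (intro mult_left_mono Liminf_mono always_eventually allI X) auto
    also have "\<dots> = ennreal (C powr ps * c0 * E powr (n / (n - p)))"
      by (simp add: Liminf_const ennreal_mult[symmetric] c0_def mult.assoc)
    finally show ?thesis .
  qed
  have "0 \<le> C powr ps * c0" by (simp add: c0_def)
  then show ?thesis using main unfolding ps_def by blast
qed

subsection \<open>Iterating the weighted Sobolev inequality\<close>

text \<open>The q-th power of a weighted norm, in \<open>ennreal\<close>, so that it makes sense
  before any integrability is known.\<close>

definition wnorm :: "nat \<Rightarrow> real \<Rightarrow> real \<Rightarrow> (real^'n::{finite,linorder} \<Rightarrow> 'a::real_normed_vector) \<Rightarrow> ennreal" where
  "wnorm l q e f = (\<integral>\<^sup>+x. indicator (- singular_set l) x * ennreal ((rho l x powr e * norm (f x)) powr q) \<partial>lborel)"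

lemma wnorm_mono:
  assumes "0 \<le> q" "\<And>x. norm (f x) \<le> norm (g x)" shows "wnorm l q e f \<le> wnorm l q e g"
  unfolding wnorm_def using assms
  by (intro nn_integral_mono mult_left_mono ennreal_leI powr_mono2) auto

lemma sum_powr_le:
  fixes x :: "'i \<Rightarrow> real"
  assumes "finite S" "\<And>i. i \<in> S \<Longrightarrow> 0 \<le> x i" "0 \<le> q"
  shows "(\<Sum>i\<in>S. x i) powr q \<le> real (card S) powr q * (\<Sum>i\<in>S. x i powr q)"
proof (cases "S = {}")
  case False
  define y where "y = Max (x ` S)"
  have y: "x i \<le> y" if "i \<in> S" for i using that assms(1) by (simp add: y_def)
  have "y \<in> x ` S" unfolding y_def using assms(1) False by (intro Max_in) auto
  then obtain j where j: "j \<in> S" "y = x j" by blast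
  have "(\<Sum>i\<in>S. x i) powr q \<le> (real (card S) * y) powr q"
    using assms y sum_mono[of S x "\<lambda>_. y"] by (intro powr_mono2 sum_nonneg) auto
  also have "\<dots> = real (card S) powr q * x j powr q" using assms(2) j by (simp add: powr_mult)
  also have "\<dots> \<le> real (card S) powr q * (\<Sum>i\<in>S. x i powr q)"
    using assms j by (intro mult_left_mono member_le_sum) auto
  finally show ?thesis .
qed simp

lemma integrable_test_function_scaleR:
  fixes h :: "real^'n::finite \<Rightarrow> 'a::{banach, second_countable_topology}"
  assumes h: "loc_int \<Omega> h" and \<psi>: "\<psi> \<in> test_functions \<Omega>"
  shows "integrable lborel (\<lambda>x. \<psi> x *\<^sub>R h x)"
proof -
  let ?S = "closure {x. \<psi> x \<noteq> 0}"
  note t = test_functionD[OF \<psi>]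
  have c: "continuous_on UNIV \<psi>" using t(2) by (simp add: has_partials_def)
  obtain R where "\<And>x. x \<in> ?S \<Longrightarrow> norm x \<le> R"
    using compact_imp_bounded[OF t(3)] unfolding bounded_iff by blast
  then have "\<psi> x = 0" if "R < norm x" for x using t(5)[of x] that by force
  then obtain B where B: "\<And>x. \<bar>\<psi> x\<bar> \<le> B" using compact_support_bounded[OF c] by blast
  have "integrable lborel (\<lambda>x. \<psi> x *\<^sub>R (indicator ?S x *\<^sub>R h x))"
    by (rule integrable_bounded_scaleR[OF loc_intD(2)[OF h t(3,4)] _ B])
      (simp add: borel_measurable_continuous_onI[OF c])
  also have "(\<lambda>x. \<psi> x *\<^sub>R (indicator ?S x *\<^sub>R h x)) = (\<lambda>x. \<psi> x *\<^sub>R h x)"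
  proof
    fix x show "\<psi> x *\<^sub>R (indicator ?S x *\<^sub>R h x) = \<psi> x *\<^sub>R h x"
    proof (cases "x \<in> ?S")
      case True
      then show ?thesis by (simp only: indicator_simps scaleR_one)
    next
      case False
      show ?thesis by (simp only: t(5)[OF False] scaleR_zero_left)
    qed
  qed
  finally show ?thesis .
qed

lemma weak_partial_inner:
  fixes f g :: "real^'n::finite \<Rightarrow> 'a::euclidean_space"
  assumes "weak_partial \<Omega> i f g"
  shows "weak_partial \<Omega> i (\<lambda>x. f x \<bullet> b) (\<lambda>x. g x \<bullet> b)"
proof -
  note w = weak_partialD[OF assms]
  have l: "loc_int \<Omega> (\<lambda>x. h x \<bullet> b)" if h: "loc_int \<Omega> h" for h :: "real^'n \<Rightarrow> 'a"
    unfolding loc_int_def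
  proof (intro conjI allI impI)
    show "(\<lambda>x. h x \<bullet> b) \<in> borel_measurable borel" using loc_intD(1)[OF h] by simp
    fix K assume "compact K \<and> K \<subseteq> \<Omega>"
    then have "integrable lborel (\<lambda>x. (indicator K x *\<^sub>R h x) \<bullet> b)"
      by (intro integrable_inner_left loc_intD(2)[OF h]) auto
    then show "integrable lborel (\<lambda>x. indicator K x *\<^sub>R (h x \<bullet> b))" by simp
  qed
  show ?thesis
    unfolding weak_partial_def
  proof (intro conjI ballI l w)
    fix \<phi> assume \<phi>: "\<phi> \<in> test_functions \<Omega>"
    have "(\<integral>x. partial_deriv i \<phi> x *\<^sub>R (f x \<bullet> b) \<partial>lborel) = (\<integral>x. (partial_deriv i \<phi> x *\<^sub>R f x) \<bullet> b \<partial>lborel)"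
      by simp
    also have "\<dots> = (\<integral>x. partial_deriv i \<phi> x *\<^sub>R f x \<partial>lborel) \<bullet> b"
      using integrable_test_function_scaleR[OF w(1) test_function_partial_deriv(1)[OF \<phi>]] by (intro integral_inner_left) simp
    also have "\<dots> = - ((\<integral>x. \<phi> x *\<^sub>R g x \<partial>lborel) \<bullet> b)"
      using w(3)[OF \<phi>] by simp
    also have "(\<integral>x. \<phi> x *\<^sub>R g x \<partial>lborel) \<bullet> b = (\<integral>x. (\<phi> x *\<^sub>R g x) \<bullet> b \<partial>lborel)"
      using integrable_test_function_scaleR[OF w(2) \<phi>] by (intro integral_inner_left[symmetric]) simp
    finally show "(\<integral>x. partial_deriv i \<phi> x *\<^sub>R (f x \<bullet> b) \<partial>lborel) = - (\<integral>x. \<phi> x *\<^sub>R (g x \<bullet> b) \<partial>lborel)"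
      by simp
  qed
qed

lemma wnorm_le_sum_components:
  fixes f :: "real^'n::{finite,linorder} \<Rightarrow> 'a::euclidean_space"
  assumes [measurable]: "f \<in> borel_measurable borel" and q: "0 \<le> q"
  shows "wnorm l q e f \<le> ennreal (real DIM('a) powr q) * (\<Sum>b\<in>Basis. wnorm l q e (\<lambda>x. f x \<bullet> b))"
proof -
  let ?I = "indicator (- singular_set l) :: (real, 'n) vec \<Rightarrow> ennreal"
  have "wnorm l q e f \<le> (\<integral>\<^sup>+x. ennreal (real DIM('a) powr q) * (\<Sum>b\<in>Basis. ?I x * ennreal ((rho l x powr e * norm (f x \<bullet> b)) powr q)) \<partial>lborel)"
    unfolding wnorm_def
  proof (intro nn_integral_mono)
    fix x
    have "(rho l x powr e * norm (f x)) powr q \<le> (\<Sum>b\<in>Basis. rho l x powr e * norm (f x \<bullet> b)) powr q"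
      using q norm_le_l1[of "f x"] by (intro powr_mono2) (auto simp: sum_distrib_left[symmetric] intro!: mult_left_mono)
    also have "\<dots> \<le> real DIM('a) powr q * (\<Sum>b\<in>Basis. (rho l x powr e * norm (f x \<bullet> b)) powr q)"
      by (intro sum_powr_le q) auto
    finally have "ennreal ((rho l x powr e * norm (f x)) powr q) \<le> ennreal (real DIM('a) powr q * (\<Sum>b\<in>Basis. (rho l x powr e * norm (f x \<bullet> b)) powr q))"
      by (rule ennreal_leI)
    also have "\<dots> = ennreal (real DIM('a) powr q) * (\<Sum>b\<in>Basis. ennreal ((rho l x powr e * norm (f x \<bullet> b)) powr q))"
      by (subst ennreal_mult) (auto intro: sum_nonneg)
    finally show "?I x * ennreal ((rho l x powr e * norm (f x)) powr q) \<le>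
        ennreal (real DIM('a) powr q) * (\<Sum>b\<in>Basis. ?I x * ennreal ((rho l x powr e * norm (f x \<bullet> b)) powr q))"
      by (cases "x \<in> - singular_set l") simp_all
  qed
  also have "\<dots> = ennreal (real DIM('a) powr q) * (\<Sum>b\<in>Basis. wnorm l q e (\<lambda>x. f x \<bullet> b))"
    unfolding wnorm_def by (subst nn_integral_cmult, measurable, subst nn_integral_sum, measurable)
  finally show ?thesis .
qed

text \<open>The scalar inequality for each component. The bounds are rewritten as powers, so that
  \<open>E\<close> scales like a norm and the conclusion can be fed into the next Sobolev
  step.\<close>

lemma weighted_sobolev_vector:
  fixes p s :: real and l :: nat
  defines "n \<equiv> real CARD('n::{finite,linorder})"
  assumes p: "1 < p" "p < n"
  shows "\<exists>c\<ge>0. \<forall>(f :: (real, 'n) vec \<Rightarrow> 'a::euclidean_space) f' E. (\<forall>i. weak_partial (- singular_set l) i f (f' i)) \<longrightarrow> 0 \<le> E \<longrightarrow>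
    wnorm l p (s - 1) f \<le> ennreal (E powr p) \<longrightarrow> (\<forall>i. wnorm l p s (f' i) \<le> ennreal (E powr p)) \<longrightarrow>
    wnorm l (n * p / (n - p)) s f \<le> ennreal ((c * E) powr (n * p / (n - p)))"
proof -
  define ps where "ps = n * p / (n - p)"
  have ps0: "0 < ps" using p by (simp add: ps_def)
  obtain c where c: "0 \<le> c" and sob: "\<And>(f :: (real, 'n) vec \<Rightarrow> real) f' E. (\<And>i. weak_partial (- singular_set l) i f (f' i)) \<Longrightarrow> 0 \<le> E \<Longrightarrow>
      wnorm l p (s - 1) f \<le> ennreal E \<Longrightarrow> (\<And>i. wnorm l p s (f' i) \<le> ennreal E) \<Longrightarrow>
      wnorm l ps s f \<le> ennreal (c * E powr (n / (n - p)))"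
    using weighted_sobolev[where 'n = 'n, OF p[unfolded n_def], of l s] unfolding wnorm_def real_norm_def ps_def n_def by blast
  \<comment> \<open>One factor \<open>DIM('a)\<close> counts the components; its power comes from
    taking \<open>powr ps\<close> of a sum.\<close>
  define M where "M = real DIM('a) powr ps * (real DIM('a) * c)"
  have M0: "0 \<le> M" using c by (simp add: M_def)
  define C where "C = M powr (1 / ps)"
  have "wnorm l ps s f \<le> ennreal ((C * E) powr ps)"
    if f: "\<And>i. weak_partial (- singular_set l) i f (f' i)" and E: "0 \<le> E" "wnorm l p (s - 1) f \<le> ennreal (E powr p)"
      "\<And>i. wnorm l p s (f' i) \<le> ennreal (E powr p)"
    for f :: "(real, 'n) vec \<Rightarrow> 'a" and f' E
  proof -
    have [measurable]: "f \<in> borel_measurable borel" using weak_partialD(1)[OF f] loc_intD(1) by blast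
    have comp: "wnorm l ps s (\<lambda>x. f x \<bullet> b) \<le> ennreal (c * (E powr p) powr (n / (n - p)))" if b: "b \<in> Basis" for b
    proof (rule sob)
      show "weak_partial (- singular_set l) i (\<lambda>x. f x \<bullet> b) (\<lambda>x. f' i x \<bullet> b)" for i
        by (rule weak_partial_inner[OF f])
      have nb: "norm (y \<bullet> b) \<le> norm y" for y :: 'a using Basis_le_norm[OF b] by simp
      show "wnorm l p (s - 1) (\<lambda>x. f x \<bullet> b) \<le> ennreal (E powr p)"
        using p nb by (intro order_trans[OF wnorm_mono E(2)]) auto
      show "wnorm l p s (\<lambda>x. f' i x \<bullet> b) \<le> ennreal (E powr p)" for i
        using p nb by (intro order_trans[OF wnorm_mono E(3)]) auto
    qed simp
    have "wnorm l ps s f \<le> ennreal (real DIM('a) powr ps) * (\<Sum>b\<in>Basis. wnorm l ps s (\<lambda>x. f x \<bullet> b))"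
      using ps0 by (intro wnorm_le_sum_components) auto
    also have "\<dots> \<le> ennreal (real DIM('a) powr ps) * (\<Sum>b\<in>(Basis::'a set). ennreal (c * (E powr p) powr (n / (n - p))))"
      by (intro mult_left_mono sum_mono comp) auto
    also have "(\<Sum>b\<in>(Basis::'a set). ennreal (c * (E powr p) powr (n / (n - p)))) = ennreal (real DIM('a) * (c * (E powr p) powr (n / (n - p))))"
      using c by (simp add: ennreal_of_nat_eq_real_of_nat ennreal_mult)
    also have "ennreal (real DIM('a) powr ps) * \<dots> = ennreal (M * (E powr p) powr (n / (n - p)))"
      using c by (simp add: M_def ennreal_mult[symmetric] mult.assoc)
    also have "(E powr p) powr (n / (n - p)) = E powr ps"
      by (simp add: powr_powr ps_def mult.commute)
    also have "M * E powr ps = (C * E) powr ps"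
      using M0 E ps0 by (simp add: C_def powr_mult powr_powr)
    finally show ?thesis .
  qed
  moreover have "0 \<le> C" by (simp add: C_def)
  ultimately show ?thesis unfolding ps_def by blast
qed

section \<open>Families of derivatives and repeated gains of integrability\<close>

abbreviation mi_Suc :: "('n \<Rightarrow> nat) \<Rightarrow> 'n \<Rightarrow> 'n \<Rightarrow> nat" where
  "mi_Suc \<beta> i \<equiv> \<beta>(i := Suc (\<beta> i))"

lemma mi_order_Suc: "mi_order (mi_Suc \<beta> i) = Suc (mi_order \<beta>)"
proof -
  have "(\<Sum>j\<in>UNIV - {i}. mi_Suc \<beta> i j) = (\<Sum>j\<in>UNIV - {i}. \<beta> j)" by (rule sum.cong) auto
  then show ?thesis by (simp add: mi_order_def sum.remove[of UNIV i])
qed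

text \<open>The exponent q with 1/q = 1/p - k/n, reached after \<open>k\<close> Sobolev
  steps.\<close>

definition sobolev_exponent :: "real \<Rightarrow> real \<Rightarrow> nat \<Rightarrow> real" where
  "sobolev_exponent n p k = n * p / (n - real k * p)"

lemma sobolev_exponent_0: "0 < n \<Longrightarrow> sobolev_exponent n p 0 = p"
  by (simp add: sobolev_exponent_def)

text \<open>The bounds 1 < q < n license the next application of the Sobolev inequality; the upper
  one is the hypothesis (k + 1) p < n rewritten.\<close>

lemma sobolev_exponent_Suc:
  assumes "1 < p" "real (Suc k) * p < n"
  shows "sobolev_exponent n p (Suc k) = n * sobolev_exponent n p k / (n - sobolev_exponent n p k)"
    and "1 < sobolev_exponent n p k" "sobolev_exponent n p k < n"
proof -
  have a: "real k * p + p < n" using assms by (simp add: algebra_simps)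
  have kp: "0 \<le> real k * p" using assms by simp
  have n0: "0 < n" and d: "0 < n - real k * p" using a kp assms by linarith+
  define d where "d = n - real k * p"
  have d0: "0 < d" "0 < d - p" using a assms(1) unfolding d_def by linarith+
  have "n - n * p / d = n * (d - p) / d"
    using d0 by (simp add: diff_divide_distrib right_diff_distrib)
  then have "n * (n * p / d) / (n - n * p / d) = n * p / (d - p)"
    using n0 d0 by simp
  moreover have "n - real (Suc k) * p = d - p" by (simp add: d_def algebra_simps)
  ultimately show "sobolev_exponent n p (Suc k) = n * sobolev_exponent n p k / (n - sobolev_exponent n p k)"
    unfolding sobolev_exponent_def d_def[symmetric] by simp
  have "n * p < n * (n - real k * p)" using n0 a by (intro mult_strict_left_mono) auto
  then show "sobolev_exponent n p k < n" using d by (simp add: sobolev_exponent_def divide_less_eq)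
  have "1 * (n - real k * p) \<le> n" using kp by simp
  also have "\<dots> < n * p" using n0 assms by simp
  finally show "1 < sobolev_exponent n p k" using d by (simp add: sobolev_exponent_def less_divide_eq)
qed

text \<open>A coherent choice of Borel representatives, detached from the function they come from,
  so that each \<open>W \<beta>\<close> can be treated as a function in its own right.\<close>

definition deriv_family ::
    "nat \<Rightarrow> nat \<Rightarrow> (('n \<Rightarrow> nat) \<Rightarrow> real^'n::{finite,linorder} \<Rightarrow> 'a::{banach, second_countable_topology}) \<Rightarrow> bool" where
  "deriv_family l m W \<longleftrightarrow> (\<forall>\<beta>. mi_order \<beta> \<le> m \<longrightarrow> loc_int (- singular_set l) (W \<beta>)) \<and>
     (\<forall>\<beta> i. mi_order \<beta> < m \<longrightarrow> weak_partial (- singular_set l) i (W \<beta>) (W (mi_Suc \<beta> i)))"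

text \<open>For the step to k + 1 put s = |\<beta>| + k + 1 - a. The inequality asks for
  \<open>W \<beta>\<close> with weight s - 1 and for its derivatives, of order |\<beta>| + 1, with
  weight s, both in the exponent for \<open>k\<close>: two instances of the induction
  hypothesis.\<close>

lemma sobolev_iterate_aux:
  fixes p a :: real and l m k :: nat
  defines "n \<equiv> real CARD('n::{finite,linorder})"
  assumes p: "1 < p" and m: "real m * p < n" and k: "k \<le> m"
  shows "\<exists>c\<ge>0. \<forall>(W :: ('n \<Rightarrow> nat) \<Rightarrow> (real, 'n) vec \<Rightarrow> 'a::euclidean_space) E. deriv_family l m W \<longrightarrow> 0 \<le> E \<longrightarrow>
    (\<forall>\<beta>. mi_order \<beta> \<le> m \<longrightarrow> wnorm l p (real (mi_order \<beta>) - a) (W \<beta>) \<le> ennreal (E powr p)) \<longrightarrow>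
    (\<forall>\<beta>. mi_order \<beta> + k \<le> m \<longrightarrow> wnorm l (sobolev_exponent n p k) (real (mi_order \<beta> + k) - a) (W \<beta>)
       \<le> ennreal ((c * E) powr sobolev_exponent n p k))"
  using k
proof (induction k)
  case 0
  have "0 < n" by (simp add: n_def)
  then show ?case by (intro exI[of _ 1]) (simp add: sobolev_exponent_0)
next
  case (Suc k)
  let ?q = "sobolev_exponent n p k" and ?q' = "sobolev_exponent n p (Suc k)"
  have "real (Suc k) * p \<le> real m * p" using Suc.prems p by (intro mult_right_mono) auto
  then have lt: "real (Suc k) * p < n" using m by simp
  note q = sobolev_exponent_Suc[OF p lt]
  from Suc obtain c where c: "0 \<le> c" and IH: "\<And>(W :: ('n \<Rightarrow> nat) \<Rightarrow> (real, 'n) vec \<Rightarrow> 'a) E \<beta>. deriv_family l m W \<Longrightarrow> 0 \<le> E \<Longrightarrow>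
    (\<And>\<beta>. mi_order \<beta> \<le> m \<Longrightarrow> wnorm l p (real (mi_order \<beta>) - a) (W \<beta>) \<le> ennreal (E powr p)) \<Longrightarrow>
    mi_order \<beta> + k \<le> m \<Longrightarrow> wnorm l ?q (real (mi_order \<beta> + k) - a) (W \<beta>) \<le> ennreal ((c * E) powr ?q)"
    by (metis Suc_leD)
  define good where "good s d \<longleftrightarrow> 0 \<le> d \<and> (\<forall>(f :: (real, 'n) vec \<Rightarrow> 'a) f' E. (\<forall>i. weak_partial (- singular_set l) i f (f' i)) \<longrightarrow> 0 \<le> E \<longrightarrow>
      wnorm l ?q (s - 1) f \<le> ennreal (E powr ?q) \<longrightarrow> (\<forall>i. wnorm l ?q s (f' i) \<le> ennreal (E powr ?q)) \<longrightarrow>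
      wnorm l ?q' s f \<le> ennreal ((d * E) powr ?q'))" for s d
  have "\<exists>d. good s d" for s
    unfolding good_def q(1) using weighted_sobolev_vector[where 'n = 'n and 'a = 'a, OF q(2,3)[unfolded n_def], of l s]
    unfolding n_def by blast
  then obtain d where d: "\<And>s. good s (d s)" by metis
  \<comment> \<open>The Sobolev constant depends on the weight and so on the order of \<beta>;
    summing over the finitely many orders gives a common one.\<close>
  define D where "D = (\<Sum>b\<le>m. d (real (b + Suc k) - a))"
  have d0: "0 \<le> d s" for s using d[of s] by (simp add: good_def)
  have dD: "d (real (b + Suc k) - a) \<le> D" if "b \<le> m" for b
    unfolding D_def using that d0 by (intro member_le_sum) auto
  have D0: "0 \<le> D" unfolding D_def by (intro sum_nonneg d0)
  show ?case
  proof (intro exI[of _ "D * c"] conjI allI impI)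
    show "0 \<le> D * c" using D0 c by simp
    fix W :: "('n \<Rightarrow> nat) \<Rightarrow> (real, 'n) vec \<Rightarrow> 'a" and E and \<beta> :: "'n \<Rightarrow> nat"
    assume W: "deriv_family l m W" and E: "0 \<le> E"
      and bd: "\<forall>\<beta>. mi_order \<beta> \<le> m \<longrightarrow> wnorm l p (real (mi_order \<beta>) - a) (W \<beta>) \<le> ennreal (E powr p)"
      and \<beta>: "mi_order \<beta> + Suc k \<le> m"
    let ?s = "real (mi_order \<beta> + Suc k) - a"
    have w: "weak_partial (- singular_set l) i (W \<beta>) (W (mi_Suc \<beta> i))" for i
      using W \<beta> by (simp add: deriv_family_def)
    have 1: "wnorm l ?q (?s - 1) (W \<beta>) \<le> ennreal ((c * E) powr ?q)"
      using IH[OF W E, of \<beta>] bd \<beta> by (simp add: algebra_simps)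
    have 2: "wnorm l ?q ?s (W (mi_Suc \<beta> i)) \<le> ennreal ((c * E) powr ?q)" for i
      using IH[OF W E, of "mi_Suc \<beta> i"] bd \<beta> by (simp add: mi_order_Suc algebra_simps)
    have "wnorm l ?q' ?s (W \<beta>) \<le> ennreal ((d ?s * (c * E)) powr ?q')"
      by (rule d[of ?s, unfolded good_def, THEN conjunct2, rule_format, where f' = "\<lambda>i. W (mi_Suc \<beta> i)"])
        (use w 1 2 c E in auto)
    also have "\<dots> \<le> ennreal ((D * c * E) powr ?q')"
    proof (intro ennreal_leI powr_mono2)
      have "?q' = n * ?q / (n - ?q)" by (rule q(1))
      then show "0 \<le> ?q'" using q(2,3) by simp
      show "0 \<le> d ?s * (c * E)" using d0 c E by simp
      show "d ?s * (c * E) \<le> D * c * E"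
        unfolding mult.assoc using dD[of "mi_order \<beta>"] \<beta> c E by (intro mult_right_mono) auto
    qed
    finally show "wnorm l ?q' ?s (W \<beta>) \<le> ennreal ((D * c * E) powr ?q')" .
  qed
qed

text \<open>One constant for every number of steps. It is at least 1, so that \<open>c * E\<close>
  also bounds norms for which no step was taken.\<close>

lemma sobolev_iterate:
  fixes p a :: real and l m :: nat
  defines "n \<equiv> real CARD('n::{finite,linorder})"
  assumes p: "1 < p" and m: "real m * p < n"
  shows "\<exists>c\<ge>1. \<forall>(W :: ('n \<Rightarrow> nat) \<Rightarrow> (real, 'n) vec \<Rightarrow> 'a::euclidean_space) E k \<beta>. deriv_family l m W \<longrightarrow> 0 \<le> E \<longrightarrow>
    (\<forall>\<beta>. mi_order \<beta> \<le> m \<longrightarrow> wnorm l p (real (mi_order \<beta>) - a) (W \<beta>) \<le> ennreal (E powr p)) \<longrightarrow>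
    mi_order \<beta> + k \<le> m \<longrightarrow> wnorm l (sobolev_exponent n p k) (real (mi_order \<beta> + k) - a) (W \<beta>)
       \<le> ennreal ((c * E) powr sobolev_exponent n p k)"
proof -
  define good where "good k c \<longleftrightarrow> 0 \<le> c \<and> (\<forall>(W :: ('n \<Rightarrow> nat) \<Rightarrow> (real, 'n) vec \<Rightarrow> 'a) E. deriv_family l m W \<longrightarrow> 0 \<le> E \<longrightarrow>
    (\<forall>\<beta>. mi_order \<beta> \<le> m \<longrightarrow> wnorm l p (real (mi_order \<beta>) - a) (W \<beta>) \<le> ennreal (E powr p)) \<longrightarrow>
    (\<forall>\<beta>. mi_order \<beta> + k \<le> m \<longrightarrow> wnorm l (sobolev_exponent n p k) (real (mi_order \<beta> + k) - a) (W \<beta>)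
       \<le> ennreal ((c * E) powr sobolev_exponent n p k)))" for k c
  have "\<exists>c. k \<le> m \<longrightarrow> good k c" for k
    unfolding good_def using sobolev_iterate_aux[where 'n = 'n and 'a = 'a, OF p m[unfolded n_def], of k l a] unfolding n_def by blast
  then obtain c where c: "\<And>k. k \<le> m \<Longrightarrow> good k (c k)" by metis
  define C where "C = 1 + (\<Sum>k\<le>m. c k)"
  have c0: "0 \<le> c k" if "k \<le> m" for k using c[OF that] by (simp add: good_def)
  have cC: "c k \<le> C" if "k \<le> m" for k
  proof -
    have "c k \<le> (\<Sum>k\<le>m. c k)" using that c0 by (intro member_le_sum) auto
    then show ?thesis by (simp add: C_def)
  qed
  show ?thesis
  proof (intro exI[of _ C] conjI allI impI)
    show "1 \<le> C" unfolding C_def using sum_nonneg[of "{..m}" c] c0 by simp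
    fix W :: "('n \<Rightarrow> nat) \<Rightarrow> (real, 'n) vec \<Rightarrow> 'a" and E k and \<beta> :: "'n \<Rightarrow> nat"
    assume W: "deriv_family l m W" and E: "0 \<le> E"
      and bd: "\<forall>\<beta>. mi_order \<beta> \<le> m \<longrightarrow> wnorm l p (real (mi_order \<beta>) - a) (W \<beta>) \<le> ennreal (E powr p)"
      and \<beta>: "mi_order \<beta> + k \<le> m"
    have k: "k \<le> m" using \<beta> by simp
    have "real k * p \<le> real m * p" using k p by (intro mult_right_mono) auto
    then have "real k * p \<le> n" using m by linarith
    then have q0: "0 \<le> sobolev_exponent n p k"
      using p by (auto simp: sobolev_exponent_def n_def intro!: divide_nonneg_nonneg)
    have "wnorm l (sobolev_exponent n p k) (real (mi_order \<beta> + k) - a) (W \<beta>) \<le> ennreal ((c k * E) powr sobolev_exponent n p k)"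
      using c[OF k] W E bd \<beta> unfolding good_def by blast
    also have "\<dots> \<le> ennreal ((C * E) powr sobolev_exponent n p k)"
      using q0 cC[OF k] c0[OF k] E by (intro ennreal_leI powr_mono2 mult_right_mono) auto
    finally show "wnorm l (sobolev_exponent n p k) (real (mi_order \<beta> + k) - a) (W \<beta>) \<le> ennreal ((C * E) powr sobolev_exponent n p k)" .
  qed
qed

subsection \<open>Products of weighted functions\<close>

text \<open>With t = 1/q + 1/r the exponents q t and r t are exactly conjugate, and Young's
  inequality for a^(1/t) and b^(1/t) bounds (a b)^(1/t). This dominates a b unless a b \<le> 1, the
  case covered by the summand 1.\<close>

lemma young_pairI:
  fixes q r :: real
  assumes "1 \<le> q" "1 \<le> r" "1 / q + 1 / r \<le> 1"
  shows "young_pair q r"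
  unfolding young_pair_def
proof (intro conjI allI impI assms)
  fix a b :: real assume ab: "0 \<le> a" "0 \<le> b"
  define t where "t = 1 / q + 1 / r"
  have t: "0 < t" "t \<le> 1" using assms by (auto simp: t_def intro!: add_pos_pos)
  have tq: "q * t = 1 + q / r" "r * t = 1 + r / q" using assms by (simp_all add: t_def distrib_left)
  then have gt: "1 < q * t" "1 < r * t" using assms by auto
  have "1 / (q * t) + 1 / (r * t) = (1 / q + 1 / r) / t"
    by (simp add: add_divide_distrib)
  also have "\<dots> = 1" using t by (simp add: t_def)
  finally have "a powr (1 / t) * b powr (1 / t) \<le> (a powr (1 / t)) powr (q * t) / (q * t) + (b powr (1 / t)) powr (r * t) / (r * t)"
    using gt by (intro Youngs_inequality) auto
  also have "\<dots> = a powr q / (q * t) + b powr r / (r * t)"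
    using t by (simp add: powr_powr)
  also have "\<dots> \<le> a powr q / 1 + b powr r / 1"
    using gt by (intro add_mono divide_left_mono) auto
  finally have y: "(a * b) powr (1 / t) \<le> a powr q + b powr r"
    using ab by (simp add: powr_mult)
  show "a * b \<le> 1 + a powr q + b powr r"
  proof (cases "a * b \<le> 1")
    case True
    moreover have "0 \<le> a powr q + b powr r" by simp
    ultimately show ?thesis by linarith
  next
    case False
    have "1 \<le> 1 / t" using t by simp
    then have "(a * b) powr 1 \<le> (a * b) powr (1 / t)" using False by (intro powr_mono) auto
    then show ?thesis using y ab by simp
  qed
qed

text \<open>\<open>r\<close> is the exponent that Young's inequality requires, \<open>r'\<close> the
  possibly larger one that is available. As p < r \<le> r', the power with exponent \<open>r\<close>
  is at most the sum of those with exponents \<open>p\<close> and \<open>r'\<close>, according to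
  whether y \<le> 1.\<close>

lemma powr_prod_le_three:
  fixes x y p q r r' :: real
  assumes xy: "0 \<le> x" "0 \<le> y" and p: "0 < p" "p < q" "p < r" "p / q + p / r = 1" and r': "r \<le> r'"
  shows "(x * y) powr p \<le> x powr q + y powr p + y powr r'"
proof -
  have "1 / (q / p) + 1 / (r / p) = 1" using p by simp
  then have "x powr p * y powr p \<le> (x powr p) powr (q / p) / (q / p) + (y powr p) powr (r / p) / (r / p)"
    using p by (intro Youngs_inequality) auto
  also have "\<dots> = x powr q / (q / p) + y powr r / (r / p)" using p by (simp add: powr_powr)
  also have "\<dots> \<le> x powr q / 1 + y powr r / 1" using p by (intro add_mono divide_left_mono) auto
  finally have 1: "(x * y) powr p \<le> x powr q + y powr r" using xy by (simp add: powr_mult)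
  have "y powr r \<le> y powr p + y powr r'"
  proof (cases "y \<le> 1")
    case True
    have "y powr r \<le> y powr p" using True xy p by (cases "y = 0") (auto intro: powr_mono')
    then show ?thesis by (simp add: add_increasing2)
  next
    case False
    have "y powr r \<le> y powr r'" using False r' by (intro powr_mono) auto
    then show ?thesis by (simp add: add_increasing)
  qed
  with 1 show ?thesis by simp
qed

text \<open>Each of the three integrands bounding \<open>U\<close> and \<open>V\<close> is \<open>rho powr (- n)\<close> times a power of
  \<open>rho powr (b - a + n / p) * norm U\<close> or \<open>rho powr (c - a + n / p) * norm V\<close>, so that Young's
  inequality applies pointwise.\<close>

lemma wnorm_mult_le:
  fixes U V :: "real^'n::{finite,linorder} \<Rightarrow> 'a::{real_normed_field, euclidean_space}" and p a E F :: real and b c j k l :: nat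
  defines "n \<equiv> real CARD('n)"
  assumes [measurable]: "U \<in> borel_measurable borel" "V \<in> borel_measurable borel"
    and p: "1 < p" and j: "1 \<le> j" "real j * p < n" and k: "real k * p < n" and jk: "n \<le> real (j + k) * p"
    and EF: "0 < E" "0 < F"
    and U: "wnorm l (sobolev_exponent n p j) (real (b + j) - a) U \<le> ennreal (E powr sobolev_exponent n p j)"
    and V: "wnorm l p (real c - a) V \<le> ennreal (F powr p)"
    and V': "wnorm l (sobolev_exponent n p k) (real (c + k) - a) V \<le> ennreal (F powr sobolev_exponent n p k)"
  shows "wnorm l p (real (b + c) - 2 * (a - n / (2 * p))) (\<lambda>x. U x * V x) \<le> ennreal (3 * (E * F) powr p)"
proof -
  define q where "q = sobolev_exponent n p j"
  define r' where "r' = sobolev_exponent n p k"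
  \<comment> \<open>Since p/q = 1 - j p/n, the conjugate exponent has p/r = j p/n. The comparison r
    \<le> r' below is n \<le> (j + k) p rewritten.\<close>
  define r where "r = n / real j"
  have n0: "0 < n" by (simp add: n_def)
  have dj: "0 < n - real j * p" and dk: "0 < n - real k * p" using j k by auto
  have j0: "0 < real j" using j by simp
  have q_eq: "p / q = 1 - real j * p / n"
    using n0 p dj by (simp add: q_def sobolev_exponent_def diff_divide_distrib)
  have pq: "p < q"
  proof -
    have "p * (n - real j * p) < n * p" using p j0 by (simp add: algebra_simps)
    then show ?thesis using dj by (simp add: q_def sobolev_exponent_def less_divide_eq)
  qed
  have pr: "p < r" using j0 j by (simp add: r_def less_divide_eq mult.commute)
  have pqr: "p / q + p / r = 1" unfolding q_eq by (simp add: r_def mult.commute)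
  have rr': "r \<le> r'"
  proof -
    have "n * (n - real k * p) \<le> n * (real j * p)"
      using n0 jk by (intro mult_left_mono) (auto simp: algebra_simps)
    then show ?thesis using j0 dk by (simp add: r_def r'_def sobolev_exponent_def divide_le_eq le_divide_eq mult_ac)
  qed
  have q0: "0 < q" and r'0: "0 < r'" using p pq pr rr' by auto
  let ?\<Omega> = "- singular_set l :: (real, 'n) vec set"
  let ?X = "\<lambda>x. rho l x powr (real b - a + n / p) * norm (U x) / E"
  let ?Y = "\<lambda>x. rho l x powr (real c - a + n / p) * norm (V x) / F"
  \<comment> \<open>Homogeneity: a term with weight shift \<open>w\<close> and exponent
    \<open>z\<close> is a power of the scale-invariant quantity times \<open>rho powr (- n)\<close>
    as soon as (w - n/p) z = - n. The three terms in use, with w = j, 0 and k, all satisfy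
    this.\<close>
  have scale: "rho l x powr (- n) * (rho l x powr (real d - a + n / p) * t / G) powr z = G powr (- z) * (rho l x powr (real d + w - a) * t) powr z"
    if x: "x \<in> ?\<Omega>" and z: "(w - n / p) * z = - n" and t: "0 \<le> t" and G: "0 < G" for x :: "(real, 'n) vec" and d t G z w
  proof -
    have rp: "0 < rho l x" using rho_pos[OF x] .
    have "(real d - a + n / p) * z + - n = (real d + w - a) * z" using z by (simp add: algebra_simps)
    then have "rho l x powr (- n) * (rho l x powr (real d - a + n / p)) powr z = (rho l x powr (real d + w - a)) powr z"
      using rp by (simp add: powr_powr powr_add[symmetric] add.commute)
    moreover have "(A * t / G) powr z = A powr z * (t powr z * G powr (- z))" if "0 \<le> A" for A
      using that t G by (simp add: powr_mult powr_divide powr_minus_divide)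
    ultimately show ?thesis using t by (simp add: powr_mult mult.assoc[symmetric])
  qed
  have zq: "(real j - n / p) * q = - n"
  proof -
    have "real j - n / p = - ((n - real j * p) / p)" using p by (simp add: diff_divide_distrib)
    then show ?thesis using p dj by (simp add: q_def sobolev_exponent_def)
  qed
  have zr': "(real k - n / p) * r' = - n"
  proof -
    have "real k - n / p = - ((n - real k * p) / p)" using p by (simp add: diff_divide_distrib)
    then show ?thesis using p dk by (simp add: r'_def sobolev_exponent_def)
  qed
  have zp: "(0 - n / p) * p = - n" using p by simp
  have main: "(rho l x powr (real (b + c) - 2 * (a - n / (2 * p))) * norm (U x * V x)) powr p \<le>
      (E * F) powr p * (E powr (- q) * (rho l x powr (real (b + j) - a) * norm (U x)) powr q +
        F powr (- p) * (rho l x powr (real c - a) * norm (V x)) powr p +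
        F powr (- r') * (rho l x powr (real (c + k) - a) * norm (V x)) powr r')"
    if x: "x \<in> ?\<Omega>" for x
  proof -
    have rp: "0 < rho l x" using rho_pos[OF x] .
    have "(rho l x powr (real (b + c) - 2 * (a - n / (2 * p))) * norm (U x * V x)) powr p =
       (E * F) powr p * (rho l x powr (- n) * (?X x * ?Y x) powr p)"
    proof -
      have "(real (b + c) - 2 * (a - n / (2 * p))) * p = - n + (real b - a + n / p) * p + (real c - a + n / p) * p"
        using p by (simp add: algebra_simps)
      then have Z: "(rho l x powr (real (b + c) - 2 * (a - n / (2 * p)))) powr p =
          rho l x powr (- n) * (rho l x powr (real b - a + n / p)) powr p * (rho l x powr (real c - a + n / p)) powr p"
        by (simp only: powr_powr) (simp only: powr_add)
      have "(Z * norm (U x * V x)) powr p = (E * F) powr p * (R * ((P * norm (U x) / E) * (Q * norm (V x) / F)) powr p)"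
        if "Z powr p = R * P powr p * Q powr p" "0 \<le> Z" "0 \<le> P" "0 \<le> Q" for Z R P Q :: real
        using EF that by (simp add: norm_mult powr_mult powr_divide)
      from this[OF Z] show ?thesis by (simp only: powr_ge_zero)
    qed
    also have "\<dots> \<le> (E * F) powr p * (rho l x powr (- n) * (?X x powr q + ?Y x powr p + ?Y x powr r'))"
      using EF p pq pr pqr rr' by (intro mult_left_mono powr_prod_le_three[where r = r]) auto
    also have "rho l x powr (- n) * (?X x powr q + ?Y x powr p + ?Y x powr r') =
        E powr (- q) * (rho l x powr (real (b + j) - a) * norm (U x)) powr q +
        F powr (- p) * (rho l x powr (real c - a) * norm (V x)) powr p +
        F powr (- r') * (rho l x powr (real (c + k) - a) * norm (V x)) powr r'"
      using scale[OF x zq, of "norm (U x)" E b] scale[OF x zp, of "norm (V x)" F c] scale[OF x zr', of "norm (V x)" F c] EF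
      by (simp add: distrib_left)
    finally show ?thesis .
  qed
  let ?I = "indicator ?\<Omega> :: _ \<Rightarrow> ennreal"
  let ?T1 = "\<lambda>x. ?I x * ennreal ((rho l x powr (real (b + j) - a) * norm (U x)) powr q)"
  let ?T2 = "\<lambda>x. ?I x * ennreal ((rho l x powr (real c - a) * norm (V x)) powr p)"
  let ?T3 = "\<lambda>x. ?I x * ennreal ((rho l x powr (real (c + k) - a) * norm (V x)) powr r')"
  have "wnorm l p (real (b + c) - 2 * (a - n / (2 * p))) (\<lambda>x. U x * V x) \<le>
    (\<integral>\<^sup>+x. ennreal ((E * F) powr p) * (ennreal (E powr (- q)) * ?T1 x + ennreal (F powr (- p)) * ?T2 x + ennreal (F powr (- r')) * ?T3 x) \<partial>lborel)"
    unfolding wnorm_def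
  proof (intro nn_integral_mono)
    fix x
    show "?I x * ennreal ((rho l x powr (real (b + c) - 2 * (a - n / (2 * p))) * norm (U x * V x)) powr p) \<le>
      ennreal ((E * F) powr p) * (ennreal (E powr (- q)) * ?T1 x + ennreal (F powr (- p)) * ?T2 x + ennreal (F powr (- r')) * ?T3 x)"
    proof (cases "x \<in> ?\<Omega>")
      case True
      from ennreal_leI[OF main[OF True]] True show ?thesis
        by (simp add: ennreal_mult ennreal_plus)
    qed simp
  qed
  also have "\<dots> = ennreal ((E * F) powr p) * (ennreal (E powr (- q)) * wnorm l q (real (b + j) - a) U +
      ennreal (F powr (- p)) * wnorm l p (real c - a) V + ennreal (F powr (- r')) * wnorm l r' (real (c + k) - a) V)"
    unfolding wnorm_def by (simp add: nn_integral_cmult nn_integral_add)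
  also have "\<dots> \<le> ennreal ((E * F) powr p) * (ennreal (E powr (- q)) * ennreal (E powr q) +
      ennreal (F powr (- p)) * ennreal (F powr p) + ennreal (F powr (- r')) * ennreal (F powr r'))"
    using U V V' unfolding q_def r'_def by (intro mult_left_mono add_mono) auto
  \<comment> \<open>Each of the three normalised integrals is at most 1; this is the origin of the
    constant 3.\<close>
  also have "\<dots> = ennreal ((E * F) powr p) * (1 + 1 + 1)"
    using EF by (simp add: ennreal_mult[symmetric] powr_add[symmetric])
  also have "\<dots> = ennreal (3 * (E * F) powr p)"
    by (simp add: ennreal_mult mult.commute)
  finally show ?thesis .
qed

subsection \<open>Borel representatives of weak derivatives\<close>

text \<open>The Borel counterpart of \<open>has_weak_deriv\<close>. Integrals run over the whole
  space, which is harmless because test functions vanish off \<Omega>.\<close>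

definition weak_multi ::
    "(real^'n::{finite,linorder}) set \<Rightarrow> ('n \<Rightarrow> nat) \<Rightarrow> (real^'n::{finite,linorder} \<Rightarrow> 'a::{banach, second_countable_topology}) \<Rightarrow>
     (real^'n::{finite,linorder} \<Rightarrow> 'a) \<Rightarrow> bool" where
  "weak_multi \<Omega> \<alpha> f g \<longleftrightarrow> loc_int \<Omega> f \<and> loc_int \<Omega> g \<and>
     (\<forall>\<phi>\<in>test_functions \<Omega>. (\<integral>x. multi_deriv \<alpha> \<phi> x *\<^sub>R f x \<partial>lborel) = (- 1) ^ mi_order \<alpha> *\<^sub>R (\<integral>x. \<phi> x *\<^sub>R g x \<partial>lborel))"

lemma weak_multiD:
  assumes "weak_multi \<Omega> \<alpha> f g"
  shows "loc_int \<Omega> f" "loc_int \<Omega> g"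
    "\<phi> \<in> test_functions \<Omega> \<Longrightarrow> (\<integral>x. multi_deriv \<alpha> \<phi> x *\<^sub>R f x \<partial>lborel) = (- 1) ^ mi_order \<alpha> *\<^sub>R (\<integral>x. \<phi> x *\<^sub>R g x \<partial>lborel)"
  using assms by (auto simp: weak_multi_def)

lemma multi_deriv_test_function:
  assumes "\<phi> \<in> test_functions \<Omega>" shows "multi_deriv \<alpha> \<phi> \<in> test_functions \<Omega>"
proof -
  have pow: "(partial_deriv i ^^ k) \<psi> \<in> test_functions \<Omega>" if "\<psi> \<in> test_functions \<Omega>" for i k \<psi>
    by (induction k) (auto intro: test_function_partial_deriv(1) that)
  have "foldr (\<lambda>i. partial_deriv i ^^ \<alpha> i) js \<phi> \<in> test_functions \<Omega>" for js
    by (induction js) (auto intro: pow assms)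
  then show ?thesis by (simp add: multi_deriv_def)
qed

lemma test_function_measurable_support:
  assumes "\<phi> \<in> test_functions \<Omega>"
  shows "\<phi> \<in> borel_measurable borel" "x \<notin> \<Omega> \<Longrightarrow> \<phi> x = 0"
proof -
  note t = test_functionD[OF assms]
  show "\<phi> \<in> borel_measurable borel"
    using t(2) by (auto simp: has_partials_def intro: borel_measurable_continuous_onI)
  show "\<phi> x = 0" if "x \<notin> \<Omega>" using t(4) that by (intro t(5)) blast
qed

lemma AE_eq_if_test_integrals_eq:
  fixes f g :: "real^'n::finite \<Rightarrow> 'a::{banach, second_countable_topology}"
  assumes \<Omega>: "open \<Omega>" and f: "loc_int \<Omega> f" and g: "loc_int \<Omega> g"
    and eq: "\<And>\<phi>. \<phi> \<in> test_functions \<Omega> \<Longrightarrow> (\<integral>x. \<phi> x *\<^sub>R f x \<partial>lborel) = (\<integral>x. \<phi> x *\<^sub>R g x \<partial>lborel)"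
  shows "AE x in lborel. x \<in> \<Omega> \<longrightarrow> f x = g x"
proof -
  have "AE x in lborel. x \<in> \<Omega> \<longrightarrow> f x - g x = 0"
  proof (rule AE_zero_if_test_integrals_zero[OF \<Omega>])
    show "loc_int \<Omega> (\<lambda>x. f x - g x)"
      using f g by (auto simp: loc_int_def scaleR_diff_right)
    show "(\<integral>x. \<phi> x *\<^sub>R (f x - g x) \<partial>lborel) = 0" if "\<phi> \<in> test_functions \<Omega>" for \<phi>
      using eq[OF that] integrable_test_function_scaleR[OF f that] integrable_test_function_scaleR[OF g that]
      by (simp add: scaleR_diff_right)
  qed
  then show ?thesis by simp
qed

text \<open>Local integrability gives measurability only on compact subsets; an increasing
  exhaustion passes it on to \<Omega>.\<close>

lemma locally_integrable_measurable:
  assumes \<Omega>: "open \<Omega>" and u: "locally_integrable_on u \<Omega>"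
  shows "(\<lambda>x. indicator \<Omega> x *\<^sub>R u x) \<in> borel_measurable lebesgue"
proof -
  obtain C where C: "\<And>n::nat. compact (C n)" "\<And>n. C n \<subseteq> \<Omega>" "(\<Union>n. C n) = \<Omega>"
    using compact_exhaustion[OF \<Omega>] by blast
  define D where "D n = (\<Union>i\<le>n. C i)" for n
  have D: "compact (D n)" "D n \<subseteq> \<Omega>" for n
    using C by (auto simp: D_def intro!: compact_UN)
  show ?thesis
  proof (rule borel_measurable_LIMSEQ_metric)
    show "(\<lambda>x. indicator (D n) x *\<^sub>R u x) \<in> borel_measurable lebesgue" for n
      using u D unfolding locally_integrable_on_def set_integrable_def by (blast intro: borel_measurable_integrable)
    fix x
    have "eventually (\<lambda>n. (indicator (D n) x :: real) = indicator \<Omega> x) sequentially"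
    proof (cases "x \<in> \<Omega>")
      case True
      then obtain i where "x \<in> C i" using C(3) by blast
      then have "x \<in> D n" if "i \<le> n" for n using that by (auto simp: D_def)
      then show ?thesis using True by (auto simp: eventually_sequentially intro!: exI[of _ i])
    next
      case False
      then have "x \<notin> D n" for n using D(2) by blast
      then show ?thesis using False by simp
    qed
    then show "(\<lambda>n. indicator (D n) x *\<^sub>R u x) \<longlonglongrightarrow> indicator \<Omega> x *\<^sub>R u x"
      by (intro tendsto_eventually) (auto elim: eventually_mono)
  qed
qed

text \<open>Each component is measurable for the completed measure and therefore agrees almost
  everywhere with a Borel function.\<close>

lemma borel_representative:
  fixes u :: "real^'n::finite \<Rightarrow> 'a::euclidean_space"
  assumes \<Omega>: "open \<Omega>" and u: "locally_integrable_on u \<Omega>"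
  shows "\<exists>u'. loc_int \<Omega> u' \<and> (AE x in lborel. x \<in> \<Omega> \<longrightarrow> u x = u' x)"
proof -
  let ?u = "\<lambda>x. indicator \<Omega> x *\<^sub>R u x"
  note m = locally_integrable_measurable[OF \<Omega> u]
  have "(\<lambda>x. ?u x \<bullet> b) \<in> borel_measurable lebesgue" for b
    by (rule borel_measurable_inner[OF m borel_measurable_const])
  then have "\<forall>b. \<exists>g\<in>borel_measurable lborel. AE x in lborel. ?u x \<bullet> b = g x"
    using completion_ex_borel_measurable_real by blast
  then obtain g where g: "\<And>b. g b \<in> borel_measurable lborel" "\<And>b. AE x in lborel. ?u x \<bullet> b = g b x" by metis
  define u' where "u' x = (\<Sum>b\<in>Basis. g b x *\<^sub>R b)" for x
  have [measurable]: "u' \<in> borel_measurable borel" unfolding u'_def using g(1) by auto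
  have "AE x in lborel. \<forall>b\<in>Basis. ?u x \<bullet> b = g b x"
    using g(2) by (intro AE_finite_allI) auto
  then have eq: "AE x in lborel. ?u x = u' x"
  proof eventually_elim
    case (elim x)
    have "u' x = (\<Sum>b\<in>Basis. (?u x \<bullet> b) *\<^sub>R b)"
      unfolding u'_def using elim by (intro sum.cong) auto
    then show ?case by (simp only: euclidean_representation)
  qed
  have "loc_int \<Omega> u'"
    unfolding loc_int_def
  proof (intro conjI allI impI)
    fix K assume K: "compact K \<and> K \<subseteq> \<Omega>"
    then have [measurable]: "K \<in> sets borel" by (simp add: borel_compact)
    have i: "integrable lebesgue (\<lambda>x. indicator K x *\<^sub>R u x)"
      using u K by (simp add: locally_integrable_on_def set_integrable_def)
    have "integrable lebesgue (\<lambda>x. indicator K x *\<^sub>R u' x)"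
    proof (rule integrable_cong_AE_imp[OF i])
      have "(\<lambda>x. indicator K x *\<^sub>R u' x) \<in> borel_measurable lborel" by measurable
      then show "(\<lambda>x. indicator K x *\<^sub>R u' x) \<in> borel_measurable lebesgue" by (rule measurable_completion)
      show "AE x in lebesgue. indicator K x *\<^sub>R u x = indicator K x *\<^sub>R u' x"
        using AE_completion[OF eq] by eventually_elim (use K in \<open>auto simp: indicator_def split: if_splits\<close>)
    qed
    then show "integrable lborel (\<lambda>x. indicator K x *\<^sub>R u' x)"
      by (subst (asm) integrable_completion) measurable
  qed measurable
  moreover have "AE x in lborel. x \<in> \<Omega> \<longrightarrow> u x = u' x"
    using eq by eventually_elim auto
  ultimately show ?thesis by blast
qed

text \<open>\<open>\<psi>\<close> stands for a test function or one of its derivatives; it vanishes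
  off \<Omega>, so the values of \<open>f\<close> and \<open>g\<close> there do not matter.\<close>

lemma set_integral_lebesgue_eq_lborel:
  fixes f g :: "real^'n::finite \<Rightarrow> 'a::{banach, second_countable_topology}"
  assumes \<Omega>: "open \<Omega>" and f: "(\<lambda>x. indicator \<Omega> x *\<^sub>R f x) \<in> borel_measurable lebesgue"
    and g: "g \<in> borel_measurable borel" and ae: "AE x in lborel. x \<in> \<Omega> \<longrightarrow> f x = g x"
    and \<psi>: "\<psi> \<in> borel_measurable borel" "\<And>x. x \<notin> \<Omega> \<Longrightarrow> \<psi> x = 0"
  shows "(LINT x:\<Omega>|lebesgue. \<psi> x *\<^sub>R f x) = (\<integral>x. \<psi> x *\<^sub>R g x \<partial>lborel)"
proof -
  have m: "(\<lambda>x. \<psi> x *\<^sub>R g x) \<in> borel_measurable lborel" using g \<psi> by simp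
  have \<psi>m: "\<psi> \<in> borel_measurable lebesgue"
    using \<psi>(1) by (intro measurable_completion) simp
  have "(LINT x:\<Omega>|lebesgue. \<psi> x *\<^sub>R f x) = (\<integral>x. \<psi> x *\<^sub>R (indicator \<Omega> x *\<^sub>R f x) \<partial>lebesgue)"
    unfolding set_lebesgue_integral_def by (simp add: mult.commute)
  also have "\<dots> = (\<integral>x. \<psi> x *\<^sub>R g x \<partial>lebesgue)"
  proof (rule integral_cong_AE)
    show "(\<lambda>x. \<psi> x *\<^sub>R (indicator \<Omega> x *\<^sub>R f x)) \<in> borel_measurable lebesgue"
      by (intro borel_measurable_scaleR \<psi>m f)
    show "(\<lambda>x. \<psi> x *\<^sub>R g x) \<in> borel_measurable lebesgue" by (rule measurable_completion[OF m])
    show "AE x in lebesgue. \<psi> x *\<^sub>R (indicator \<Omega> x *\<^sub>R f x) = \<psi> x *\<^sub>R g x"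
      using AE_completion[OF ae] by eventually_elim (use \<psi>(2) in \<open>auto simp: indicator_def\<close>)
  qed
  also have "\<dots> = (\<integral>x. \<psi> x *\<^sub>R g x \<partial>lborel)" by (rule integral_completion[OF m])
  finally show ?thesis .
qed

lemma weak_multi_if_has_weak_deriv:
  fixes u :: "real^'n::{finite,linorder} \<Rightarrow> 'a::euclidean_space"
  assumes \<Omega>: "open \<Omega>" and w: "has_weak_deriv u \<alpha> w \<Omega>" and l: "loc_int \<Omega> u'" "loc_int \<Omega> w'"
    and ae: "AE x in lborel. x \<in> \<Omega> \<longrightarrow> u x = u' x" "AE x in lborel. x \<in> \<Omega> \<longrightarrow> w x = w' x"
  shows "weak_multi \<Omega> \<alpha> u' w'"
  unfolding weak_multi_def
proof (intro conjI l ballI)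
  fix \<phi> assume \<phi>: "\<phi> \<in> test_functions \<Omega>"
  have li: "locally_integrable_on u \<Omega>" "locally_integrable_on w \<Omega>" using w by (auto simp: has_weak_deriv_def)
  note t = test_function_measurable_support[OF \<phi>] test_function_measurable_support[OF multi_deriv_test_function[OF \<phi>]]
  have "(LINT x:\<Omega>|lebesgue. multi_deriv \<alpha> \<phi> x *\<^sub>R u x) = (- 1) ^ mi_order \<alpha> *\<^sub>R (LINT x:\<Omega>|lebesgue. \<phi> x *\<^sub>R w x)"
    using w \<phi> by (simp add: has_weak_deriv_def)
  then show "(\<integral>x. multi_deriv \<alpha> \<phi> x *\<^sub>R u' x \<partial>lborel) = (- 1) ^ mi_order \<alpha> *\<^sub>R (\<integral>x. \<phi> x *\<^sub>R w' x \<partial>lborel)"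
    using set_integral_lebesgue_eq_lborel[OF \<Omega> locally_integrable_measurable[OF \<Omega> li(1)] loc_intD(1)[OF l(1)] ae(1) t(3,4)]
      set_integral_lebesgue_eq_lborel[OF \<Omega> locally_integrable_measurable[OF \<Omega> li(2)] loc_intD(1)[OF l(2)] ae(2) t(1,2)]
    by simp
qed

lemma has_weak_deriv_if_weak_multi:
  fixes u :: "real^'n::{finite,linorder} \<Rightarrow> 'a::euclidean_space"
  assumes \<Omega>: "open \<Omega>" and w: "weak_multi \<Omega> \<alpha> u' w"
    and um: "(\<lambda>x. indicator \<Omega> x *\<^sub>R u x) \<in> borel_measurable lebesgue" and ae: "AE x in lborel. x \<in> \<Omega> \<longrightarrow> u x = u' x"
  shows "has_weak_deriv u \<alpha> w \<Omega>"
  unfolding has_weak_deriv_def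
proof (intro conjI ballI)
  note l = weak_multiD(1,2)[OF w]
  have leb: "integrable lebesgue (\<lambda>x. indicator K x *\<^sub>R h x)" if "loc_int \<Omega> h" "compact K" "K \<subseteq> \<Omega>" for h :: "(real, 'n) vec \<Rightarrow> 'a" and K
    using loc_intD[OF that(1)] that(2,3) by (subst integrable_completion) (auto simp: borel_compact)
  show "locally_integrable_on w \<Omega>"
    unfolding locally_integrable_on_def set_integrable_def using leb[OF l(2)] by blast
  show "locally_integrable_on u \<Omega>"
    unfolding locally_integrable_on_def set_integrable_def
  proof (intro allI impI)
    fix K assume K: "compact K \<and> K \<subseteq> \<Omega>"
    have Km: "(indicator K :: _ \<Rightarrow> real) \<in> borel_measurable lebesgue"
      using K by (intro measurable_completion borel_measurable_indicator) (auto simp: borel_compact)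
    have e: "(\<lambda>x. indicator K x *\<^sub>R u x) = (\<lambda>x. indicator K x *\<^sub>R (indicator \<Omega> x *\<^sub>R u x))"
      using K by (auto simp: indicator_def fun_eq_iff)
    show "integrable lebesgue (\<lambda>x. indicator K x *\<^sub>R u x)"
    proof (rule integrable_cong_AE_imp)
      show "integrable lebesgue (\<lambda>x. indicator K x *\<^sub>R u' x)" using leb[OF l(1)] K by blast
      show "(\<lambda>x. indicator K x *\<^sub>R u x) \<in> borel_measurable lebesgue"
        unfolding e by (intro borel_measurable_scaleR Km um)
      show "AE x in lebesgue. indicator K x *\<^sub>R u' x = indicator K x *\<^sub>R u x"
        using AE_completion[OF ae] by eventually_elim (use K in \<open>auto simp: indicator_def\<close>)
    qed
  qed
  fix \<phi> assume \<phi>: "\<phi> \<in> test_functions \<Omega>"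
  note t = test_function_measurable_support[OF \<phi>] test_function_measurable_support[OF multi_deriv_test_function[OF \<phi>]]
  have "locally_integrable_on w \<Omega>" by fact
  then show "(LINT x:\<Omega>|lebesgue. multi_deriv \<alpha> \<phi> x *\<^sub>R u x) = (- 1) ^ mi_order \<alpha> *\<^sub>R (LINT x:\<Omega>|lebesgue. \<phi> x *\<^sub>R w x)"
    using weak_multiD(3)[OF w \<phi>] set_integral_lebesgue_eq_lborel[OF \<Omega> um loc_intD(1)[OF l(1)] ae t(3,4)]
      set_integral_lebesgue_eq_lborel[OF \<Omega> locally_integrable_measurable[OF \<Omega>] loc_intD(1)[OF l(2)] _ t(1,2), of w]
    by simp
qed

lemma has_weak_deriv_weak_deriv: "has_weak_deriv u \<alpha> w \<Omega> \<Longrightarrow> has_weak_deriv u \<alpha> (weak_deriv \<Omega> \<alpha> u) \<Omega>"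
  unfolding weak_deriv_def by (rule someI[where P = "\<lambda>w. has_weak_deriv u \<alpha> w \<Omega>"])

text \<open>\<open>weak_deriv\<close> is a choice, so the derivative delivered by the Leibniz rule
  has to be identified with it. The fundamental lemma does this for Borel representatives.\<close>

lemma has_weak_deriv_unique:
  fixes u :: "real^'n::{finite,linorder} \<Rightarrow> 'a::euclidean_space"
  assumes \<Omega>: "open \<Omega>" and w: "has_weak_deriv u \<alpha> w1 \<Omega>" "has_weak_deriv u \<alpha> w2 \<Omega>"
  shows "AE x in lborel. x \<in> \<Omega> \<longrightarrow> w1 x = w2 x"
proof -
  have li: "locally_integrable_on u \<Omega>" "locally_integrable_on w1 \<Omega>" "locally_integrable_on w2 \<Omega>"
    using w by (auto simp: has_weak_deriv_def)
  obtain u' where u': "loc_int \<Omega> u'" "AE x in lborel. x \<in> \<Omega> \<longrightarrow> u x = u' x"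
    using borel_representative[OF \<Omega> li(1)] by blast
  obtain v1 where v1: "loc_int \<Omega> v1" "AE x in lborel. x \<in> \<Omega> \<longrightarrow> w1 x = v1 x"
    using borel_representative[OF \<Omega> li(2)] by blast
  obtain v2 where v2: "loc_int \<Omega> v2" "AE x in lborel. x \<in> \<Omega> \<longrightarrow> w2 x = v2 x"
    using borel_representative[OF \<Omega> li(3)] by blast
  note m1 = weak_multiD(3)[OF weak_multi_if_has_weak_deriv[OF \<Omega> w(1) u'(1) v1(1) u'(2) v1(2)]]
  note m2 = weak_multiD(3)[OF weak_multi_if_has_weak_deriv[OF \<Omega> w(2) u'(1) v2(1) u'(2) v2(2)]]
  have "AE x in lborel. x \<in> \<Omega> \<longrightarrow> v1 x = v2 x"
  proof (rule AE_eq_if_test_integrals_eq[OF \<Omega> v1(1) v2(1)])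
    fix \<phi> assume "\<phi> \<in> test_functions \<Omega>"
    from m1[OF this] m2[OF this]
    show "(\<integral>x. \<phi> x *\<^sub>R v1 x \<partial>lborel) = (\<integral>x. \<phi> x *\<^sub>R v2 x \<partial>lborel)" by simp
  qed
  with v1(2) v2(2) show ?thesis by eventually_elim auto
qed

text \<open>The formula of order \<beta> is applied to the test function
  \<open>partial_deriv i \<phi>\<close>; commuting derivatives turns it into the formula of order
  \<open>mi_Suc \<beta> i\<close>, and the signs differ by one factor -1.\<close>

lemma weak_partial_if_weak_multi:
  assumes 1: "weak_multi \<Omega> \<beta> f g" and 2: "weak_multi \<Omega> (mi_Suc \<beta> i) f h"
  shows "weak_partial \<Omega> i g h"
  unfolding weak_partial_def
proof (intro conjI ballI weak_multiD(2)[OF 1] weak_multiD(2)[OF 2])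
  fix \<phi> assume \<phi>: "\<phi> \<in> test_functions \<Omega>"
  let ?s = "(- 1) ^ mi_order \<beta> :: real"
  have s: "?s * ?s = 1" by (simp flip: power_mult_distrib)
  have "(\<integral>x. partial_deriv i \<phi> x *\<^sub>R g x \<partial>lborel) = ?s *\<^sub>R (?s *\<^sub>R (\<integral>x. partial_deriv i \<phi> x *\<^sub>R g x \<partial>lborel))"
    by (simp only: scaleR_scaleR s scaleR_one)
  also have "?s *\<^sub>R (\<integral>x. partial_deriv i \<phi> x *\<^sub>R g x \<partial>lborel) = (\<integral>x. multi_deriv \<beta> (partial_deriv i \<phi>) x *\<^sub>R f x \<partial>lborel)"
    by (rule weak_multiD(3)[OF 1 test_function_partial_deriv(1)[OF \<phi>], symmetric])
  also have "\<dots> = (\<integral>x. multi_deriv (mi_Suc \<beta> i) \<phi> x *\<^sub>R f x \<partial>lborel)"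
    by (simp only: multi_deriv_partial_deriv[OF test_functionD(1)[OF \<phi>]])
  also have "\<dots> = - (?s *\<^sub>R (\<integral>x. \<phi> x *\<^sub>R h x \<partial>lborel))"
    using weak_multiD(3)[OF 2 \<phi>] by (simp add: mi_order_Suc)
  also have "?s *\<^sub>R - (?s *\<^sub>R (\<integral>x. \<phi> x *\<^sub>R h x \<partial>lborel)) = - (\<integral>x. \<phi> x *\<^sub>R h x \<partial>lborel)"
    by (simp only: scaleR_minus_right scaleR_scaleR s scaleR_one)
  finally show "(\<integral>x. partial_deriv i \<phi> x *\<^sub>R g x \<partial>lborel) = - (\<integral>x. \<phi> x *\<^sub>R h x \<partial>lborel)" .
qed

text \<open>The converse passage, by which the derivatives of a product are built up one order at a
  time.\<close>

lemma weak_multi_Suc: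
  assumes 1: "weak_multi \<Omega> \<beta> f g" and 2: "weak_partial \<Omega> i g h"
  shows "weak_multi \<Omega> (mi_Suc \<beta> i) f h"
  unfolding weak_multi_def
proof (intro conjI ballI weak_multiD(1)[OF 1] weak_partialD(2)[OF 2])
  fix \<phi> assume \<phi>: "\<phi> \<in> test_functions \<Omega>"
  have "(\<integral>x. multi_deriv (mi_Suc \<beta> i) \<phi> x *\<^sub>R f x \<partial>lborel) = (\<integral>x. multi_deriv \<beta> (partial_deriv i \<phi>) x *\<^sub>R f x \<partial>lborel)"
    by (simp only: multi_deriv_partial_deriv[OF test_functionD(1)[OF \<phi>]])
  also have "\<dots> = (- 1) ^ mi_order \<beta> *\<^sub>R - (\<integral>x. \<phi> x *\<^sub>R h x \<partial>lborel)"
    using weak_multiD(3)[OF 1 test_function_partial_deriv(1)[OF \<phi>]] weak_partialD(3)[OF 2 \<phi>] by simp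
  finally show "(\<integral>x. multi_deriv (mi_Suc \<beta> i) \<phi> x *\<^sub>R f x \<partial>lborel) = (- 1) ^ mi_order (mi_Suc \<beta> i) *\<^sub>R (\<integral>x. \<phi> x *\<^sub>R h x \<partial>lborel)"
    by (simp add: mi_order_Suc)
qed

subsection \<open>The Leibniz rule\<close>

lemma weak_partial_sum_list:
  fixes F G :: "'z \<Rightarrow> real^'n::finite \<Rightarrow> 'a::{banach, second_countable_topology}"
  assumes "\<And>z. z \<in> set L \<Longrightarrow> weak_partial \<Omega> i (F z) (G z)"
  shows "weak_partial \<Omega> i (\<lambda>x. \<Sum>z\<leftarrow>L. F z x) (\<lambda>x. \<Sum>z\<leftarrow>L. G z x)"
  using assms
proof (induction L)
  case Nil
  show ?case by (auto simp: weak_partial_def loc_int_def)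
next
  case (Cons z L)
  let ?f = "\<lambda>x. \<Sum>z\<leftarrow>L. F z x" and ?g = "\<lambda>x. \<Sum>z\<leftarrow>L. G z x"
  have 1: "weak_partial \<Omega> i (F z) (G z)" and 2: "weak_partial \<Omega> i ?f ?g" using Cons by auto
  note w1 = weak_partialD[OF 1] and w2 = weak_partialD[OF 2]
  have l: "loc_int \<Omega> (\<lambda>x. a x + b x)" if "loc_int \<Omega> a" "loc_int \<Omega> b" for a b :: "real^'n \<Rightarrow> 'a"
    using that by (auto simp: loc_int_def scaleR_add_right)
  have "weak_partial \<Omega> i (\<lambda>x. F z x + ?f x) (\<lambda>x. G z x + ?g x)"
    unfolding weak_partial_def
  proof (intro conjI ballI l w1 w2)
    fix \<phi> assume \<phi>: "\<phi> \<in> test_functions \<Omega>"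
    note d\<phi> = test_function_partial_deriv(1)[OF \<phi>]
    show "(\<integral>x. partial_deriv i \<phi> x *\<^sub>R (F z x + ?f x) \<partial>lborel) = - (\<integral>x. \<phi> x *\<^sub>R (G z x + ?g x) \<partial>lborel)"
      using w1(3)[OF \<phi>] w2(3)[OF \<phi>]
        integrable_test_function_scaleR[OF w1(1) d\<phi>, of i] integrable_test_function_scaleR[OF w2(1) d\<phi>, of i]
        integrable_test_function_scaleR[OF w1(2) \<phi>] integrable_test_function_scaleR[OF w2(2) \<phi>]
      by (simp add: scaleR_add_right)
  qed
  then show ?case by simp
qed

text \<open>A list with repetitions takes the place of binomial coefficients: each further
  derivative turns every pair into two, hence the length. Only the orders and the number of terms
  enter the estimate.\<close>

lemma weak_multi_Leibniz:
  fixes W W' :: "('n::{finite,linorder} \<Rightarrow> nat) \<Rightarrow> (real, 'n) vec \<Rightarrow> 'a::{real_normed_field, euclidean_space}"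
  assumes W: "deriv_family l m W" "deriv_family l m W'" and M: "M \<le> m"
    and pair: "\<And>\<beta> \<gamma>. mi_order \<beta> + mi_order \<gamma> \<le> M \<Longrightarrow> loc_pairing (- singular_set l) (W \<beta>) (W' \<gamma>)"
    and \<alpha>: "mi_order \<alpha> \<le> M"
  shows "\<exists>L. (\<forall>(\<beta>, \<gamma>)\<in>set L. mi_order \<beta> + mi_order \<gamma> = mi_order \<alpha>) \<and> length L = 2 ^ mi_order \<alpha> \<and>
    weak_multi (- singular_set l) \<alpha> (\<lambda>x. W (\<lambda>_. 0) x * W' (\<lambda>_. 0) x) (\<lambda>x. \<Sum>(\<beta>, \<gamma>)\<leftarrow>L. W \<beta> x * W' \<gamma> x)"
  using \<alpha>
proof (induction "mi_order \<alpha>" arbitrary: \<alpha>)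
  case 0
  then have z: "\<alpha> = (\<lambda>_. 0)" by (auto simp: mi_order_def)
  have o: "mi_order (\<lambda>_ :: 'n. 0 :: nat) = 0" by (simp add: mi_order_def)
  have "loc_int (- singular_set l) (\<lambda>x. W (\<lambda>_. 0) x * W' (\<lambda>_. 0) x)"
    using W o by (intro loc_int_mult pair) (auto simp: deriv_family_def)
  then show ?case
    unfolding z by (intro exI[of _ "[(\<lambda>_. 0, \<lambda>_. 0)]"]) (simp add: o weak_multi_def multi_deriv_0)
next
  case (Suc k)
  have "mi_order \<alpha> = 0" if "\<And>i. \<alpha> i = 0" using that by (simp add: mi_order_def)
  then have "\<exists>i. \<alpha> i \<noteq> 0" using Suc.hyps(2) by (metis nat.distinct(1))
  then obtain i where i: "\<alpha> i \<noteq> 0" by blast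
  define \<alpha>' where "\<alpha>' = \<alpha>(i := \<alpha> i - 1)"
  have \<alpha>_eq: "\<alpha> = mi_Suc \<alpha>' i" using i by (auto simp: \<alpha>'_def)
  have k: "k = mi_order \<alpha>'" using Suc.hyps(2) unfolding \<alpha>_eq by (simp add: mi_order_Suc)
  have "mi_order \<alpha>' \<le> M" using Suc.prems Suc.hyps(2) k by simp
  from Suc.hyps(1)[OF k this] obtain L where
    L: "\<forall>(\<beta>, \<gamma>)\<in>set L. mi_order \<beta> + mi_order \<gamma> = mi_order \<alpha>'" "length L = 2 ^ mi_order \<alpha>'"
      "weak_multi (- singular_set l) \<alpha>' (\<lambda>x. W (\<lambda>_. 0) x * W' (\<lambda>_. 0) x) (\<lambda>x. \<Sum>(\<beta>, \<gamma>)\<leftarrow>L. W \<beta> x * W' \<gamma> x)"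
    by blast
  \<comment> \<open>In one half of the new list the derivative falls on the first factor, in the
    other half on the second.\<close>
  define L' where "L' = map (\<lambda>(\<beta>, \<gamma>). (mi_Suc \<beta> i, \<gamma>)) L @ map (\<lambda>(\<beta>, \<gamma>). (\<beta>, mi_Suc \<gamma> i)) L"
  have lt: "mi_order \<alpha>' < M" using Suc.prems Suc.hyps(2) k by simp
  have "weak_partial (- singular_set l) i (\<lambda>x. \<Sum>z\<leftarrow>L. (case z of (\<beta>, \<gamma>) \<Rightarrow> W \<beta> x * W' \<gamma> x))
    (\<lambda>x. \<Sum>z\<leftarrow>L. (case z of (\<beta>, \<gamma>) \<Rightarrow> W (mi_Suc \<beta> i) x * W' \<gamma> x + W \<beta> x * W' (mi_Suc \<gamma> i) x))"
  proof (rule weak_partial_sum_list)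
    fix z assume "z \<in> set L"
    then obtain \<beta> \<gamma> where z: "z = (\<beta>, \<gamma>)" and o: "mi_order \<beta> + mi_order \<gamma> = mi_order \<alpha>'"
      using L(1) by (cases z) auto
    have o': "mi_order \<beta> < m" "mi_order \<gamma> < m" using o lt M by auto
    have "weak_partial (- singular_set l) i (\<lambda>x. W \<beta> x * W' \<gamma> x) (\<lambda>x. W (mi_Suc \<beta> i) x * W' \<gamma> x + W \<beta> x * W' (mi_Suc \<gamma> i) x)"
      using W o' o lt by (intro weak_partial_mult open_singular_compl pair) (auto simp: deriv_family_def mi_order_Suc)
    then show "weak_partial (- singular_set l) i (\<lambda>x. case z of (\<beta>, \<gamma>) \<Rightarrow> W \<beta> x * W' \<gamma> x)
       (\<lambda>x. case z of (\<beta>, \<gamma>) \<Rightarrow> W (mi_Suc \<beta> i) x * W' \<gamma> x + W \<beta> x * W' (mi_Suc \<gamma> i) x)"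
      by (simp add: z)
  qed
  also have "(\<lambda>x. \<Sum>z\<leftarrow>L. (case z of (\<beta>, \<gamma>) \<Rightarrow> W (mi_Suc \<beta> i) x * W' \<gamma> x + W \<beta> x * W' (mi_Suc \<gamma> i) x)) =
      (\<lambda>x. \<Sum>(\<beta>, \<gamma>)\<leftarrow>L'. W \<beta> x * W' \<gamma> x)"
    by (simp add: L'_def split_beta' o_def sum_list_addf)
  finally have "weak_multi (- singular_set l) \<alpha> (\<lambda>x. W (\<lambda>_. 0) x * W' (\<lambda>_. 0) x) (\<lambda>x. \<Sum>(\<beta>, \<gamma>)\<leftarrow>L'. W \<beta> x * W' \<gamma> x)"
    unfolding \<alpha>_eq by (rule weak_multi_Suc[OF L(3)])
  moreover have "length L' = 2 ^ mi_order \<alpha>"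
    using L(2) by (simp add: L'_def \<alpha>_eq mi_order_Suc)
  moreover have "\<forall>(\<beta>, \<gamma>)\<in>set L'. mi_order \<beta> + mi_order \<gamma> = mi_order \<alpha>"
    using L(1) by (auto simp: L'_def \<alpha>_eq mi_order_Suc)
  ultimately show ?case by blast
qed

lemma wnorm_sum_list_le:
  fixes F :: "'z \<Rightarrow> real^'n::{finite,linorder} \<Rightarrow> 'a::euclidean_space"
  assumes [measurable]: "\<And>z. z \<in> set L \<Longrightarrow> F z \<in> borel_measurable borel" and q: "0 \<le> q" and B: "0 \<le> B"
    and le: "\<And>z. z \<in> set L \<Longrightarrow> wnorm l q e (F z) \<le> ennreal B"
  shows "wnorm l q e (\<lambda>x. \<Sum>z\<leftarrow>L. F z x) \<le> ennreal (real (length L) powr q * (real (length L) * B))"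
proof -
  let ?N = "length L" and ?I = "indicator (- singular_set l) :: (real, 'n) vec \<Rightarrow> ennreal"
  have m [measurable]: "F (L ! j) \<in> borel_measurable borel" if "j \<in> {..<?N}" for j using that assms(1) by simp
  have "wnorm l q e (\<lambda>x. \<Sum>z\<leftarrow>L. F z x) \<le>
    (\<integral>\<^sup>+x. ennreal (real ?N powr q) * (\<Sum>j<?N. ?I x * ennreal ((rho l x powr e * norm (F (L ! j) x)) powr q)) \<partial>lborel)"
    unfolding wnorm_def
  proof (intro nn_integral_mono)
    fix x
    have "(rho l x powr e * norm (\<Sum>z\<leftarrow>L. F z x)) powr q \<le> (\<Sum>j<?N. rho l x powr e * norm (F (L ! j) x)) powr q"
      using q norm_sum[of "\<lambda>j. F (L ! j) x" "{..<?N}"]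
      by (intro powr_mono2) (auto simp: sum_list_sum_nth atLeast0LessThan sum_distrib_left[symmetric] intro!: mult_left_mono)
    also have "\<dots> \<le> real (card {..<?N}) powr q * (\<Sum>j<?N. (rho l x powr e * norm (F (L ! j) x)) powr q)"
      by (intro sum_powr_le q) auto
    finally have "ennreal ((rho l x powr e * norm (\<Sum>z\<leftarrow>L. F z x)) powr q) \<le>
        ennreal (real ?N powr q * (\<Sum>j<?N. (rho l x powr e * norm (F (L ! j) x)) powr q))"
      by (simp add: ennreal_leI)
    also have "\<dots> = ennreal (real ?N powr q) * (\<Sum>j<?N. ennreal ((rho l x powr e * norm (F (L ! j) x)) powr q))"
      by (subst ennreal_mult) (auto intro: sum_nonneg)
    finally show "?I x * ennreal ((rho l x powr e * norm (\<Sum>z\<leftarrow>L. F z x)) powr q) \<le>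
        ennreal (real ?N powr q) * (\<Sum>j<?N. ?I x * ennreal ((rho l x powr e * norm (F (L ! j) x)) powr q))"
      by (cases "x \<in> - singular_set l") simp_all
  qed
  also have "\<dots> = ennreal (real ?N powr q) * (\<Sum>j<?N. wnorm l q e (F (L ! j)))"
    unfolding wnorm_def by (subst nn_integral_cmult, measurable, subst nn_integral_sum, measurable)
  also have "\<dots> \<le> ennreal (real ?N powr q) * (\<Sum>j<?N. ennreal B)"
    by (intro mult_left_mono sum_mono le) auto
  also have "\<dots> = ennreal (real ?N powr q * (real ?N * B))"
    using B by (simp add: ennreal_of_nat_eq_real_of_nat ennreal_mult[symmetric])
  finally show ?thesis .
qed

subsection \<open>Multiplication in Kondratiev spaces\<close>

text \<open>The bridge from the integrand of the norm, built on the chosen \<open>weak_deriv\<close>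
  and Lebesgue measure, to \<open>wnorm\<close> of an arbitrary representative.\<close>

lemma kondratiev_integrand_lebesgue:
  fixes u :: "real^'n::{finite,linorder} \<Rightarrow> 'a::euclidean_space"
  assumes w: "has_weak_deriv u \<alpha> w (- singular_set l)" and p: "0 < p"
    and v: "AE x in lborel. x \<in> - singular_set l \<longrightarrow> weak_deriv (- singular_set l) \<alpha> u x = v x"
  shows "(\<lambda>x. indicator (- singular_set l) x *\<^sub>R kondratiev_integrand a p l \<alpha> u x) \<in> borel_measurable lebesgue"
    and "(\<integral>\<^sup>+x. ennreal (indicator (- singular_set l) x *\<^sub>R kondratiev_integrand a p l \<alpha> u x) \<partial>lebesgue)
      = wnorm l p (real (mi_order \<alpha>) - a) v"
proof -
  let ?\<Omega> = "- singular_set l :: (real, 'n) vec set"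
  have "has_weak_deriv u \<alpha> (weak_deriv ?\<Omega> \<alpha> u) ?\<Omega>"
    by (rule has_weak_deriv_weak_deriv[OF w])
  then have "locally_integrable_on (weak_deriv ?\<Omega> \<alpha> u) ?\<Omega>" by (simp add: has_weak_deriv_def)
  note m = locally_integrable_measurable[OF open_singular_compl this]
  have "(\<lambda>x. rho l x powr (real (mi_order \<alpha>) - a)) \<in> borel_measurable lborel" by measurable
  then have r [measurable]: "(\<lambda>x. rho l x powr (real (mi_order \<alpha>) - a)) \<in> borel_measurable lebesgue"
    by (rule measurable_completion)
  define z where "z x = indicator ?\<Omega> x *\<^sub>R weak_deriv ?\<Omega> \<alpha> u x" for x
  have [measurable]: "z \<in> borel_measurable lebesgue" using m by (simp add: z_def[abs_def])
  have "(\<lambda>x. indicator ?\<Omega> x *\<^sub>R kondratiev_integrand a p l \<alpha> u x) =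
    (\<lambda>x. (rho l x powr (real (mi_order \<alpha>) - a) * norm (z x)) powr p)"
    by (auto simp: kondratiev_integrand_def indicator_def z_def)
  also have "\<dots> \<in> borel_measurable lebesgue" by measurable
  finally show "(\<lambda>x. indicator ?\<Omega> x *\<^sub>R kondratiev_integrand a p l \<alpha> u x) \<in> borel_measurable lebesgue" .
  have "(\<integral>\<^sup>+x. ennreal (indicator ?\<Omega> x *\<^sub>R kondratiev_integrand a p l \<alpha> u x) \<partial>lebesgue) =
    (\<integral>\<^sup>+x. ennreal (indicator ?\<Omega> x *\<^sub>R kondratiev_integrand a p l \<alpha> u x) \<partial>lborel)"
    by (rule nn_integral_completion)
  also have "\<dots> = wnorm l p (real (mi_order \<alpha>) - a) v"
    unfolding wnorm_def
  proof (rule nn_integral_cong_AE)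
    show "AE x in lborel. ennreal (indicator ?\<Omega> x *\<^sub>R kondratiev_integrand a p l \<alpha> u x) =
        indicator ?\<Omega> x * ennreal ((rho l x powr (real (mi_order \<alpha>) - a) * norm (v x)) powr p)"
      using v by eventually_elim (auto simp: indicator_def kondratiev_integrand_def)
  qed
  finally show "(\<integral>\<^sup>+x. ennreal (indicator ?\<Omega> x *\<^sub>R kondratiev_integrand a p l \<alpha> u x) \<partial>lebesgue)
      = wnorm l p (real (mi_order \<alpha>) - a) v" .
qed

lemma kondratiev_integrand_nonneg: "0 \<le> kondratiev_integrand a p l \<alpha> u x"
  by (simp add: kondratiev_integrand_def)

text \<open>Every derivative is bounded by the same number, because each summand of the norm is at
  most the whole sum of nonnegative terms.\<close>

lemma kondratiev_deriv_family:
  fixes u :: "real^'n::{finite,linorder} \<Rightarrow> 'a::euclidean_space"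
  assumes u: "u \<in> kondratiev_space m a p l" and p: "1 < p"
  shows "\<exists>W. deriv_family l m W \<and> (AE x in lborel. x \<in> - singular_set l \<longrightarrow> u x = W (\<lambda>_. 0) x) \<and>
    (\<forall>\<beta>. mi_order \<beta> \<le> m \<longrightarrow> wnorm l p (real (mi_order \<beta>) - a) (W \<beta>) \<le> ennreal (kondratiev_norm m a p l u powr p))"
proof -
  let ?\<Omega> = "- singular_set l :: (real, 'n) vec set" and ?w = "\<lambda>\<beta>. weak_deriv (- singular_set l) \<beta> u"
  have w: "has_weak_deriv u \<beta> (?w \<beta>) ?\<Omega>" if "mi_order \<beta> \<le> m" for \<beta>
  proof -
    have "\<exists>v. has_weak_deriv u \<beta> v ?\<Omega>" using u that by (simp add: kondratiev_space_def)
    then obtain v where "has_weak_deriv u \<beta> v ?\<Omega>" ..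
    then show ?thesis by (rule has_weak_deriv_weak_deriv)
  qed
  have "\<exists>v. mi_order \<beta> \<le> m \<longrightarrow> loc_int ?\<Omega> v \<and> (AE x in lborel. x \<in> ?\<Omega> \<longrightarrow> ?w \<beta> x = v x)" for \<beta>
  proof (cases "mi_order \<beta> \<le> m")
    case True
    have "locally_integrable_on (?w \<beta>) ?\<Omega>" using w[OF True] by (simp add: has_weak_deriv_def)
    then show ?thesis using borel_representative[OF open_singular_compl] by blast
  qed auto
  then have "\<exists>W. \<forall>\<beta>. mi_order \<beta> \<le> m \<longrightarrow> loc_int ?\<Omega> (W \<beta>) \<and> (AE x in lborel. x \<in> ?\<Omega> \<longrightarrow> ?w \<beta> x = W \<beta> x)"
    by (intro choice allI)
  then obtain W where W: "\<And>\<beta>. mi_order \<beta> \<le> m \<Longrightarrow> loc_int ?\<Omega> (W \<beta>)"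
    "\<And>\<beta>. mi_order \<beta> \<le> m \<Longrightarrow> AE x in lborel. x \<in> ?\<Omega> \<longrightarrow> ?w \<beta> x = W \<beta> x" by blast
  have o: "mi_order (\<lambda>_ :: 'n. 0 :: nat) = 0" by (simp add: mi_order_def)
  have li: "locally_integrable_on u ?\<Omega>" using w[of "\<lambda>_. 0"] o by (simp add: has_weak_deriv_def)
  obtain u' where u': "loc_int ?\<Omega> u'" "AE x in lborel. x \<in> ?\<Omega> \<longrightarrow> u x = u' x"
    using borel_representative[OF open_singular_compl li] by blast
  have wm: "weak_multi ?\<Omega> \<beta> u' (W \<beta>)" if "mi_order \<beta> \<le> m" for \<beta>
    by (rule weak_multi_if_has_weak_deriv[OF open_singular_compl w[OF that] u'(1) W(1)[OF that] u'(2) W(2)[OF that]])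
  \<comment> \<open>Even the weak derivative of order 0 is only some chosen function; testing
    identifies it with \<open>u\<close>.\<close>
  have "AE x in lborel. x \<in> ?\<Omega> \<longrightarrow> u' x = W (\<lambda>_. 0) x"
  proof (rule AE_eq_if_test_integrals_eq[OF open_singular_compl u'(1)])
    show "loc_int ?\<Omega> (W (\<lambda>_. 0))" using W(1) o by simp
    show "(\<integral>x. \<phi> x *\<^sub>R u' x \<partial>lborel) = (\<integral>x. \<phi> x *\<^sub>R W (\<lambda>_. 0) x \<partial>lborel)" if "\<phi> \<in> test_functions ?\<Omega>" for \<phi>
      using weak_multiD(3)[OF wm that, of "\<lambda>_. 0"] o by (simp add: multi_deriv_0)
  qed
  then have "AE x in lborel. x \<in> ?\<Omega> \<longrightarrow> u x = W (\<lambda>_. 0) x"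
    using u'(2) by eventually_elim auto
  moreover have "deriv_family l m W"
    unfolding deriv_family_def
    using W(1) weak_partial_if_weak_multi[OF wm wm] by (auto simp: mi_order_Suc)
  moreover have "wnorm l p (real (mi_order \<beta>) - a) (W \<beta>) \<le> ennreal (kondratiev_norm m a p l u powr p)"
    if \<beta>: "mi_order \<beta> \<le> m" for \<beta>
  proof -
    let ?J = "\<lambda>\<beta>. LINT x:?\<Omega>|lebesgue. kondratiev_integrand a p l \<beta> u x"
    have J0: "0 \<le> ?J \<beta>" for \<beta>
      unfolding set_lebesgue_integral_def
      by (intro Bochner_Integration.integral_nonneg) (simp add: kondratiev_integrand_nonneg)
    have int: "integrable lebesgue (\<lambda>x. indicator ?\<Omega> x *\<^sub>R kondratiev_integrand a p l \<beta> u x)"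
      using u \<beta> by (simp add: kondratiev_space_def set_integrable_def)
    have "wnorm l p (real (mi_order \<beta>) - a) (W \<beta>) =
        (\<integral>\<^sup>+x. ennreal (indicator ?\<Omega> x *\<^sub>R kondratiev_integrand a p l \<beta> u x) \<partial>lebesgue)"
      using p by (intro kondratiev_integrand_lebesgue(2)[OF w[OF \<beta>] _ W(2)[OF \<beta>], symmetric]) simp
    also have "\<dots> = ennreal (?J \<beta>)"
      unfolding set_lebesgue_integral_def
      by (intro nn_integral_eq_integral int) (simp add: kondratiev_integrand_nonneg)
    also have "\<dots> \<le> ennreal (\<Sum>\<beta> | mi_order \<beta> \<le> m. ?J \<beta>)"
      using \<beta> J0 finite_mi_order_le by (intro ennreal_leI member_le_sum) auto
    also have "(\<Sum>\<beta> | mi_order \<beta> \<le> m. ?J \<beta>) = kondratiev_norm m a p l u powr p"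
      using p sum_nonneg[of "{\<beta>. mi_order \<beta> \<le> m}" ?J] J0 by (simp add: kondratiev_norm_def powr_powr)
    finally show ?thesis .
  qed
  ultimately show ?thesis by blast
qed

text \<open>In a Leibniz term the factors have j = m0 - |\<beta>| and k = m0 - |\<gamma>|
  derivatives in reserve. As |\<beta>| + |\<gamma>| \<le> m1, these satisfy n \<le> (j + k) p, which
  is what \<open>wnorm_mult_le\<close> asks for.\<close>

lemma kondratiev_space_multiplication:
  fixes p a0 a1 :: real and m0 m1 l :: nat
  assumes p: "1 < p"
    and m0: "real m0 < real CARD('n::{finite,linorder}) / p"
    and m1: "real m1 \<le> 2 * real m0 - real CARD('n) / p"
    and a1: "a1 = 2 * (a0 - real CARD('n) / (2 * p))"
  shows "\<exists>K\<ge>0. \<forall>u \<in> kondratiev_space m0 a0 p l. \<forall>v \<in> kondratiev_space m0 a0 p l. \<forall>\<alpha>. mi_order \<alpha> \<le> m1 \<longrightarrow>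
    (\<exists>w. has_weak_deriv (\<lambda>x. u x * v x :: 'a::{real_normed_field, euclidean_space}) \<alpha> w (- singular_set l :: (real, 'n) vec set) \<and>
      wnorm l p (real (mi_order \<alpha>) - a1) w \<le> ennreal (K * (kondratiev_norm m0 a0 p l u * kondratiev_norm m0 a0 p l v) powr p))"
proof -
  let ?\<Omega> = "- singular_set l :: (real, 'n) vec set"
  define n where "n = real CARD('n)"
  have n0: "0 < n" by (simp add: n_def)
  have m0p: "real m0 * p < n" using m0 p by (simp add: n_def less_divide_eq)
  have m1p: "n \<le> (2 * real m0 - real m1) * p"
  proof -
    have "n / p \<le> 2 * real m0 - real m1" using m1 by (simp add: n_def)
    then show ?thesis using p by (simp add: divide_le_eq)
  qed
  \<comment> \<open>From m0 < n/p follows 2 m0 - n/p < m0. Hence neither factor of a Leibniz term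
    ever uses up all of its \<open>m0\<close> derivatives.\<close>
  have "real m1 < real m0" using m0 m1 by linarith
  then have m10: "m1 < m0" by simp
  obtain c where c: "1 \<le> c" and sob: "\<And>(W :: ('n \<Rightarrow> nat) \<Rightarrow> (real, 'n) vec \<Rightarrow> 'a) E k \<beta>. deriv_family l m0 W \<Longrightarrow> 0 \<le> E \<Longrightarrow>
    (\<And>\<beta>. mi_order \<beta> \<le> m0 \<Longrightarrow> wnorm l p (real (mi_order \<beta>) - a0) (W \<beta>) \<le> ennreal (E powr p)) \<Longrightarrow>
    mi_order \<beta> + k \<le> m0 \<Longrightarrow> wnorm l (sobolev_exponent n p k) (real (mi_order \<beta> + k) - a0) (W \<beta>)
       \<le> ennreal ((c * E) powr sobolev_exponent n p k)"
    using sobolev_iterate[where 'n = 'n and 'a = 'a, OF p m0p[unfolded n_def], of l a0] unfolding n_def by blast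
  define N where "N = (2::real) ^ m1"
  have N1: "1 \<le> N" by (simp add: N_def)
  \<comment> \<open>\<open>N\<close> bounds the number of Leibniz terms and enters through the p-th
    power of their sum; 3 comes from the product estimate and \<open>c * c\<close> from the two
    Sobolev bounds.\<close>
  define K where "K = N powr p * (N * 3 * (c * c) powr p)"
  have K0: "0 \<le> K" using N1 by (simp add: K_def)
  have "\<exists>w. has_weak_deriv (\<lambda>x. u x * v x) \<alpha> w ?\<Omega> \<and>
      wnorm l p (real (mi_order \<alpha>) - a1) w \<le> ennreal (K * (kondratiev_norm m0 a0 p l u * kondratiev_norm m0 a0 p l v) powr p)"
    if u: "u \<in> kondratiev_space m0 a0 p l" and v: "v \<in> kondratiev_space m0 a0 p l" and \<alpha>: "mi_order \<alpha> \<le> m1"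
    for u v :: "(real, 'n) vec \<Rightarrow> 'a" and \<alpha>
  proof -
    define A where "A = kondratiev_norm m0 a0 p l u"
    define B where "B = kondratiev_norm m0 a0 p l v"
    have A0: "0 \<le> A" and B0: "0 \<le> B" by (auto simp: A_def B_def kondratiev_norm_def)
    obtain W where W: "deriv_family l m0 W" "AE x in lborel. x \<in> ?\<Omega> \<longrightarrow> u x = W (\<lambda>_. 0) x"
      "\<And>\<beta>. mi_order \<beta> \<le> m0 \<Longrightarrow> wnorm l p (real (mi_order \<beta>) - a0) (W \<beta>) \<le> ennreal (A powr p)"
      using kondratiev_deriv_family[OF u p] unfolding A_def by blast
    obtain W' where W': "deriv_family l m0 W'" "AE x in lborel. x \<in> ?\<Omega> \<longrightarrow> v x = W' (\<lambda>_. 0) x"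
      "\<And>\<beta>. mi_order \<beta> \<le> m0 \<Longrightarrow> wnorm l p (real (mi_order \<beta>) - a0) (W' \<beta>) \<le> ennreal (B powr p)"
      using kondratiev_deriv_family[OF v p] unfolding B_def by blast
    have meas: "W \<beta> \<in> borel_measurable borel" "W' \<beta> \<in> borel_measurable borel" if "mi_order \<beta> \<le> m0" for \<beta>
      using W(1) W'(1) that loc_intD(1) unfolding deriv_family_def by blast+
    have exps: "1 \<le> j" "real j * p < n" "real k * p < n" "n \<le> real (j + k) * p"
      if "b + d \<le> m1" "j = m0 - b" "k = m0 - d" for b d j k
    proof -
      have bd: "b < m0" "d < m0" using that m10 by auto
      show "1 \<le> j" using bd that by simp
      have "real j * p \<le> real m0 * p" "real k * p \<le> real m0 * p" using that p by (auto intro!: mult_right_mono)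
      then show "real j * p < n" "real k * p < n" using m0p by auto
      have "2 * real m0 - real m1 \<le> real (j + k)" using that bd by (simp add: of_nat_diff)
      then have "(2 * real m0 - real m1) * p \<le> real (j + k) * p" using p by (intro mult_right_mono) auto
      then show "n \<le> real (j + k) * p" using m1p by simp
    qed
    have sob_fin: "wnorm l (sobolev_exponent n p k) (real (mi_order \<beta> + k) - a0) (Z \<beta>) < \<infinity>"
      if "deriv_family l m0 Z" "0 \<le> E" "\<And>\<beta>. mi_order \<beta> \<le> m0 \<Longrightarrow> wnorm l p (real (mi_order \<beta>) - a0) (Z \<beta>) \<le> ennreal (E powr p)"
        "mi_order \<beta> + k \<le> m0" for Z :: "('n \<Rightarrow> nat) \<Rightarrow> (real, 'n) vec \<Rightarrow> 'a" and E \<beta> k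
      using le_less_trans[OF sob[OF that] ennreal_less_top] by simp
    \<comment> \<open>The reciprocals of the two Sobolev exponents add up to at most 1/p, more than
      enough for local integrability of the product.\<close>
    have pair: "loc_pairing ?\<Omega> (W \<beta>) (W' \<gamma>)" if o: "mi_order \<beta> + mi_order \<gamma> \<le> m1" for \<beta> \<gamma>
    proof -
      define j k where "j = m0 - mi_order \<beta>" and "k = m0 - mi_order \<gamma>"
      note e = exps[OF o j_def k_def]
      let ?q = "sobolev_exponent n p j" and ?r = "sobolev_exponent n p k"
      have le: "mi_order \<beta> \<le> m0" "mi_order \<gamma> \<le> m0" using o m10 by auto
      have ge1: "1 \<le> sobolev_exponent n p i" if "real i * p < n" for i
      proof -
        have "n - real i * p \<le> n * 1" using p by simp
        also have "\<dots> \<le> n * p" using n0 p by (intro mult_left_mono) auto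
        finally show ?thesis using that by (simp add: sobolev_exponent_def le_divide_eq)
      qed
      have "1 / ?q + 1 / ?r = ((n - real j * p) + (n - real k * p)) / (n * p)"
        unfolding sobolev_exponent_def by (subst add_divide_distrib) simp
      also have "\<dots> \<le> n / (n * p)"
        using e(4) n0 p by (intro divide_right_mono) (auto simp: algebra_simps)
      also have "\<dots> \<le> 1" using n0 p by simp
      finally have y: "young_pair ?q ?r" using ge1[OF e(2)] ge1[OF e(3)] by (intro young_pairI)
      have "loc_int ?\<Omega> (\<lambda>x. norm (W \<beta> x) powr ?q)"
        by (rule loc_int_powr_weighted[OF meas(1)[OF le(1)], where e = "real (mi_order \<beta> + j) - a0"])
          (use ge1[OF e(2)] sob_fin[OF W(1) A0 W(3), of \<beta> j] le in \<open>auto simp: j_def wnorm_def\<close>)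
      moreover have "loc_int ?\<Omega> (\<lambda>x. norm (W' \<gamma> x) powr ?r)"
        by (rule loc_int_powr_weighted[OF meas(2)[OF le(2)], where e = "real (mi_order \<gamma> + k) - a0"])
          (use ge1[OF e(3)] sob_fin[OF W'(1) B0 W'(3), of \<gamma> k] le in \<open>auto simp: k_def wnorm_def\<close>)
      ultimately show ?thesis using y unfolding loc_pairing_def by blast
    qed
    have prod: "wnorm l p (real (mi_order \<beta> + mi_order \<gamma>) - a1) (\<lambda>x. W \<beta> x * W' \<gamma> x) \<le> ennreal (3 * (c * A * (c * B)) powr p)"
      if o: "mi_order \<beta> + mi_order \<gamma> \<le> m1" for \<beta> \<gamma>
    proof -
      define j k where "j = m0 - mi_order \<beta>" and "k = m0 - mi_order \<gamma>"
      note e = exps[OF o j_def k_def]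
      have le: "mi_order \<beta> \<le> m0" "mi_order \<gamma> \<le> m0" using o m10 by auto
      \<comment> \<open>\<open>wnorm_mult_le\<close> normalises by the norm bounds, which may be 0
        here; they are enlarged by \<open>t\<close>, and \<open>t\<close> then tends to 0.\<close>
      have eps: "wnorm l p (real (mi_order \<beta> + mi_order \<gamma>) - a1) (\<lambda>x. W \<beta> x * W' \<gamma> x) \<le> ennreal (3 * (c * (A + t) * (c * (B + t))) powr p)"
        if t: "0 < t" for t
      proof -
        have pos: "0 < A + t" "0 < B + t" using A0 B0 t by auto
        have mono: "ennreal (E powr p) \<le> ennreal ((E + t) powr p)" if "0 \<le> E" for E
          using that t p by (intro ennreal_leI powr_mono2) auto
        have WA: "\<And>\<beta>. mi_order \<beta> \<le> m0 \<Longrightarrow> wnorm l p (real (mi_order \<beta>) - a0) (W \<beta>) \<le> ennreal ((A + t) powr p)"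
          using order_trans[OF W(3) mono[OF A0]] by blast
        have WB: "\<And>\<beta>. mi_order \<beta> \<le> m0 \<Longrightarrow> wnorm l p (real (mi_order \<beta>) - a0) (W' \<beta>) \<le> ennreal ((B + t) powr p)"
          using order_trans[OF W'(3) mono[OF B0]] by blast
        have "wnorm l p (real (mi_order \<gamma>) - a0) (W' \<gamma>) \<le> ennreal ((B + t) powr p)"
          by (rule WB[OF le(2)])
        \<comment> \<open>As c \<ge> 1, the bound without any Sobolev step can share the constant of
          the other two.\<close>
        also have "\<dots> \<le> ennreal ((c * (B + t)) powr p)"
          using c pos p by (intro ennreal_leI powr_mono2) auto
        finally have V: "wnorm l p (real (mi_order \<gamma>) - a0) (W' \<gamma>) \<le> ennreal ((c * (B + t)) powr p)" .
        show ?thesis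
          unfolding a1
        proof (rule wnorm_mult_le[where j = j and k = k, OF meas(1)[OF le(1)] meas(2)[OF le(2)] p e[unfolded n_def]])
          show "0 < c * (A + t)" "0 < c * (B + t)" using c pos by auto
          show "wnorm l (sobolev_exponent (real CARD('n)) p j) (real (mi_order \<beta> + j) - a0) (W \<beta>) \<le> ennreal ((c * (A + t)) powr sobolev_exponent (real CARD('n)) p j)"
            unfolding n_def[symmetric] using pos le by (intro sob[OF W(1) _ WA]) (auto simp: j_def)
          show "wnorm l (sobolev_exponent (real CARD('n)) p k) (real (mi_order \<gamma> + k) - a0) (W' \<gamma>) \<le> ennreal ((c * (B + t)) powr sobolev_exponent (real CARD('n)) p k)"
            unfolding n_def[symmetric] using pos le by (intro sob[OF W'(1) _ WB]) (auto simp: k_def)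
        qed (rule V)
      qed
      have lim0: "(\<lambda>i. 1 / real (Suc i)) \<longlonglongrightarrow> 0" using LIMSEQ_Suc[OF lim_1_over_n] by simp
      have "(\<lambda>i. c * (A + 1 / real (Suc i)) * (c * (B + 1 / real (Suc i)))) \<longlonglongrightarrow> c * (A + 0) * (c * (B + 0))"
        by (intro tendsto_mult tendsto_add tendsto_const lim0)
      then have "(\<lambda>i. (c * (A + 1 / real (Suc i)) * (c * (B + 1 / real (Suc i)))) powr p) \<longlonglongrightarrow> (c * (A + 0) * (c * (B + 0))) powr p"
        using p A0 B0 c by (intro tendsto_powr'[OF _ tendsto_const]) auto
      then have "(\<lambda>i. ennreal (3 * (c * (A + 1 / real (Suc i)) * (c * (B + 1 / real (Suc i)))) powr p)) \<longlonglongrightarrow> ennreal (3 * (c * (A + 0) * (c * (B + 0))) powr p)"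
        by (intro tendsto_ennrealI tendsto_mult tendsto_const)
      then have "wnorm l p (real (mi_order \<beta> + mi_order \<gamma>) - a1) (\<lambda>x. W \<beta> x * W' \<gamma> x) \<le> ennreal (3 * (c * (A + 0) * (c * (B + 0))) powr p)"
        by (rule Lim_bounded2[where N = 0]) (use eps in simp)
      then show ?thesis by simp
    qed
    obtain L where L: "\<forall>(\<beta>, \<gamma>)\<in>set L. mi_order \<beta> + mi_order \<gamma> = mi_order \<alpha>" "length L = 2 ^ mi_order \<alpha>"
      "weak_multi ?\<Omega> \<alpha> (\<lambda>x. W (\<lambda>_. 0) x * W' (\<lambda>_. 0) x) (\<lambda>x. \<Sum>(\<beta>, \<gamma>)\<leftarrow>L. W \<beta> x * W' \<gamma> x)"
      using weak_multi_Leibniz[OF W(1) W'(1) _ pair \<alpha>] m10 by auto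
    have "u \<in> borel_measurable (lebesgue_on ?\<Omega>)" "v \<in> borel_measurable (lebesgue_on ?\<Omega>)"
      using u v by (auto simp: kondratiev_space_def)
    then have "(\<lambda>x. u x * v x) \<in> borel_measurable (lebesgue_on ?\<Omega>)" by simp
    then have um: "(\<lambda>x. indicator ?\<Omega> x *\<^sub>R (u x * v x)) \<in> borel_measurable lebesgue"
      using open_singular_compl by (subst (asm) borel_measurable_restrict_space_iff) auto
    have ae: "AE x in lborel. x \<in> ?\<Omega> \<longrightarrow> u x * v x = W (\<lambda>_. 0) x * W' (\<lambda>_. 0) x"
      using W(2) W'(2) by eventually_elim auto
    have hw: "has_weak_deriv (\<lambda>x. u x * v x) \<alpha> (\<lambda>x. \<Sum>(\<beta>, \<gamma>)\<leftarrow>L. W \<beta> x * W' \<gamma> x) ?\<Omega>"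
      by (rule has_weak_deriv_if_weak_multi[OF open_singular_compl L(3) um ae])
    let ?b = "3 * (c * A * (c * B)) powr p"
    have "wnorm l p (real (mi_order \<alpha>) - a1) (\<lambda>x. \<Sum>z\<leftarrow>L. (case z of (\<beta>, \<gamma>) \<Rightarrow> \<lambda>x. W \<beta> x * W' \<gamma> x) x)
        \<le> ennreal (real (length L) powr p * (real (length L) * ?b))"
    proof (rule wnorm_sum_list_le)
      fix z assume "z \<in> set L"
      then obtain \<beta> \<gamma> where z: "z = (\<beta>, \<gamma>)" and o: "mi_order \<beta> + mi_order \<gamma> = mi_order \<alpha>"
        using L(1) by (cases z) auto
      have le: "mi_order \<beta> \<le> m0" "mi_order \<gamma> \<le> m0" using o \<alpha> m10 by auto
      show "(case z of (\<beta>, \<gamma>) \<Rightarrow> \<lambda>x. W \<beta> x * W' \<gamma> x) \<in> borel_measurable borel"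
        using meas(1)[OF le(1)] meas(2)[OF le(2)] by (simp add: z)
      show "wnorm l p (real (mi_order \<alpha>) - a1) (case z of (\<beta>, \<gamma>) \<Rightarrow> \<lambda>x. W \<beta> x * W' \<gamma> x) \<le> ennreal ?b"
        using prod[of \<beta> \<gamma>] o \<alpha> by (simp add: z)
    qed (use p in auto)
    also have "\<dots> \<le> ennreal (N powr p * (N * ?b))"
    proof -
      have len: "real (length L) \<le> N"
        using power_increasing[OF \<alpha>, of "2::real"] by (simp add: L(2) N_def)
      then have "real (length L) powr p \<le> N powr p" using assms(1) by (intro powr_mono2) auto
      moreover have "real (length L) * ?b \<le> N * ?b" by (rule mult_right_mono[OF len]) simp
      ultimately have "real (length L) powr p * (real (length L) * ?b) \<le> N powr p * (N * ?b)"
        by (rule mult_mono) auto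
      then show ?thesis by (rule ennreal_leI)
    qed
    also have "N powr p * (N * ?b) = K * (A * B) powr p"
    proof -
      have "(c * A * (c * B)) powr p = (c * c) powr p * (A * B) powr p"
        using c A0 B0 by (simp add: powr_mult mult_ac)
      then show ?thesis by (simp add: K_def mult_ac)
    qed
    finally have "wnorm l p (real (mi_order \<alpha>) - a1) (\<lambda>x. \<Sum>(\<beta>, \<gamma>)\<leftarrow>L. W \<beta> x * W' \<gamma> x) \<le> ennreal (K * (A * B) powr p)"
      by (simp add: split_beta')
    then show ?thesis using hw unfolding A_def B_def by blast
  qed
  with K0 show ?thesis by blast
qed

theorem theorem34:
  fixes p a0 a1 :: real and m0 m1 l :: nat
  assumes "1 < p"
    and "1 \<le> m0"
    and "l < CARD('n::{finite,linorder})"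
    and "real CARD('n) / (2 * p) \<le> real m0"
    and "real m0 < real CARD('n) / p"
    and "real m1 \<le> 2 * real m0 - real CARD('n) / p"
    and "a1 = 2 * (a0 - real CARD('n) / (2 * p))"
  shows "\<exists>c::real.
    \<forall>u \<in> kondratiev_space m0 a0 p l. \<forall>v \<in> kondratiev_space m0 a0 p l.
      (\<lambda>x::real^'n::{finite,linorder}. u x * v x :: 'a::{real_normed_field,euclidean_space})
        \<in> kondratiev_space m1 a1 p l \<and>
      kondratiev_norm m1 a1 p l (\<lambda>x. u x * v x)
        \<le> c * kondratiev_norm m0 a0 p l u * kondratiev_norm m0 a0 p l v"
proof -
  let ?\<Omega> = "- singular_set l :: (real, 'n) vec set"
  obtain K where K: "0 \<le> K" and main: "\<And>(u :: (real, 'n) vec \<Rightarrow> 'a) v \<alpha>. u \<in> kondratiev_space m0 a0 p l \<Longrightarrow> v \<in> kondratiev_space m0 a0 p l \<Longrightarrow>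
      mi_order \<alpha> \<le> m1 \<Longrightarrow> \<exists>w. has_weak_deriv (\<lambda>x. u x * v x) \<alpha> w ?\<Omega> \<and>
      wnorm l p (real (mi_order \<alpha>) - a1) w \<le> ennreal (K * (kondratiev_norm m0 a0 p l u * kondratiev_norm m0 a0 p l v) powr p)"
    using kondratiev_space_multiplication[where 'n = 'n and 'a = 'a, OF assms(1,5,6,7), of l] by blast
  \<comment> \<open>Each of the \<open>M\<close> summands of the norm is at most \<open>K\<close>
    times the p-th power of the product of the norms; the p-th root then gives the constant (M
    K)^(1/p).\<close>
  define M where "M = real (card {\<alpha> :: 'n \<Rightarrow> nat. mi_order \<alpha> \<le> m1})"
  have "(\<lambda>x. u x * v x) \<in> kondratiev_space m1 a1 p l \<and>
      kondratiev_norm m1 a1 p l (\<lambda>x. u x * v x) \<le> (M * K) powr (1 / p) * kondratiev_norm m0 a0 p l u * kondratiev_norm m0 a0 p l v"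
    if u: "u \<in> kondratiev_space m0 a0 p l" and v: "v \<in> kondratiev_space m0 a0 p l"
    for u v :: "(real, 'n) vec \<Rightarrow> 'a"
  proof -
    let ?uv = "\<lambda>x. u x * v x" and ?A = "kondratiev_norm m0 a0 p l u" and ?B = "kondratiev_norm m0 a0 p l v"
    let ?I = "\<lambda>\<alpha> x. indicator ?\<Omega> x *\<^sub>R kondratiev_integrand a1 p l \<alpha> ?uv x"
    have AB: "0 \<le> ?A" "0 \<le> ?B" by (auto simp: kondratiev_norm_def)
    have I0: "0 \<le> ?I \<alpha> x" for \<alpha> x by (simp add: kondratiev_integrand_nonneg)
    \<comment> \<open>Integrability is proved along with the bound: the integral of a non-integrable
      function is 0 by convention, so a bound on the norm alone would carry no information.\<close>
    have deriv: "\<exists>w. has_weak_deriv ?uv \<alpha> w ?\<Omega>" and int: "integrable lebesgue (?I \<alpha>)"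
      and bound: "(\<integral>x. ?I \<alpha> x \<partial>lebesgue) \<le> K * (?A * ?B) powr p" if \<alpha>: "mi_order \<alpha> \<le> m1" for \<alpha>
    proof -
      obtain w where w: "has_weak_deriv ?uv \<alpha> w ?\<Omega>" "wnorm l p (real (mi_order \<alpha>) - a1) w \<le> ennreal (K * (?A * ?B) powr p)"
        using main[OF u v \<alpha>] by blast
      show "\<exists>w. has_weak_deriv ?uv \<alpha> w ?\<Omega>" using w(1) by blast
      have "has_weak_deriv ?uv \<alpha> (weak_deriv ?\<Omega> \<alpha> ?uv) ?\<Omega>"
        by (rule has_weak_deriv_weak_deriv[OF w(1)])
      from has_weak_deriv_unique[OF open_singular_compl this w(1)]
      have ae: "AE x in lborel. x \<in> ?\<Omega> \<longrightarrow> weak_deriv ?\<Omega> \<alpha> ?uv x = w x" .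
      note k = kondratiev_integrand_lebesgue[OF w(1) _ ae, of p a1]
      have nn: "(\<integral>\<^sup>+x. ennreal (?I \<alpha> x) \<partial>lebesgue) \<le> ennreal (K * (?A * ?B) powr p)"
        using k(2) w(2) assms(1) by simp
      show int: "integrable lebesgue (?I \<alpha>)"
      proof (rule integrableI_bounded)
        show "?I \<alpha> \<in> borel_measurable lebesgue" using k(1) assms(1) by simp
        have "(\<integral>\<^sup>+x. ennreal (norm (?I \<alpha> x)) \<partial>lebesgue) = (\<integral>\<^sup>+x. ennreal (?I \<alpha> x) \<partial>lebesgue)"
          using I0 by (intro nn_integral_cong) (simp add: kondratiev_integrand_nonneg)
        also have "\<dots> < \<infinity>" using le_less_trans[OF nn ennreal_less_top] by simp
        finally show "(\<integral>\<^sup>+x. ennreal (norm (?I \<alpha> x)) \<partial>lebesgue) < \<infinity>" .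
      qed
      have "ennreal (\<integral>x. ?I \<alpha> x \<partial>lebesgue) \<le> ennreal (K * (?A * ?B) powr p)"
        using nn nn_integral_eq_integral[OF int] I0 by simp
      then show "(\<integral>x. ?I \<alpha> x \<partial>lebesgue) \<le> K * (?A * ?B) powr p" using K by simp
    qed
    have "?uv \<in> kondratiev_space m1 a1 p l"
      using u v deriv int by (auto simp: kondratiev_space_def set_integrable_def)
    moreover have "kondratiev_norm m1 a1 p l ?uv \<le> (M * (K * (?A * ?B) powr p)) powr (1 / p)"
    proof -
      have "(\<Sum>\<alpha> | mi_order \<alpha> \<le> m1. \<integral>x. ?I \<alpha> x \<partial>lebesgue) \<le> (\<Sum>\<alpha> | mi_order (\<alpha> :: 'n \<Rightarrow> nat) \<le> m1. K * (?A * ?B) powr p)"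
        by (intro sum_mono bound) simp
      moreover have "0 \<le> (\<Sum>\<alpha> | mi_order \<alpha> \<le> m1. \<integral>x. ?I \<alpha> x \<partial>lebesgue)"
        by (intro sum_nonneg Bochner_Integration.integral_nonneg I0)
      ultimately show ?thesis
        unfolding kondratiev_norm_def[of m1] set_lebesgue_integral_def M_def using assms(1) by (intro powr_mono2) auto
    qed
    moreover have "(M * (K * (?A * ?B) powr p)) powr (1 / p) = (M * K) powr (1 / p) * ?A * ?B"
    proof -
      have "(M * (K * (?A * ?B) powr p)) powr (1 / p) = (M * K) powr (1 / p) * ((?A * ?B) powr p) powr (1 / p)"
        using K by (simp add: powr_mult M_def mult.assoc[symmetric])
      also have "((?A * ?B) powr p) powr (1 / p) = ?A * ?B"
        using AB assms(1) by (simp add: powr_powr)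
      finally show ?thesis by simp
    qed
    ultimately show ?thesis by simp
  qed
  then show ?thesis by blast
qed

end
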